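(* Let $n\ge1$, $\theta\in(0,2]$ and $p=p_\theta:=1+\theta/n$. If $\varphi\in\mathfrak L^{1,\infty}_{\rm ul}(\log\mathfrak L)^\alpha$ for some $\alpha>n/\theta$, then there exists $T>0$ such that problem (P) possesses a solution $u$ in $\mathbb R^n\times(0,T)$ satisfying $$\sup_{t\in(0,T)}|||u(t)|||_{1,n/\theta;T^{1/\theta}}+\sup_{t\in(0,T)} t^{\frac n\theta}\Big[\log\Big(e+\frac1t\Big)\Big]^{\frac n\theta}\|u(t)\|_{L^\infty}<\infty,$$ $\lim_{t\to+0}\|u(t)-S_\theta(t)\varphi\|_{\mathfrak L^{1,\infty}_{\rm ul}(\log\mathfrak L)^{\gamma}}=0$ for every $\gamma\in[0,n/\theta)$, and $u(t)\to\varphi$ as $t\to+0$ in the sense of distributions.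
   Context: Problem (P) is the Cauchy problem $\partial_t u+(-\Delta)^{\theta/2}u=|u|^{p-1}u$ in $\mathbb R^n\times(0,\infty)$, $u(x,0)=\varphi(x)$. Let $G_\theta$ be the fundamental solution of $\partial_t v+(-\Delta)^{\theta/2}v=0$ and $(S_\theta(t)\varphi)(x)=\int G_\theta(x-y,t)\varphi(y)\,dy$. With $F_p(s)=|s|^{p-1}s$, a measurable a.e. finite $u$ on $\mathbb R^n\times(0,T)$ is a solution of (P) in $\mathbb R^n\times(0,T)$ if for a.a. $(x,t)$: $y\mapsto G_\theta(x-y,t)\varphi(y)$ is integrable, $(y,s)\mapsto G_\theta(x-y,t-s)F_p(u(y,s))$ is integrable on $\mathbb R^n\times(0,t)$, and $u(x,t)=[S_\theta(t)\varphi](x)+\int_0^t[S_\theta(t-s)F_p(u(s))](x)\,ds$. For $q\in[1,\infty)$, $\alpha\ge0$, $f\in L^1_{\rm loc}$: $\|f\|_{\mathfrak L^{q,\infty}(\log\mathfrak L)^\alpha}:=\sup_{s>0}\{[\log(e+1/s)]^\alpha\sup_{|E|=s}\int_E|f|^q\,dx\}^{1/q}$ (sup over measurable $E$ with $|E|=s$); $|||f|||_{q,\alpha;\rho}:=\sup_{z\in\mathbb R^n}\|f\chi_{B(z,\rho)}\|_{\mathfrak L^{q,\infty}(\log\mathfrak L)^\alpha}$ for $\rho>0$; $\mathfrak L^{q,\infty}_{\rm ul}(\log\mathfrak L)^\alpha$ is the set of $f\in L^1_{\rm loc}$ with $\|f\|_{\mathfrak L^{q,\infty}_{\rm ul}(\log\mathfrak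 L)^\alpha}:=|||f|||_{q,\alpha;1}<\infty$. *)

theory Defs
  imports "HOL-Analysis.Analysis" "HOL-Probability.Probability"
begin

text \<open>Fundamental solution of d/dt v + (-Delta)^(theta/2) v = 0 on R^n (n = CARD('n)),
  given via the inverse Fourier transform of exp(-t |xi|^theta):
  G(x,t) = (2 pi)^(-n) int cos(x . xi) exp(-t |xi|^theta) d xi  (the sine part vanishes by symmetry).\<close>
definition fund_sol :: "real \<Rightarrow> real^'n \<Rightarrow> real \<Rightarrow> real" where
  "fund_sol \<theta> x t =
     (2 * pi) powr (- real CARD('n)) *
     (\<integral>\<xi>. cos (x \<bullet> \<xi>) * exp (- t * norm \<xi> powr \<theta>) \<partial>lebesgue)"

definition semigroup :: "real \<Rightarrow> real \<Rightarrow> (real^'n \<Rightarrow> real) \<Rightarrow> real^'n \<Rightarrow> real" where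
  "semigroup \<theta> t \<phi> x = (\<integral>y. fund_sol \<theta> (x - y) t * \<phi> y \<partial>lebesgue)"

definition Fp :: "real \<Rightarrow> real \<Rightarrow> real" where
  "Fp p s = \<bar>s\<bar> powr (p - 1) * s"

definition is_solution ::
  "real \<Rightarrow> real \<Rightarrow> (real^'n \<Rightarrow> real) \<Rightarrow> real \<Rightarrow> (real^'n \<Rightarrow> real \<Rightarrow> real) \<Rightarrow> bool" where
  "is_solution \<theta> p \<phi> T u \<longleftrightarrow>
     (\<lambda>z. u (fst z) (snd z)) \<in> borel_measurable lebesgue \<and>
     (AE z in lebesgue. snd z \<in> {0<..<T} \<longrightarrow>
        (let x = fst z; t = snd z in
           integrable lebesgue (\<lambda>y. fund_sol \<theta> (x - y) t * \<phi> y) \<and>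
           set_integrable lebesgue (UNIV \<times> {0<..<t})
              (\<lambda>w. fund_sol \<theta> (x - fst w) (t - snd w) * Fp p (u (fst w) (snd w))) \<and>
           u x t = semigroup \<theta> t \<phi> x +
              (LINT w : UNIV \<times> {0<..<t} | lebesgue.
                 fund_sol \<theta> (x - fst w) (t - snd w) * Fp p (u (fst w) (snd w)))))"

definition enn_root :: "real \<Rightarrow> ennreal \<Rightarrow> ennreal" where
  "enn_root q X = (if X = \<top> then \<top> else ennreal (enn2real X powr (1 / q)))"

definition logweak_norm :: "real \<Rightarrow> real \<Rightarrow> ('a::euclidean_space \<Rightarrow> real) \<Rightarrow> ennreal" where
  "logweak_norm q \<alpha> f =
     (SUP s \<in> {0<..}. enn_root q
        (ennreal (ln (exp 1 + 1 / s) powr \<alpha>) *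
         (SUP E \<in> {E \<in> sets lebesgue. emeasure lebesgue E = ennreal s}.
            (\<integral>\<^sup>+ x \<in> E. ennreal (\<bar>f x\<bar> powr q) \<partial>lebesgue))))"

definition ul_norm :: "real \<Rightarrow> real \<Rightarrow> real \<Rightarrow> ('a::euclidean_space \<Rightarrow> real) \<Rightarrow> ennreal" where
  "ul_norm q \<alpha> \<rho> f = (SUP z. logweak_norm q \<alpha> (\<lambda>x. f x * indicator (ball z \<rho>) x))"

definition locally_integrable :: "('a::euclidean_space \<Rightarrow> real) \<Rightarrow> bool" where
  "locally_integrable f \<longleftrightarrow> f \<in> borel_measurable lebesgue \<and>
     (\<forall>K. compact K \<longrightarrow> set_integrable lebesgue K f)"

definition ul_space :: "real \<Rightarrow> real \<Rightarrow> ('a::euclidean_space \<Rightarrow> real) set" where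
  "ul_space q \<alpha> = {f. locally_integrable f \<and> ul_norm q \<alpha> 1 f < \<top>}"

coinductive_set smooth_fun :: "(real^'n \<Rightarrow> real) set" where
  "\<lbrakk>\<forall>x. f differentiable (at x);
    \<forall>i. (\<lambda>x. frechet_derivative f (at x) (axis i 1)) \<in> smooth_fun\<rbrakk> \<Longrightarrow> f \<in> smooth_fun"

definition test_fun :: "(real^'n \<Rightarrow> real) \<Rightarrow> bool" where
  "test_fun \<psi> \<longleftrightarrow> \<psi> \<in> smooth_fun \<and> compact (closure {x. \<psi> x \<noteq> 0})"

end

theory Submission
  imports Defs "HOL-Real_Asymp.Real_Asymp"
begin

text \<open>
  The kernel \<open>fund_sol \<theta> \<cdot> t\<close> is nonnegative and radially decreasing, because
  \<open>exp (- t r powr (\<theta> / 2))\<close> is a bounded pointwise limit of nonnegative combinations of the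
  functions \<open>r \<mapsto> exp (- s r)\<close>, whose values at \<open>r = |\<xi>|\<^sup>2\<close> are Gaussians. Fourier inversion gives
  total mass one and the semigroup property.

  Put \<open>W x t = (S(t) |\<phi>|) x\<close> and \<open>\<kappa> = n / \<theta>\<close>. Averaging over balls of radius \<open>t powr (1 / \<theta>)\<close> yields
  \<open>W x t \<le> C t powr (- \<kappa>) (ln (e + 1 / t)) powr (- \<alpha>)\<close>. Since \<open>p - 1 = 1 / \<kappa>\<close>, the factor \<open>W powr (p - 1)\<close>
  is bounded by \<open>C' s\<^sup>-\<^sup>1 (ln (e + 1 / s)) powr (- \<alpha> / \<kappa>)\<close>, which is integrable at \<open>s = 0\<close> exactly because
  \<open>\<alpha> > \<kappa>\<close>. As \<open>S(t - s) W(s) = W(t)\<close>, the Duhamel map is a contraction on \<open>{u. |u| \<le> 2 W}\<close> for the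
  pointwise weight \<open>W\<close> on short time intervals, and \<open>|u(t) - S(t) \<phi>| \<le> \<eta>(t) W(t)\<close> with \<open>\<eta>(t)\<close> tending to 0.
  All claims about \<open>u\<close> are thereby claims about \<open>W\<close>.
\<close>

section \<open>Gaussian integrals\<close>

text \<open>The kernel is given only as a cosine integral, which displays neither its sign nor its
  decay. Positivity has to come before everything else: it lets Fatou's lemma produce integrability
  of the kernel without any asymptotics, and it allows the later estimates to be made with
  nonnegative integrals, where the order of integration is free. A pointwise weight is preferred to
  a norm because space then drops out of the nonlinear estimate: a bound |g(s)| <= r(s) W(s) turns
  the Duhamel integral of g at time t into at most W(t) times the scalar integral of r over (0, t),
  and no smoothing estimate between function spaces is required. The norm of W(t) costs nothing:
  W(t) averages translates of the absolute value of the datum with total weight one, and the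
  uniformly local bound does not see translations. The claim speaks of Lebesgue measurable objects,
  whereas product arguments want Borel ones; so the datum is replaced by a Borel representative, and
  the completion returns only at the end.\<close>

lemma nn_integral_lborel_affine:
  fixes f :: "'a::euclidean_space \<Rightarrow> ennreal"
  assumes [measurable]: "f \<in> borel_measurable borel" and c: "c \<noteq> 0"
  shows "(\<integral>\<^sup>+x. f x \<partial>lborel) = ennreal (\<bar>c\<bar> ^ DIM('a)) * (\<integral>\<^sup>+x. f (a + c *\<^sub>R x) \<partial>lborel)"
  by (subst lborel_affine[OF c, of a])
     (simp add: nn_integral_density nn_integral_distr nn_integral_cmult)

lemma lborel_integral_affine:
  fixes f :: "'a::euclidean_space \<Rightarrow> real"
  assumes [measurable]: "f \<in> borel_measurable borel" and c: "c \<noteq> 0"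
  shows "(\<integral>x. f x \<partial>lborel) = \<bar>c\<bar> ^ DIM('a) * (\<integral>x. f (a + c *\<^sub>R x) \<partial>lborel)"
  by (subst lborel_affine[OF c, of a])
     (simp add: integral_density integral_distr)

text \<open>\<open>lborel_eq\<close> presents \<open>lborel\<close> as the image of a product of
  one-dimensional measures indexed by \<open>Basis\<close>, so this is the product theorem there.
  The values may lie in any normed field because the Gaussian case works with complex
  exponentials.\<close>

lemma lborel_integral_prod_Basis:
  fixes f :: "'a::euclidean_space \<Rightarrow> real \<Rightarrow> _::{real_normed_field,banach,second_countable_topology}"
  assumes f: "\<And>b. b \<in> Basis \<Longrightarrow> integrable lborel (f b)"
  shows "integrable lborel (\<lambda>x::'a. \<Prod>b\<in>Basis. f b (x \<bullet> b))"
    and "(\<integral>x. (\<Prod>b\<in>Basis. f b (x \<bullet> b)) \<partial>(lborel::'a measure)) = (\<Prod>b\<in>Basis. integral\<^sup>L lborel (f b))"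
proof -
  interpret product_sigma_finite "\<lambda>_::'a. lborel::real measure"
    by standard
  have [measurable]: "f b \<in> borel_measurable borel" if "b \<in> Basis" for b
    using f[OF that] by auto
  have m: "(\<lambda>x::'a. \<Prod>b\<in>Basis. f b (x \<bullet> b)) \<in> borel_measurable borel"
    by measurable
  have eq: "(\<Prod>b\<in>Basis. f b ((\<Sum>b\<in>Basis. y b *\<^sub>R b) \<bullet> b)) = (\<Prod>b\<in>Basis. f b (y b))" for y :: "'a \<Rightarrow> real"
    by (intro prod.cong refl) simp
  show "integrable lborel (\<lambda>x::'a. \<Prod>b\<in>Basis. f b (x \<bullet> b))"
    by (subst lborel_eq, subst integrable_distr_eq)
       (simp_all add: m eq product_integrable_prod f del: inner_sum_left)
  show "(\<integral>x. (\<Prod>b\<in>Basis. f b (x \<bullet> b)) \<partial>(lborel::'a measure)) = (\<Prod>b\<in>Basis. integral\<^sup>L lborel (f b))"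
    by (subst lborel_eq, subst integral_distr)
       (simp_all add: m eq product_integral_prod f del: inner_sum_left)
qed

text \<open>Rescaling by \<open>c = sqrt (2 * s)\<close> turns the Gaussian into the standard normal
  density, whose characteristic function is known; the prefactor \<open>sqrt (pi / s)\<close> is
  \<open>sqrt (2 * pi) / c\<close>.\<close>

lemma gaussian_fourier_real:
  fixes a s :: real
  assumes s: "0 < s"
  shows "integrable lborel (\<lambda>y. iexp (a * y) * complex_of_real (exp (- s * y\<^sup>2)))"
    and "(\<integral>y. iexp (a * y) * complex_of_real (exp (- s * y\<^sup>2)) \<partial>lborel)
         = complex_of_real (sqrt (pi / s) * exp (- a\<^sup>2 / (4 * s)))"
proof -
  define c where "c = sqrt (2 * s)"
  have c: "c > 0" "c\<^sup>2 = 2 * s"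
    using s by (auto simp: c_def)
  define F where "F = (\<lambda>x. std_normal_density x *\<^sub>R iexp (a / c * x))"
  have F: "F (0 + c * y) = complex_of_real (1 / sqrt (2 * pi)) * (iexp (a * y) * complex_of_real (exp (- s * y\<^sup>2)))" for y
    using c by (simp add: F_def normal_density_def scaleR_conv_of_real power_mult_distrib)
  have eqF: "iexp (a * y) * complex_of_real (exp (- s * y\<^sup>2)) = complex_of_real (sqrt (2 * pi)) * F (0 + c * y)" for y
    unfolding F mult.assoc[symmetric] by (simp flip: of_real_mult)
  have "integrable lborel (\<lambda>x. norm (F x))"
    unfolding F_def by (simp add: integrable_std_normal_moment[of 0, simplified])
  then have iF: "integrable lborel F"
    by (rule integrable_norm_cancel) (simp add: F_def)
  have "char std_normal_distribution (a / c) = (\<integral>x. F x \<partial>lborel)"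
    unfolding char_def F_def by (subst integral_density) auto
  then have IF: "(\<integral>x. F x \<partial>lborel) = complex_of_real (exp (- a\<^sup>2 / (4 * s)))"
    using c by (simp add: char_std_normal_distribution power_divide)
  have "integrable lborel (\<lambda>y. F (0 + c * y))"
    using iF c lborel_integrable_real_affine[of F c 0] by simp
  then show "integrable lborel (\<lambda>y. iexp (a * y) * complex_of_real (exp (- s * y\<^sup>2)))"
    unfolding eqF by (rule integrable_mult_right)
  have "(\<integral>x. F x \<partial>lborel) = \<bar>c\<bar> *\<^sub>R (\<integral>y. F (0 + c * y) \<partial>lborel)"
    using c by (intro lborel_integral_real_affine) auto
  then have "(\<integral>y. F (0 + c * y) \<partial>lborel) = complex_of_real (exp (- a\<^sup>2 / (4 * s)) / c)"
    using c IF by (simp add: field_simps scaleR_conv_of_real)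
  moreover have "sqrt (2 * pi) / c = sqrt (pi / s)"
    using s by (simp add: c_def real_sqrt_mult real_sqrt_divide)
  then have "sqrt (pi / s) * exp (- a\<^sup>2 / (4 * s)) = sqrt (2 * pi) * (exp (- a\<^sup>2 / (4 * s)) / c)"
    by (metis times_divide_eq_left times_divide_eq_right)
  ultimately show "(\<integral>y. iexp (a * y) * complex_of_real (exp (- s * y\<^sup>2)) \<partial>lborel)
         = complex_of_real (sqrt (pi / s) * exp (- a\<^sup>2 / (4 * s)))"
    unfolding eqF by (simp only: integral_mult_right_zero of_real_mult)
qed

text \<open>The cosine of \<open>x \<bullet> \<xi>\<close> does not factor over the coordinates, but
  the complex exponential does; the real part is taken only after the product of the one-dimensional
  transforms has been formed.\<close>

lemma gaussian_fourier:
  fixes x :: "'a::euclidean_space"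
  assumes s: "0 < s"
  shows integrable_gaussian: "integrable lborel (\<lambda>\<xi>::'a. exp (- s * (norm \<xi>)\<^sup>2))"
    and gaussian_cos_integral: "(\<integral>\<xi>. cos (x \<bullet> \<xi>) * exp (- s * (norm \<xi>)\<^sup>2) \<partial>lborel)
         = sqrt (pi / s) ^ DIM('a) * exp (- (norm x)\<^sup>2 / (4 * s))"
proof -
  define f where "f = (\<lambda>(x::'a) b y. iexp ((x \<bullet> b) * y) * complex_of_real (exp (- s * y\<^sup>2)))"
  have nsq: "(norm \<xi>)\<^sup>2 = (\<Sum>b\<in>Basis. (\<xi> \<bullet> b)\<^sup>2)" for \<xi> :: 'a
    by (subst power2_norm_eq_inner, subst euclidean_inner) (simp add: power2_eq_square)
  have eq: "(\<Prod>b\<in>Basis. f x b (\<xi> \<bullet> b)) = iexp (x \<bullet> \<xi>) * complex_of_real (exp (- s * (norm \<xi>)\<^sup>2))" for x \<xi> :: 'a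
    unfolding f_def prod.distrib nsq
    by (subst euclidean_inner) (simp add: sum_distrib_left exp_sum flip: sum_negf)
  have i: "integrable lborel (f x b)" for x b
    unfolding f_def by (rule gaussian_fourier_real[OF s])
  have I1: "integrable lborel (\<lambda>\<xi>::'a. iexp (x \<bullet> \<xi>) * complex_of_real (exp (- s * (norm \<xi>)\<^sup>2)))" for x :: 'a
    using lborel_integral_prod_Basis(1)[of "f x", OF i] unfolding eq .
  show "integrable lborel (\<lambda>\<xi>::'a. exp (- s * (norm \<xi>)\<^sup>2))"
    using integrable_Re[OF I1[of 0]] by simp
  have "(\<integral>\<xi>. iexp (x \<bullet> \<xi>) * complex_of_real (exp (- s * (norm \<xi>)\<^sup>2)) \<partial>lborel)
      = (\<Prod>b\<in>Basis. complex_of_real (sqrt (pi / s) * exp (- (x \<bullet> b)\<^sup>2 / (4 * s))))"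
    using lborel_integral_prod_Basis(2)[of "f x", OF i] unfolding eq
    unfolding f_def gaussian_fourier_real(2)[OF s] .
  also have "\<dots> = complex_of_real (sqrt (pi / s) ^ DIM('a) * exp (- (norm x)\<^sup>2 / (4 * s)))"
    by (simp add: prod.distrib nsq exp_sum sum_divide_distrib flip: sum_negf of_real_prod)
  finally have "Re (\<integral>\<xi>. iexp (x \<bullet> \<xi>) * complex_of_real (exp (- s * (norm \<xi>)\<^sup>2)) \<partial>lborel)
      = sqrt (pi / s) ^ DIM('a) * exp (- (norm x)\<^sup>2 / (4 * s))"
    by (simp del: of_real_mult of_real_power)
  then show "(\<integral>\<xi>. cos (x \<bullet> \<xi>) * exp (- s * (norm \<xi>)\<^sup>2) \<partial>lborel)
         = sqrt (pi / s) ^ DIM('a) * exp (- (norm x)\<^sup>2 / (4 * s))"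
    by (subst (asm) integral_Re[OF I1, symmetric]) (simp add: Re_exp)
qed

section \<open>Radial monotonicity of the fractional heat kernel\<close>

lemma integrable_lborel_inverse_1_plus_square: "integrable lborel (\<lambda>x::real. inverse (1 + x\<^sup>2))"
  using integrable_inverse_1_plus_square by (simp add: set_integrable_def einterval_def)

text \<open>The exponential beats every power of the norm, so \<open>q\<close> is bounded: it tends
  to 0 at infinity and is continuous on the remaining compact interval. This gives a multiple of the
  tensor product of \<open>inverse (1 + y\<^sup>2)\<close> as majorant, integrable coordinate by
  coordinate and without polar coordinates.\<close>

lemma integrable_exp_neg_norm_powr:
  assumes t: "0 < t" and \<theta>: "0 < \<theta>"
  shows "integrable lborel (\<lambda>\<xi>::'a::euclidean_space. exp (- t * norm \<xi> powr \<theta>))"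
proof -
  define q where "q = (\<lambda>r::real. (1 + r\<^sup>2) ^ DIM('a) * exp (- t * r powr \<theta>))"
  have "(q \<longlongrightarrow> 0) at_top"
    unfolding q_def using t \<theta> by real_asymp
  then have "\<forall>\<^sub>F r in at_top. q r < 1"
    by (rule order_tendstoD) simp
  then obtain R where R: "\<And>r. r \<ge> R \<Longrightarrow> q r < 1"
    by (auto simp: eventually_at_top_linorder)
  have "continuous_on {0..max 0 R} q"
    unfolding q_def using \<theta> by (intro continuous_intros continuous_on_powr') auto
  then have "bounded (q ` {0..max 0 R})"
    by (intro compact_imp_bounded compact_continuous_image) auto
  then obtain B where B: "\<And>r. r \<in> {0..max 0 R} \<Longrightarrow> \<bar>q r\<bar> \<le> B"
    unfolding bounded_iff by (metis imageI real_norm_def)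
  have qB: "q r \<le> max 1 B" if "r \<ge> 0" for r
  proof (cases "r \<ge> R")
    case True
    then show ?thesis using R[of r] by simp
  next
    case False
    then have "\<bar>q r\<bar> \<le> B" using that by (intro B) auto
    then show ?thesis by simp
  qed
  have bnd: "exp (- t * norm \<xi> powr \<theta>) \<le> max 1 B * (\<Prod>b\<in>Basis. inverse (1 + (\<xi> \<bullet> b)\<^sup>2))" for \<xi> :: 'a
  proof -
    have "(\<Prod>b\<in>Basis. 1 + (\<xi> \<bullet> b)\<^sup>2) \<le> (\<Prod>b\<in>(Basis::'a set). 1 + (norm \<xi>)\<^sup>2)"
      using Basis_le_norm by (intro prod_mono) (auto intro!: abs_le_square_iff[THEN iffD1])
    then have "(\<Prod>b\<in>Basis. 1 + (\<xi> \<bullet> b)\<^sup>2) \<le> (1 + (norm \<xi>)\<^sup>2) ^ DIM('a)"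
      by simp
    then have "(\<Prod>b\<in>Basis. 1 + (\<xi> \<bullet> b)\<^sup>2) * exp (- t * norm \<xi> powr \<theta>) \<le> q (norm \<xi>)"
      unfolding q_def by (intro mult_right_mono) auto
    also have "\<dots> \<le> max 1 B" by (rule qB) simp
    finally have "(\<Prod>b\<in>Basis. 1 + (\<xi> \<bullet> b)\<^sup>2) * exp (- t * norm \<xi> powr \<theta>) \<le> max 1 B" .
    moreover have "(\<Prod>b\<in>Basis. 1 + (\<xi> \<bullet> b)\<^sup>2) > 0"
      by (intro prod_pos) (auto intro: add_pos_nonneg)
    ultimately have "exp (- t * norm \<xi> powr \<theta>) \<le> max 1 B / (\<Prod>b\<in>Basis. 1 + (\<xi> \<bullet> b)\<^sup>2)"
      by (subst pos_le_divide_eq) (simp_all only: mult.commute)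
    then show ?thesis
      using prod_inversef[of "\<lambda>b. 1 + (\<xi> \<bullet> b)\<^sup>2" Basis] by (simp only: divide_inverse o_def)
  qed
  have int: "integrable lborel (\<lambda>\<xi>::'a. max 1 B * (\<Prod>b\<in>Basis. inverse (1 + (\<xi> \<bullet> b)\<^sup>2)))"
    by (intro integrable_mult_right lborel_integral_prod_Basis(1)[where f="\<lambda>_ y. inverse (1 + y\<^sup>2)"]
        integrable_lborel_inverse_1_plus_square)
  show ?thesis
  proof (rule Bochner_Integration.integrable_bound[OF int])
    show "AE \<xi>::'a in lborel. norm (exp (- t * norm \<xi> powr \<theta>)) \<le> norm (max 1 B * (\<Prod>b\<in>Basis. inverse (1 + (\<xi> \<bullet> b)\<^sup>2)))"
      using bnd by (intro AE_I2) (simp only: real_norm_def abs_exp_cancel order_trans[OF _ abs_ge_self])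
  qed simp
qed

text \<open>Nonnegativity is part of the notion, so that a single property passes to sums and
  pointwise limits. Points of equal norm give the inequality both ways, hence radial symmetry is
  included.\<close>

definition radially_decreasing :: "('a::real_normed_vector \<Rightarrow> real) \<Rightarrow> bool" where
  "radially_decreasing h \<longleftrightarrow> (\<forall>x y. norm x \<le> norm y \<longrightarrow> 0 \<le> h y \<and> h y \<le> h x)"

lemma radially_decreasing_limit:
  assumes "\<And>k. radially_decreasing (h k)" "\<And>x. (\<lambda>k. h k x) \<longlonglongrightarrow> g x"
  shows "radially_decreasing g"
  unfolding radially_decreasing_def
proof (intro allI impI)
  fix x y :: 'a assume "norm x \<le> norm y"
  then have "0 \<le> h k y" "h k y \<le> h k x" for k
    using assms(1)[of k] by (auto simp: radially_decreasing_def)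
  then show "0 \<le> g y \<and> g y \<le> g x"
    by (intro conjI LIMSEQ_le_const[OF assms(2)] LIMSEQ_le[OF assms(2) assms(2)]) auto
qed

text \<open>The Gaussian factor makes the transform of every bounded \<open>f\<close> absolutely
  convergent, including the constants that occur in exponential series. It is removed at the end by
  letting \<open>\<eta>\<close> tend to 0.\<close>

definition radial_ft :: "(real \<Rightarrow> real) \<Rightarrow> real \<Rightarrow> 'a::euclidean_space \<Rightarrow> real" where
  "radial_ft f \<eta> x = (\<integral>\<xi>. cos (x \<bullet> \<xi>) * (f ((norm \<xi>)\<^sup>2) * exp (- \<eta> * (norm \<xi>)\<^sup>2)) \<partial>lborel)"

lemma integrable_radial_ft:
  fixes x :: "'a::euclidean_space"
  assumes [measurable]: "f \<in> borel_measurable borel" and B: "\<And>r. r > 0 \<Longrightarrow> \<bar>f r\<bar> \<le> B" and "\<eta> > 0"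
  shows "integrable lborel (\<lambda>\<xi>. cos (x \<bullet> \<xi>) * (f ((norm \<xi>)\<^sup>2) * exp (- \<eta> * (norm \<xi>)\<^sup>2)))"
proof (rule Bochner_Integration.integrable_bound)
  show "integrable lborel (\<lambda>\<xi>::'a. B * exp (- \<eta> * (norm \<xi>)\<^sup>2))"
    using integrable_gaussian[OF \<open>\<eta> > 0\<close>] by (rule integrable_mult_right)
  show "AE \<xi> in lborel. norm (cos (x \<bullet> \<xi>) * (f ((norm \<xi>)\<^sup>2) * exp (- \<eta> * (norm \<xi>)\<^sup>2)))
      \<le> norm (B * exp (- \<eta> * (norm \<xi>)\<^sup>2))"
    using AE_lborel_singleton[of "0::'a"]
  proof eventually_elim
    fix \<xi> :: 'a assume "\<xi> \<noteq> 0"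
    then have "\<bar>f ((norm \<xi>)\<^sup>2)\<bar> \<le> \<bar>B\<bar>"
      by (intro order_trans[OF B abs_ge_self]) simp
    then show "norm (cos (x \<bullet> \<xi>) * (f ((norm \<xi>)\<^sup>2) * exp (- \<eta> * (norm \<xi>)\<^sup>2)))
      \<le> norm (B * exp (- \<eta> * (norm \<xi>)\<^sup>2))"
      unfolding norm_mult using mult_mono[of "\<bar>cos (x \<bullet> \<xi>)\<bar>" 1 "\<bar>f ((norm \<xi>)\<^sup>2)\<bar>" "\<bar>B\<bar>"]
      by (auto simp: mult.assoc[symmetric] intro!: mult_right_mono)
  qed
qed simp

text \<open>Profiles enter only through their values at \<open>(norm \<xi>)\<^sup>2\<close>, and the
  origin is a null set; hence bound and convergence are asked for \<open>r > 0\<close> only. This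
  matters because the binomial series is summed at \<open>exp (- r / N) < 1\<close>.\<close>

lemma radial_ft_limit:
  assumes [measurable]: "\<And>k. f k \<in> borel_measurable borel" "g \<in> borel_measurable borel"
    and B: "\<And>k r. r > 0 \<Longrightarrow> \<bar>f k r\<bar> \<le> B" and "\<eta> > 0"
    and lim: "\<And>r. r > 0 \<Longrightarrow> (\<lambda>k. f k r) \<longlonglongrightarrow> g r"
    and dec: "\<And>k. radially_decreasing (radial_ft (f k) \<eta> :: 'a::euclidean_space \<Rightarrow> real)"
  shows "radially_decreasing (radial_ft g \<eta> :: 'a \<Rightarrow> real)"
proof (rule radially_decreasing_limit[OF dec])
  fix x :: 'a
  show "(\<lambda>k. radial_ft (f k) \<eta> x) \<longlonglongrightarrow> radial_ft g \<eta> x"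
    unfolding radial_ft_def
  proof (rule integral_dominated_convergence)
    show "integrable lborel (\<lambda>\<xi>::'a. B * exp (- \<eta> * (norm \<xi>)\<^sup>2))"
      using integrable_gaussian[OF \<open>\<eta> > 0\<close>] by (rule integrable_mult_right)
    show "AE \<xi> in lborel. (\<lambda>k. cos (x \<bullet> \<xi>) * (f k ((norm \<xi>)\<^sup>2) * exp (- \<eta> * (norm \<xi>)\<^sup>2)))
       \<longlonglongrightarrow> cos (x \<bullet> \<xi>) * (g ((norm \<xi>)\<^sup>2) * exp (- \<eta> * (norm \<xi>)\<^sup>2))"
      using AE_lborel_singleton[of "0::'a"]
      by eventually_elim (auto intro!: tendsto_intros lim)
    show "AE \<xi> in lborel. norm (cos (x \<bullet> \<xi>) * (f k ((norm \<xi>)\<^sup>2) * exp (- \<eta> * (norm \<xi>)\<^sup>2)))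
       \<le> B * exp (- \<eta> * (norm \<xi>)\<^sup>2)" for k
      using AE_lborel_singleton[of "0::'a"]
    proof eventually_elim
      fix \<xi> :: 'a assume "\<xi> \<noteq> 0"
      then have "\<bar>f k ((norm \<xi>)\<^sup>2)\<bar> \<le> B"
        by (intro B) simp
      then show "norm (cos (x \<bullet> \<xi>) * (f k ((norm \<xi>)\<^sup>2) * exp (- \<eta> * (norm \<xi>)\<^sup>2))) \<le> B * exp (- \<eta> * (norm \<xi>)\<^sup>2)"
        unfolding norm_mult using mult_mono[of "\<bar>cos (x \<bullet> \<xi>)\<bar>" 1 "\<bar>f k ((norm \<xi>)\<^sup>2)\<bar>" "B"]
        by (auto simp: mult.assoc[symmetric] intro!: mult_right_mono)
    qed
  qed simp_all
qed

inductive_set exp_cone :: "(real \<Rightarrow> real) set" where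
  exp: "0 \<le> c \<Longrightarrow> 0 \<le> s \<Longrightarrow> (\<lambda>r. c * exp (- s * r)) \<in> exp_cone"
| add: "f \<in> exp_cone \<Longrightarrow> h \<in> exp_cone \<Longrightarrow> (\<lambda>r. f r + h r) \<in> exp_cone"

lemma exp_cone_const: "0 \<le> c \<Longrightarrow> (\<lambda>_. c) \<in> exp_cone"
  using exp_cone.exp[of c 0] by simp

lemma exp_cone_mult:
  assumes "f \<in> exp_cone" "h \<in> exp_cone"
  shows "(\<lambda>r. f r * h r) \<in> exp_cone"
  using assms(1)
proof induction
  case (exp c s)
  show ?case using assms(2)
  proof induction
    case (exp c' s')
    have "(\<lambda>r. c * exp (- s * r) * (c' * exp (- s' * r))) = (\<lambda>r. (c * c') * exp (- (s + s') * r))"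
      by (auto simp: exp_add[symmetric] algebra_simps)
    then show ?case
      using exp_cone.exp[of "c * c'" "s + s'"] exp \<open>0 \<le> c\<close> \<open>0 \<le> s\<close> by simp
  qed (auto simp: distrib_left intro: exp_cone.add)
qed (auto simp: distrib_right intro: exp_cone.add)

lemma exp_cone_power: "f \<in> exp_cone \<Longrightarrow> (\<lambda>r. f r ^ j) \<in> exp_cone"
  by (induction j) (auto intro: exp_cone_mult exp_cone_const)

lemma exp_cone_sum:
  "finite J \<Longrightarrow> (\<And>j. j \<in> J \<Longrightarrow> f j \<in> exp_cone) \<Longrightarrow> (\<lambda>r. \<Sum>j\<in>J. f j r) \<in> exp_cone"
  by (induction J rule: finite_induct) (auto intro: exp_cone.add exp_cone_const)

lemma exp_cone_measurable: "f \<in> exp_cone \<Longrightarrow> f \<in> borel_measurable borel"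
  by (induction rule: exp_cone.induct) auto

lemma exp_cone_bounds: "f \<in> exp_cone \<Longrightarrow> r \<ge> 0 \<Longrightarrow> 0 \<le> f r \<and> f r \<le> f 0"
  by (induction rule: exp_cone.induct) (auto simp: mult_left_le intro!: add_mono)

text \<open>A generator contributes a Gaussian with parameter \<open>s + \<eta>\<close>, whose
  transform is again a Gaussian; \<open>\<eta> > 0\<close> keeps this parameter positive when
  \<open>s = 0\<close>.\<close>

lemma exp_cone_radial:
  assumes "f \<in> exp_cone" and "\<eta> > 0"
  shows "radially_decreasing (radial_ft f \<eta> :: 'a::euclidean_space \<Rightarrow> real)"
  using assms(1)
proof induction
  case (exp c s)
  have "radial_ft (\<lambda>r. c * exp (- s * r)) \<eta> x
      = c * (sqrt (pi / (s + \<eta>)) ^ DIM('a) * exp (- (norm x)\<^sup>2 / (4 * (s + \<eta>))))" for x :: 'a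
  proof -
    have eq: "cos (x \<bullet> \<xi>) * (c * exp (- s * (norm \<xi>)\<^sup>2) * exp (- \<eta> * (norm \<xi>)\<^sup>2))
        = c * (cos (x \<bullet> \<xi>) * exp (- (s + \<eta>) * (norm \<xi>)\<^sup>2))" for \<xi>
      by (simp add: exp_add[symmetric] algebra_simps)
    have "s + \<eta> > 0"
      using exp \<open>\<eta> > 0\<close> by simp
    show ?thesis
      unfolding radial_ft_def eq integral_mult_right_zero gaussian_cos_integral[OF \<open>s + \<eta> > 0\<close>] ..
  qed
  then show ?case
    using exp \<open>\<eta> > 0\<close>
    by (auto simp: radially_decreasing_def intro!: mult_left_mono divide_right_mono power_mono)
next
  case (add f h)
  have "radial_ft (\<lambda>r. f r + h r) \<eta> x = radial_ft f \<eta> x + radial_ft h \<eta> x" for x :: 'a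
  proof -
    have "integrable lborel (\<lambda>\<xi>. cos (x \<bullet> \<xi>) * (g ((norm \<xi>)\<^sup>2) * exp (- \<eta> * (norm \<xi>)\<^sup>2)))"
      if "g \<in> exp_cone" for g
      using exp_cone_bounds[OF that]
      by (intro integrable_radial_ft[where B="g 0"] exp_cone_measurable that \<open>\<eta> > 0\<close>) simp
    from this[OF add.hyps(1)] this[OF add.hyps(2)] show ?thesis
      unfolding radial_ft_def distrib_left distrib_right
      by (rule Bochner_Integration.integral_add)
  qed
  then show ?case
    using add.IH by (auto simp: radially_decreasing_def intro!: add_mono add_nonneg_nonneg)
qed

text \<open>The truncated exponential series of \<open>f\<close> lie in the cone. Elements of the
  cone are nonnegative and largest at 0, so \<open>C * exp (f 0)\<close> dominates all truncations.
  \<open>C\<close> makes room for a normalising factor in the application.\<close>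

lemma exp_of_exp_cone_radial:
  assumes f: "f \<in> exp_cone" and "\<eta> > 0" and "C \<ge> 0"
  shows "radially_decreasing (radial_ft (\<lambda>r. C * exp (f r)) \<eta> :: 'a::euclidean_space \<Rightarrow> real)"
proof -
  define e where "e = (\<lambda>N r. C * (\<Sum>j<N. 1 / fact j * f r ^ j))"
  have e_lim: "(\<lambda>N. e N r) \<longlonglongrightarrow> C * exp (f r)" for r
    using exp_converges[of "f r"] unfolding e_def sums_def
    by (intro tendsto_intros) (simp add: field_simps)
  have eE: "e N \<in> exp_cone" for N
    unfolding e_def
    by (intro exp_cone_mult exp_cone_sum exp_cone_const exp_cone_power f \<open>C \<ge> 0\<close>) auto
  have [measurable]: "f \<in> borel_measurable borel"
    using f by (rule exp_cone_measurable)
  show ?thesis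
  proof (rule radial_ft_limit[where f = e])
    show "\<bar>e N r\<bar> \<le> C * exp (f 0)" if "r > 0" for N r
    proof -
      have "0 \<le> e N r" "e N r \<le> e N 0"
        using exp_cone_bounds[OF eE, of r N] that by auto
      moreover have "e N 0 \<le> C * exp (f 0)"
      proof (rule LIMSEQ_le_const[OF e_lim])
        have "e N 0 \<le> e k 0" if "k \<ge> N" for k
          unfolding e_def using that \<open>C \<ge> 0\<close> exp_cone_bounds[OF f, of 0]
          by (intro mult_left_mono sum_mono2) auto
        then show "\<exists>M. \<forall>k\<ge>M. e N 0 \<le> e k 0" by blast
      qed
      ultimately show ?thesis by simp
    qed
  qed (auto intro: exp_cone_measurable eE exp_cone_radial \<open>\<eta> > 0\<close> e_lim)
qed

text \<open>Up to the factorial, the signed coefficient is the product of \<open>i - a\<close> for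
  \<open>i = 0, ..., j\<close>: the factor at \<open>i = 0\<close> is \<open>- a\<close>, all others
  are nonnegative because \<open>a \<le> 1\<close>. With \<open>a = \<theta> / 2\<close> this is
  where \<open>\<theta> \<le> 2\<close> is decisive.\<close>

lemma minus_one_power_gbinomial_nonpos:
  fixes a :: real
  assumes "0 < a" "a \<le> 1"
  shows "(a gchoose Suc j) * (- 1) ^ Suc j \<le> 0"
proof -
  have "(a gchoose Suc j) * (- 1) ^ Suc j = (\<Prod>i<Suc j. real i - a) / fact (Suc j)"
  proof -
    have "(\<Prod>i<Suc j. a - real i) * (- 1) ^ Suc j = (\<Prod>i<Suc j. (a - real i) * (- 1))"
      unfolding prod.distrib by simp
    then show ?thesis
      by (simp add: gbinomial_prod_rev atLeast0LessThan del: prod.lessThan_Suc power_Suc fact_Suc)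
  qed
  also have "(\<Prod>i<Suc j. real i - a) = - a * (\<Prod>i<j. real (Suc i) - a)"
    by (subst prod.lessThan_Suc_shift) simp
  also have "(\<Prod>i<j. real (Suc i) - a) \<ge> 0"
    using assms by (intro prod_nonneg) auto
  then have "- a * (\<Prod>i<j. real (Suc i) - a) / fact (Suc j) \<le> 0"
    using assms by (intro divide_nonpos_pos mult_nonpos_nonneg) auto
  finally show ?thesis .
qed

text \<open>With \<open>y = exp (- r / N)\<close> the binomial series reads \<open>(N (1 - y)) powr a = N powr a (1 - \<Sum>j. b j y ^ Suc j)\<close> with
  \<open>b j \<ge> 0\<close>, so \<open>exp (- t (N (1 - y)) powr a)\<close> is a constant times a limit of exponentials of elements of
  \<open>exp_cone\<close>; and \<open>N (1 - exp (- r / N))\<close> tends to \<open>r\<close>.\<close>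

lemma exp_neg_powr_radial:
  assumes a: "0 < a" "a \<le> 1" and "0 < t" "0 < \<eta>"
  shows "radially_decreasing (radial_ft (\<lambda>r. exp (- t * r powr a)) \<eta> :: 'a::euclidean_space \<Rightarrow> real)"
proof -
  define b where "b = (\<lambda>j. - ((a gchoose Suc j) * (- 1) ^ Suc j))"
  have b: "b j \<ge> 0" for j
    using minus_one_power_gbinomial_nonpos[OF a, of j] by (simp add: b_def)
  have b_sums: "(\<lambda>j. b j * y ^ Suc j) sums (1 - (1 - y) powr a)" if "0 \<le> y" "y < 1" for y :: real
  proof -
    have "(\<lambda>n. (a gchoose n) * (- y) ^ n) sums (1 + (- y)) powr a"
      using that by (intro gen_binomial_real) auto
    then have "(\<lambda>n. (a gchoose Suc n) * (- y) ^ Suc n) sums ((1 - y) powr a - 1)"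
      by (subst sums_Suc_iff) simp
    then have "(\<lambda>n. - ((a gchoose Suc n) * (- y) ^ Suc n)) sums (- ((1 - y) powr a - 1))"
      by (rule sums_minus)
    moreover have "- ((a gchoose Suc n) * (- y) ^ Suc n) = b n * y ^ Suc n" for n
      unfolding b_def by (subst (1) power_minus) simp
    ultimately show ?thesis by (simp only: minus_diff_eq)
  qed
  have H: "radially_decreasing (radial_ft (\<lambda>r. exp (- t * (N * (1 - exp (- r / N))) powr a)) \<eta> :: 'a \<Rightarrow> real)"
    if "N > 0" for N :: real
  proof -
    define f where "f = (\<lambda>M r. \<Sum>j<M. (t * N powr a * b j) * exp (- r / N) ^ Suc j)"
    have fE: "f M \<in> exp_cone" for M
    proof -
      have "(\<lambda>r. (t * N powr a * b j) * exp (- (real (Suc j) / N) * r)) \<in> exp_cone" for j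
        using that \<open>0 < t\<close> b by (intro exp_cone.exp) auto
      moreover have "exp (- r / N) ^ Suc j = exp (- (real (Suc j) / N) * r)" for r j
        by (simp add: exp_of_nat_mult[symmetric] del: power_Suc of_nat_Suc)
      ultimately show ?thesis
        unfolding f_def by (intro exp_cone_sum) auto
    qed
    have f_sums: "(\<lambda>M. f M r) \<longlonglongrightarrow> t * N powr a * (1 - (1 - exp (- r / N)) powr a)" if "r > 0" for r
    proof -
      have "(\<lambda>j. (t * N powr a) * (b j * exp (- r / N) ^ Suc j)) sums ((t * N powr a) * (1 - (1 - exp (- r / N)) powr a))"
        using that \<open>N > 0\<close> by (intro sums_mult b_sums) auto
      then show ?thesis
        unfolding sums_def f_def by (simp add: mult.assoc)
    qed
    \<comment> \<open>The terms are nonnegative, so partial sums stay below their limit, which is at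
      most \<open>t * N powr a\<close>. The factor \<open>exp (- t * N powr a)\<close> then brings
      \<open>exp (f M r)\<close> below 1, uniformly in \<open>M\<close>.\<close>
    have f_le: "f M r \<le> t * N powr a" if "r > 0" for M r
    proof -
      have "f M r \<le> t * N powr a * (1 - (1 - exp (- r / N)) powr a)"
      proof (rule LIMSEQ_le_const[OF f_sums[OF that]])
        have "f M r \<le> f k r" if "k \<ge> M" for k
          unfolding f_def using that \<open>t > 0\<close> b by (intro sum_mono2) auto
        then show "\<exists>M'. \<forall>k\<ge>M'. f M r \<le> f k r" by blast
      qed
      also have "\<dots> \<le> t * N powr a"
        using \<open>t > 0\<close> by (simp add: mult_left_le)
      finally show ?thesis .
    qed
    show ?thesis
    proof (rule radial_ft_limit[where f = "\<lambda>M r. exp (- t * N powr a) * exp (f M r)" and B = 1])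
      show "(\<lambda>r. exp (- t * N powr a) * exp (f M r)) \<in> borel_measurable borel" for M
        using exp_cone_measurable[OF fE, of M] by measurable
      show "\<bar>exp (- t * N powr a) * exp (f M r)\<bar> \<le> 1" if "r > 0" for M r
        using f_le[OF that, of M] by (simp flip: exp_add)
      show "(\<lambda>M. exp (- t * N powr a) * exp (f M r)) \<longlonglongrightarrow> exp (- t * (N * (1 - exp (- r / N))) powr a)"
        if "r > 0" for r
      proof -
        have "(N * (1 - exp (- r / N))) powr a = N powr a * (1 - exp (- r / N)) powr a"
          using \<open>N > 0\<close> that by (intro powr_mult)
        then have "exp (- t * (N * (1 - exp (- r / N))) powr a)
           = exp (- t * N powr a) * exp (t * N powr a * (1 - (1 - exp (- r / N)) powr a))"
          by (simp add: exp_add[symmetric] algebra_simps)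
        then show ?thesis
          by (simp only:) (intro tendsto_mult tendsto_exp tendsto_const f_sums[OF that])
      qed
    qed (auto intro!: exp_of_exp_cone_radial fE \<open>0 < \<eta>\<close>)
  qed
  show ?thesis
  proof (rule radial_ft_limit[where f = "\<lambda>k r. exp (- t * (real (Suc k) * (1 - exp (- r / real (Suc k)))) powr a)" and B = 1])
    show "(\<lambda>k. exp (- t * (real (Suc k) * (1 - exp (- r / real (Suc k)))) powr a)) \<longlonglongrightarrow> exp (- t * r powr a)"
      if "r > 0" for r
    proof -
      have "(\<lambda>k. real (Suc k) * (1 - exp (- r / real (Suc k)))) \<longlonglongrightarrow> r"
        using that by real_asymp
      then show ?thesis
        using that by (intro tendsto_intros) auto
    qed
    show "radially_decreasing (radial_ft (\<lambda>r. exp (- t * (real (Suc k) * (1 - exp (- r / real (Suc k)))) powr a)) \<eta> :: 'a \<Rightarrow> real)" for k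
      by (rule H) simp
  qed (use \<open>0 < t\<close> \<open>0 < \<eta>\<close> in auto)
qed

text \<open>In the variable \<open>(norm \<xi>)\<^sup>2\<close> the exponent \<theta> becomes
  \<theta>/2, which lies in (0, 1]. The Gaussian regularisation is removed along
  \<open>1 / real (Suc k)\<close>, with the integrable exponential itself as majorant.\<close>

lemma exp_neg_norm_powr_fourier_radial:
  assumes "0 < t" "0 < \<theta>" "\<theta> \<le> 2"
  shows "radially_decreasing (\<lambda>x::'a::euclidean_space. \<integral>\<xi>. cos (x \<bullet> \<xi>) * exp (- t * norm \<xi> powr \<theta>) \<partial>lborel)"
proof (rule radially_decreasing_limit)
  show "radially_decreasing (radial_ft (\<lambda>r. exp (- t * r powr (\<theta> / 2))) (1 / real (Suc k)) :: 'a \<Rightarrow> real)" for k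
    using assms by (intro exp_neg_powr_radial) auto
  fix x :: 'a
  have sq: "((norm \<xi>)\<^sup>2) powr (\<theta> / 2) = norm \<xi> powr \<theta>" for \<xi> :: 'a
    by (cases "\<xi> = 0") (auto simp: powr_powr simp flip: powr_numeral)
  show "(\<lambda>k. radial_ft (\<lambda>r. exp (- t * r powr (\<theta> / 2))) (1 / real (Suc k)) x)
     \<longlonglongrightarrow> (\<integral>\<xi>. cos (x \<bullet> \<xi>) * exp (- t * norm \<xi> powr \<theta>) \<partial>lborel)"
    unfolding radial_ft_def sq
  proof (rule integral_dominated_convergence)
    show "integrable lborel (\<lambda>\<xi>::'a. exp (- t * norm \<xi> powr \<theta>))"
      using assms by (intro integrable_exp_neg_norm_powr) auto
    show "AE \<xi> in lborel. (\<lambda>k. cos (x \<bullet> \<xi>) * (exp (- t * norm \<xi> powr \<theta>) * exp (- (1 / real (Suc k)) * (norm \<xi>)\<^sup>2)))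
        \<longlonglongrightarrow> cos (x \<bullet> \<xi>) * exp (- t * norm \<xi> powr \<theta>)"
    proof (rule AE_I2)
      fix \<xi> :: 'a
      have "(\<lambda>k. exp (- (1 / real (Suc k)) * (norm \<xi>)\<^sup>2)) \<longlonglongrightarrow> exp (- 0 * (norm \<xi>)\<^sup>2)"
        by (intro tendsto_intros LIMSEQ_Suc lim_const_over_n)
      then have "(\<lambda>k. cos (x \<bullet> \<xi>) * (exp (- t * norm \<xi> powr \<theta>) * exp (- (1 / real (Suc k)) * (norm \<xi>)\<^sup>2)))
        \<longlonglongrightarrow> cos (x \<bullet> \<xi>) * (exp (- t * norm \<xi> powr \<theta>) * exp (- 0 * (norm \<xi>)\<^sup>2))"
        by (intro tendsto_mult tendsto_const)
      then show "(\<lambda>k. cos (x \<bullet> \<xi>) * (exp (- t * norm \<xi> powr \<theta>) * exp (- (1 / real (Suc k)) * (norm \<xi>)\<^sup>2)))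
        \<longlonglongrightarrow> cos (x \<bullet> \<xi>) * exp (- t * norm \<xi> powr \<theta>)"
        by simp
    qed
    show "AE \<xi> in lborel. norm (cos (x \<bullet> \<xi>) * (exp (- t * norm \<xi> powr \<theta>) * exp (- (1 / real (Suc k)) * (norm \<xi>)\<^sup>2)))
        \<le> exp (- t * norm \<xi> powr \<theta>)" for k
    proof (rule AE_I2)
      fix \<xi> :: 'a
      have "\<bar>cos (x \<bullet> \<xi>)\<bar> * (exp (- t * norm \<xi> powr \<theta>) * exp (- (1 / real (Suc k)) * (norm \<xi>)\<^sup>2))
         \<le> 1 * (exp (- t * norm \<xi> powr \<theta>) * 1)"
        by (intro mult_mono) auto
      then show "norm (cos (x \<bullet> \<xi>) * (exp (- t * norm \<xi> powr \<theta>) * exp (- (1 / real (Suc k)) * (norm \<xi>)\<^sup>2)))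
        \<le> exp (- t * norm \<xi> powr \<theta>)"
        by (simp add: abs_mult)
    qed
  qed simp_all
qed

section \<open>Fourier inversion and the semigroup property\<close>

lemma integrable_lborel_pair_mult:
  fixes f :: "'a::euclidean_space \<Rightarrow> real" and g :: "'b::euclidean_space \<Rightarrow> real"
  assumes f: "integrable lborel f" and g: "integrable lborel g"
  shows "integrable (lborel \<Otimes>\<^sub>M lborel) (\<lambda>(x, y). f x * g y)"
proof (rule lborel_pair.Fubini_integrable)
  have [measurable]: "f \<in> borel_measurable borel" "g \<in> borel_measurable borel"
    using f g by auto
  show "(\<lambda>(x, y). f x * g y) \<in> borel_measurable (lborel \<Otimes>\<^sub>M lborel)"
    by measurable
  show "integrable lborel (\<lambda>x. \<integral>y. norm (case (x, y) of (x, y) \<Rightarrow> f x * g y) \<partial>lborel)"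
    using f by (simp add: abs_mult)
  show "AE x in lborel. integrable lborel (\<lambda>y. case (x, y) of (x, y) \<Rightarrow> f x * g y)"
    using g by simp
qed

section \<open>Sign, monotonicity and scaling of the kernel\<close>

lemma fund_sol_lborel:
  "fund_sol \<theta> (x::real^'n) t = (2 * pi) powr (- real CARD('n)) *
     (\<integral>\<xi>. cos (x \<bullet> \<xi>) * exp (- t * norm \<xi> powr \<theta>) \<partial>lborel)"
  unfolding fund_sol_def by (subst integral_completion) auto

lemma fund_sol_measurable [measurable (raw)]:
  fixes f :: "'a \<Rightarrow> real^'n"
  assumes [measurable]: "f \<in> borel_measurable M" "g \<in> borel_measurable M"
  shows "(\<lambda>z. fund_sol \<theta> (f z) (g z)) \<in> borel_measurable M"
  unfolding fund_sol_lborel by measurable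

lemma fund_sol_uminus: "fund_sol \<theta> (- x) t = fund_sol \<theta> x t"
  by (simp add: fund_sol_def)

lemma fund_sol_radially_decreasing:
  assumes "0 < t" "0 < \<theta>" "\<theta> \<le> 2"
  shows "radially_decreasing (\<lambda>x::real^'n. fund_sol \<theta> x t)"
  using exp_neg_norm_powr_fourier_radial[OF assms, where 'a="real^'n"]
  unfolding fund_sol_lborel radially_decreasing_def by (auto intro!: mult_left_mono)

lemma fund_sol_nonneg: "0 < t \<Longrightarrow> 0 < \<theta> \<Longrightarrow> \<theta> \<le> 2 \<Longrightarrow> 0 \<le> fund_sol \<theta> x t"
  using fund_sol_radially_decreasing[of t \<theta>] unfolding radially_decreasing_def by blast

lemma fund_sol_antimono:
  fixes x y :: "real^'n"
  assumes "0 < t" "0 < \<theta>" "\<theta> \<le> 2" "norm x \<le> norm y"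
  shows "fund_sol \<theta> y t \<le> fund_sol \<theta> x t"
  using fund_sol_radially_decreasing[OF assms(1-3), where 'n='n] assms(4)
  by (auto simp: radially_decreasing_def)

text \<open>Substituting \<open>c *\<^sub>R \<xi>\<close> for \<xi> with
  \<open>c = t powr (- 1 / \<theta>)\<close> removes \<open>t\<close> from the exponent; the
  Jacobian is the prefactor, and the \<open>c\<close> in the phase moves onto
  \<open>x\<close>.\<close>

lemma fund_sol_scaling:
  fixes x :: "real^'n"
  assumes "0 < t" "0 < \<theta>"
  shows "fund_sol \<theta> x t = t powr (- real CARD('n) / \<theta>) * fund_sol \<theta> (t powr (- 1 / \<theta>) *\<^sub>R x) 1"
proof -
  define c where "c = t powr (- 1 / \<theta>)"
  have c: "c > 0" using assms by (simp add: c_def)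
  have tc: "t * (c * y) powr \<theta> = y powr \<theta>" if "y \<ge> 0" for y
  proof -
    have "(c * y) powr \<theta> = c powr \<theta> * y powr \<theta>"
      using c that by (intro powr_mult)
    also have "c powr \<theta> = inverse t"
      unfolding c_def powr_powr using assms by (simp add: powr_minus)
    finally show ?thesis using assms by simp
  qed
  have "c ^ CARD('n) = t powr (- real CARD('n) / \<theta>)"
    using c assms unfolding c_def by (simp add: powr_powr flip: powr_realpow)
  moreover have "(\<integral>\<xi>. cos (x \<bullet> \<xi>) * exp (- t * norm \<xi> powr \<theta>) \<partial>lborel)
     = \<bar>c\<bar> ^ DIM(real^'n) * (\<integral>\<xi>. cos (x \<bullet> (0 + c *\<^sub>R \<xi>)) * exp (- t * norm (0 + c *\<^sub>R \<xi>) powr \<theta>) \<partial>lborel)"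
    using c by (intro lborel_integral_affine) auto
  moreover have eq: "cos (x \<bullet> (0 + c *\<^sub>R \<xi>)) * exp (- t * norm (0 + c *\<^sub>R \<xi>) powr \<theta>)
      = cos ((c *\<^sub>R x) \<bullet> \<xi>) * exp (- 1 * norm \<xi> powr \<theta>)" for \<xi> :: "real^'n"
    using c tc[of "norm \<xi>"] by simp
  ultimately show ?thesis
    using c unfolding fund_sol_lborel c_def[symmetric] eq by simp
qed

text \<open>Fourier inversion, by testing against the Gaussians \<open>exp (- \<epsilon> |x|\<^sup>2)\<close> and letting \<open>\<epsilon>\<close> tend to 0.\<close>

lemma fund_sol_gaussian_average:
  fixes z :: "real^'n"
  assumes \<epsilon>: "0 < \<epsilon>" and t: "0 < t" and \<theta>: "0 < \<theta>"
  defines "I \<equiv> \<lambda>v. \<integral>\<eta>. exp (- t * norm (v + (2 * sqrt \<epsilon>) *\<^sub>R \<eta>) powr \<theta>) * exp (- 1 * (norm \<eta>)\<^sup>2) \<partial>(lborel :: (real^'n) measure)"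
  shows "integrable lborel (\<lambda>x. cos (z \<bullet> x) * fund_sol \<theta> x t * exp (- \<epsilon> * (norm x)\<^sup>2))"
    and "(\<integral>x. cos (z \<bullet> x) * fund_sol \<theta> x t * exp (- \<epsilon> * (norm x)\<^sup>2) \<partial>lborel)
      = inverse (sqrt pi ^ CARD('n)) * ((I z + I (- z)) / 2)"
proof -
  let ?n = "CARD('n)"
  define e where "e = (\<lambda>\<xi>::real^'n. exp (- t * norm \<xi> powr \<theta>))"
  define C where "C = (2 * pi) powr (- real ?n)"
  define F where "F = (\<lambda>x \<xi>. cos (z \<bullet> x) * exp (- \<epsilon> * (norm x)\<^sup>2) * (cos (x \<bullet> \<xi>) * e \<xi>))"
  have [measurable]: "e \<in> borel_measurable borel" unfolding e_def by measurable
  have [measurable]: "(\<lambda>(x, \<xi>). F x \<xi>) \<in> borel_measurable (lborel \<Otimes>\<^sub>M lborel)"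
    unfolding F_def by measurable
  have e_int: "integrable lborel e"
    unfolding e_def using t \<theta> by (rule integrable_exp_neg_norm_powr)
  have F_int: "integrable (lborel \<Otimes>\<^sub>M lborel) (\<lambda>(x, \<xi>). F x \<xi>)"
  proof (rule Bochner_Integration.integrable_bound)
    show "integrable (lborel \<Otimes>\<^sub>M lborel) (\<lambda>(x::real^'n, \<xi>). exp (- \<epsilon> * (norm x)\<^sup>2) * e \<xi>)"
      by (intro integrable_lborel_pair_mult integrable_gaussian \<epsilon> e_int)
    show "AE w in lborel \<Otimes>\<^sub>M lborel. norm (case w of (x, \<xi>) \<Rightarrow> F x \<xi>) \<le> norm (case w of (x, \<xi>) \<Rightarrow> exp (- \<epsilon> * (norm x)\<^sup>2) * e \<xi>)"
      by (rule AE_I2) (auto simp: F_def e_def abs_mult mult.assoc intro!: mult_le_one)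
  qed simp
  have eqF: "cos (z \<bullet> x) * fund_sol \<theta> x t * exp (- \<epsilon> * (norm x)\<^sup>2) = C * (\<integral>\<xi>. F x \<xi> \<partial>lborel)" for x
    unfolding F_def e_def C_def fund_sol_lborel by simp
  show "integrable lborel (\<lambda>x. cos (z \<bullet> x) * fund_sol \<theta> x t * exp (- \<epsilon> * (norm x)\<^sup>2))"
    unfolding eqF using lborel_pair.integrable_fst'[OF F_int] by simp
  define P where "P = (\<lambda>v::real^'n. sqrt (pi / \<epsilon>) ^ ?n * exp (- (norm v)\<^sup>2 / (4 * \<epsilon>)))"
  have [measurable]: "P \<in> borel_measurable borel" unfolding P_def by measurable
  have P_int: "(\<integral>x. cos (v \<bullet> x) * exp (- \<epsilon> * (norm x)\<^sup>2) \<partial>lborel) = P v" for v :: "real^'n"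
    unfolding P_def using gaussian_cos_integral[OF \<epsilon>, of v] by simp
  have cos_int: "integrable lborel (\<lambda>x. cos (v \<bullet> x) * exp (- \<epsilon> * (norm x)\<^sup>2))" for v :: "real^'n"
    using integrable_radial_ft[of "\<lambda>_. 1" 1 \<epsilon> v] \<epsilon> by simp
  \<comment> \<open>The product formula for cosines splits the phase into the frequencies
    \<open>z - \<xi>\<close> and \<open>z + \<xi>\<close>, giving Gaussians centred at
    \<open>z\<close> and \<open>- z\<close>; hence the two terms in the result.\<close>
  have inner: "(\<integral>x. F x \<xi> \<partial>lborel) = e \<xi> * ((P (z - \<xi>) + P (z + \<xi>)) / 2)" for \<xi>
  proof -
    have "F x \<xi> = e \<xi> / 2 * (cos ((z - \<xi>) \<bullet> x) * exp (- \<epsilon> * (norm x)\<^sup>2) + cos ((z + \<xi>) \<bullet> x) * exp (- \<epsilon> * (norm x)\<^sup>2))" for x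
      unfolding F_def by (simp add: inner_diff_left inner_add_left cos_diff cos_add inner_commute[of x] algebra_simps)
    then have "(\<integral>x. F x \<xi> \<partial>lborel) = e \<xi> / 2 * (P (z - \<xi>) + P (z + \<xi>))"
      by (simp only: integral_mult_right_zero Bochner_Integration.integral_add[OF cos_int cos_int] P_int)
    then show ?thesis by simp
  qed
  have P_le: "\<bar>P v\<bar> \<le> sqrt (pi / \<epsilon>) ^ ?n" for v
    unfolding P_def using \<epsilon> by (simp add: abs_mult mult_left_le)
  have eP_int: "integrable lborel (\<lambda>\<xi>. e \<xi> * P (f \<xi>))" if [measurable]: "f \<in> borel_measurable borel" for f
    by (rule Bochner_Integration.integrable_bound[OF integrable_mult_left[OF e_int, of "sqrt (pi / \<epsilon>) ^ ?n"]])
       (auto intro!: AE_I2 mult_left_mono P_le simp: abs_mult e_def order_trans[OF P_le])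
  \<comment> \<open>Centring at \<open>v\<close> and rescaling by \<open>2 * sqrt \<epsilon>\<close>
    freezes the Gaussian and moves \<epsilon> into a bounded continuous factor, where the limit is
    harmless. The scale factors combine to \<open>2 * sqrt pi\<close> per coordinate, independently
    of \<epsilon>.\<close>
  have aff: "(\<integral>\<xi>. e \<xi> * P (v - \<xi>) \<partial>lborel) = (2 * sqrt pi) ^ ?n * I v" for v
  proof -
    have eq: "e (v + (2 * sqrt \<epsilon>) *\<^sub>R \<eta>) * P (v - (v + (2 * sqrt \<epsilon>) *\<^sub>R \<eta>))
      = sqrt (pi / \<epsilon>) ^ ?n * (exp (- t * norm (v + (2 * sqrt \<epsilon>) *\<^sub>R \<eta>) powr \<theta>) * exp (- 1 * (norm \<eta>)\<^sup>2))" for \<eta>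
      using \<epsilon> by (simp add: P_def e_def power_mult_distrib)
    have "(\<integral>\<xi>. e \<xi> * P (v - \<xi>) \<partial>lborel)
      = \<bar>2 * sqrt \<epsilon>\<bar> ^ DIM(real^'n) * (\<integral>\<eta>. e (v + (2 * sqrt \<epsilon>) *\<^sub>R \<eta>) * P (v - (v + (2 * sqrt \<epsilon>) *\<^sub>R \<eta>)) \<partial>lborel)"
      using \<epsilon> by (intro lborel_integral_affine) auto
    also have "\<dots> = (2 * sqrt \<epsilon> * sqrt (pi / \<epsilon>)) ^ ?n * I v"
      using \<epsilon> unfolding eq by (simp only: integral_mult_right_zero I_def power_mult_distrib) simp
    also have "2 * sqrt \<epsilon> * sqrt (pi / \<epsilon>) = 2 * sqrt pi"
      using \<epsilon> by (simp add: real_sqrt_divide)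
    finally show ?thesis .
  qed
  have neg: "(\<integral>\<xi>. e \<xi> * P (z + \<xi>) \<partial>lborel) = (\<integral>\<xi>. e \<xi> * P (- z - \<xi>) \<partial>lborel)"
  proof (intro Bochner_Integration.integral_cong refl)
    show "e \<xi> * P (z + \<xi>) = e \<xi> * P (- z - \<xi>)" for \<xi>
      using norm_minus_cancel[of "z + \<xi>"] unfolding P_def by (simp del: norm_minus_cancel)
  qed
  have "(\<integral>x. cos (z \<bullet> x) * fund_sol \<theta> x t * exp (- \<epsilon> * (norm x)\<^sup>2) \<partial>lborel)
     = C * (\<integral>x. (\<integral>\<xi>. F x \<xi> \<partial>lborel) \<partial>lborel)"
    unfolding eqF by simp
  also have "(\<integral>x. (\<integral>\<xi>. F x \<xi> \<partial>lborel) \<partial>lborel) = (\<integral>\<xi>. (\<integral>x. F x \<xi> \<partial>lborel) \<partial>lborel)"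
    using F_int by (rule lborel_pair.Fubini_integral[symmetric])
  also have "\<dots> = (\<integral>\<xi>. (e \<xi> * P (z - \<xi>) + e \<xi> * P (z + \<xi>)) / 2 \<partial>lborel)"
    unfolding inner by (simp add: distrib_left)
  also have "\<dots> = ((\<integral>\<xi>. e \<xi> * P (z - \<xi>) \<partial>lborel) + (\<integral>\<xi>. e \<xi> * P (z + \<xi>) \<partial>lborel)) / 2"
    by (simp add: eP_int)
  also have "\<dots> = (2 * sqrt pi) ^ ?n * ((I z + I (- z)) / 2)"
    unfolding neg aff by (simp add: distrib_left)
  also have "C * \<dots> = (C * (2 * sqrt pi) ^ ?n) * ((I z + I (- z)) / 2)"
    by simp
  also have "C * (2 * sqrt pi) ^ ?n = inverse (sqrt pi ^ ?n)"
  proof -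
    have "pi = sqrt pi * sqrt pi" by simp
    then have "(2 * pi) ^ ?n = (2 * sqrt pi) ^ ?n * sqrt pi ^ ?n"
      by (metis mult.assoc power_mult_distrib)
    then show ?thesis
      unfolding C_def by (simp add: powr_minus powr_realpow field_simps)
  qed
  finally show "(\<integral>x. cos (z \<bullet> x) * fund_sol \<theta> x t * exp (- \<epsilon> * (norm x)\<^sup>2) \<partial>lborel)
      = inverse (sqrt pi ^ CARD('n)) * ((I z + I (- z)) / 2)" .
qed

text \<open>Integrability has to precede the inversion formula. At frequency 0 the regularised
  integrals of the nonnegative kernel are at most 1, so Fatou's lemma gives finite mass. The kernel
  itself then dominates the regularised integrands at every frequency, and dominated convergence
  identifies the limit.\<close>

lemma fund_sol_fourier:
  fixes z :: "real^'n"
  assumes t: "0 < t" and \<theta>: "0 < \<theta>" "\<theta> \<le> 2"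
  shows fund_sol_integrable: "integrable lborel (\<lambda>x::real^'n. fund_sol \<theta> x t)"
    and fund_sol_cos_integral: "(\<integral>x. cos (z \<bullet> x) * fund_sol \<theta> x t \<partial>lborel) = exp (- t * norm z powr \<theta>)"
proof -
  let ?n = "CARD('n)"
  define \<epsilon> where "\<epsilon> = (\<lambda>k. 1 / real (Suc k))"
  have \<epsilon>: "\<epsilon> k > 0" for k by (simp add: \<epsilon>_def)
  have \<epsilon>_lim: "\<epsilon> \<longlonglongrightarrow> 0"
    unfolding \<epsilon>_def by (intro LIMSEQ_Suc lim_const_over_n)
  define I where "I = (\<lambda>k v. \<integral>\<eta>. exp (- t * norm (v + (2 * sqrt (\<epsilon> k)) *\<^sub>R \<eta>) powr \<theta>) * exp (- 1 * (norm \<eta>)\<^sup>2) \<partial>(lborel :: (real^'n) measure))"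
  have gauss: "(\<integral>\<eta>. exp (- 1 * (norm \<eta>)\<^sup>2) \<partial>(lborel :: (real^'n) measure)) = sqrt pi ^ ?n"
    using gaussian_cos_integral[of 1 "0 :: real^'n"] by simp
  have gauss_int: "integrable lborel (\<lambda>\<eta> :: real^'n. exp (- 1 * (norm \<eta>)\<^sup>2))"
    by (rule integrable_gaussian) simp
  have I_lim: "(\<lambda>k. I k v) \<longlonglongrightarrow> exp (- t * norm v powr \<theta>) * sqrt pi ^ ?n" for v
    unfolding gauss[symmetric] integral_mult_right_zero[symmetric] I_def
  proof (rule integral_dominated_convergence[OF _ _ gauss_int])
    show "AE \<eta> in lborel. (\<lambda>k. exp (- t * norm (v + (2 * sqrt (\<epsilon> k)) *\<^sub>R \<eta>) powr \<theta>) * exp (- 1 * (norm \<eta>)\<^sup>2))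
        \<longlonglongrightarrow> exp (- t * norm v powr \<theta>) * exp (- 1 * (norm \<eta>)\<^sup>2)"
    proof (rule AE_I2)
      fix \<eta> :: "real^'n"
      have "(\<lambda>k. norm (v + (2 * sqrt (\<epsilon> k)) *\<^sub>R \<eta>)) \<longlonglongrightarrow> norm (v + (2 * sqrt 0) *\<^sub>R \<eta>)"
        by (intro tendsto_intros \<epsilon>_lim)
      then have "(\<lambda>k. norm (v + (2 * sqrt (\<epsilon> k)) *\<^sub>R \<eta>) powr \<theta>) \<longlonglongrightarrow> norm v powr \<theta>"
        using \<theta> by (intro tendsto_powr2) auto
      then show "(\<lambda>k. exp (- t * norm (v + (2 * sqrt (\<epsilon> k)) *\<^sub>R \<eta>) powr \<theta>) * exp (- 1 * (norm \<eta>)\<^sup>2))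
        \<longlonglongrightarrow> exp (- t * norm v powr \<theta>) * exp (- 1 * (norm \<eta>)\<^sup>2)"
        by (intro tendsto_mult tendsto_exp tendsto_const)
    qed
  qed (use t in \<open>auto intro!: AE_I2 mult_left_le_one_le\<close>)
  have J: "integrable lborel (\<lambda>x. cos (z \<bullet> x) * fund_sol \<theta> x t * exp (- \<epsilon> k * (norm x)\<^sup>2))"
    "(\<integral>x. cos (z \<bullet> x) * fund_sol \<theta> x t * exp (- \<epsilon> k * (norm x)\<^sup>2) \<partial>lborel)
      = inverse (sqrt pi ^ ?n) * ((I k z + I k (- z)) / 2)" for k and z :: "real^'n"
    unfolding I_def using fund_sol_gaussian_average[OF \<epsilon> t \<theta>(1), of z k] by auto
  have nn: "0 \<le> fund_sol \<theta> x t" for x :: "real^'n"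
    using t \<theta> by (rule fund_sol_nonneg)
  have conv: "(\<lambda>k. fund_sol \<theta> x t * exp (- \<epsilon> k * (norm x)\<^sup>2)) \<longlonglongrightarrow> fund_sol \<theta> x t" for x :: "real^'n"
  proof -
    have "(\<lambda>k. fund_sol \<theta> x t * exp (- \<epsilon> k * (norm x)\<^sup>2)) \<longlonglongrightarrow> fund_sol \<theta> x t * exp (- 0 * (norm x)\<^sup>2)"
      by (intro tendsto_mult tendsto_exp tendsto_minus tendsto_const \<epsilon>_lim)
    then show ?thesis by simp
  qed
  have I_le: "I k 0 \<le> sqrt pi ^ ?n" for k
    unfolding gauss[symmetric] I_def using t
    by (intro integral_mono' gauss_int) (auto intro!: mult_left_le_one_le)
  show int: "integrable lborel (\<lambda>x::real^'n. fund_sol \<theta> x t)"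
  proof (rule integrableI_bounded)
    have lim: "liminf (\<lambda>k. ennreal (fund_sol \<theta> x t * exp (- \<epsilon> k * (norm x)\<^sup>2))) = ennreal (fund_sol \<theta> x t)" for x :: "real^'n"
      by (intro lim_imp_Liminf tendsto_ennrealI conv) simp
    have "(\<integral>\<^sup>+x. ennreal (fund_sol \<theta> x t) \<partial>(lborel :: (real^'n) measure))
      = (\<integral>\<^sup>+x. liminf (\<lambda>k. ennreal (fund_sol \<theta> x t * exp (- \<epsilon> k * (norm x)\<^sup>2))) \<partial>(lborel :: (real^'n) measure))"
      by (simp only: lim)
    also have "\<dots> \<le> liminf (\<lambda>k. \<integral>\<^sup>+x. ennreal (fund_sol \<theta> x t * exp (- \<epsilon> k * (norm x)\<^sup>2)) \<partial>(lborel :: (real^'n) measure))"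
      by (intro nn_integral_liminf) measurable
    also have "\<dots> \<le> liminf (\<lambda>k::nat. 1)"
    proof (intro Liminf_mono always_eventually allI)
      fix k
      have "(\<integral>\<^sup>+x. ennreal (fund_sol \<theta> x t * exp (- \<epsilon> k * (norm x)\<^sup>2)) \<partial>(lborel :: (real^'n) measure))
        = ennreal (inverse (sqrt pi ^ ?n) * I k 0)"
        using J[where z=0] nn by (subst nn_integral_eq_integral) auto
      also have "\<dots> \<le> ennreal 1"
        using I_le[of k] by (intro ennreal_leI) (simp add: field_simps)
      finally show "(\<integral>\<^sup>+x. ennreal (fund_sol \<theta> x t * exp (- \<epsilon> k * (norm x)\<^sup>2)) \<partial>(lborel :: (real^'n) measure)) \<le> 1"
        by simp
    qed
    finally show "(\<integral>\<^sup>+x. ennreal (norm (fund_sol \<theta> x t)) \<partial>(lborel :: (real^'n) measure)) < \<infinity>"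
      using nn by (simp add: Liminf_const) (auto simp: less_top[symmetric] top_unique)
  qed simp
  have "(\<lambda>k. \<integral>x. cos (z \<bullet> x) * fund_sol \<theta> x t * exp (- \<epsilon> k * (norm x)\<^sup>2) \<partial>lborel)
      \<longlonglongrightarrow> (\<integral>x. cos (z \<bullet> x) * fund_sol \<theta> x t \<partial>lborel)"
  proof (rule integral_dominated_convergence[OF _ _ int])
    show "AE x in lborel. (\<lambda>k. cos (z \<bullet> x) * fund_sol \<theta> x t * exp (- \<epsilon> k * (norm x)\<^sup>2)) \<longlonglongrightarrow> cos (z \<bullet> x) * fund_sol \<theta> x t"
      unfolding mult.assoc by (intro AE_I2 tendsto_mult tendsto_const conv)
    show "AE x in lborel. norm (cos (z \<bullet> x) * fund_sol \<theta> x t * exp (- \<epsilon> k * (norm x)\<^sup>2)) \<le> fund_sol \<theta> x t" for k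
    proof (rule AE_I2)
      fix x
      have "\<bar>cos (z \<bullet> x)\<bar> * (fund_sol \<theta> x t * exp (- \<epsilon> k * (norm x)\<^sup>2)) \<le> 1 * (fund_sol \<theta> x t * 1)"
        using nn[of x] \<epsilon>[of k] by (intro mult_mono) auto
      then show "norm (cos (z \<bullet> x) * fund_sol \<theta> x t * exp (- \<epsilon> k * (norm x)\<^sup>2)) \<le> fund_sol \<theta> x t"
        using nn[of x] by (simp add: abs_mult mult.assoc)
    qed
  qed simp_all
  moreover have "(\<lambda>k. \<integral>x. cos (z \<bullet> x) * fund_sol \<theta> x t * exp (- \<epsilon> k * (norm x)\<^sup>2) \<partial>lborel)
      \<longlonglongrightarrow> inverse (sqrt pi ^ ?n) * ((exp (- t * norm z powr \<theta>) * sqrt pi ^ ?n + exp (- t * norm (- z) powr \<theta>) * sqrt pi ^ ?n) / 2)"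
    unfolding J by (intro tendsto_mult tendsto_divide tendsto_add tendsto_const I_lim) simp
  ultimately show "(\<integral>x. cos (z \<bullet> x) * fund_sol \<theta> x t \<partial>lborel) = exp (- t * norm z powr \<theta>)"
    by (rule LIMSEQ_unique[THEN trans]) simp
qed

lemma fund_sol_integral:
  assumes "0 < t" "0 < \<theta>" "\<theta> \<le> 2"
  shows "(\<integral>x. fund_sol \<theta> (x::real^'n) t \<partial>lborel) = 1"
  using fund_sol_cos_integral[OF assms, of "0::real^'n"] by simp

text \<open>One factor is expanded as a cosine integral, the other is integrated against the cosine
  by the inversion formula, and the two exponentials multiply to the one with parameter
  \<open>t + s\<close>. The product of kernel and exponential is the majorant for Fubini.\<close>

lemma fund_sol_semigroup:
  fixes x :: "real^'n"
  assumes "0 < t" "0 < s" and \<theta>: "0 < \<theta>" "\<theta> \<le> 2"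
  shows "integrable lborel (\<lambda>y. fund_sol \<theta> (x - y) t * fund_sol \<theta> y s)"
    and "(\<integral>y. fund_sol \<theta> (x - y) t * fund_sol \<theta> y s \<partial>lborel) = fund_sol \<theta> x (t + s)"
proof -
  define C where "C = (2 * pi) powr (- real CARD('n))"
  define e where "e = (\<lambda>t (\<xi>::real^'n). exp (- t * norm \<xi> powr \<theta>))"
  have [measurable]: "e t \<in> borel_measurable borel" for t unfolding e_def by measurable
  define F where "F = (\<lambda>y \<xi>. fund_sol \<theta> y s * (cos ((x - y) \<bullet> \<xi>) * e t \<xi>))"
  have Gs: "integrable lborel (\<lambda>y::real^'n. fund_sol \<theta> y s)"
    using fund_sol_integrable[OF \<open>0 < s\<close> \<theta>] .
  have [measurable]: "(\<lambda>(x, \<xi>). F x \<xi>) \<in> borel_measurable (lborel \<Otimes>\<^sub>M lborel)"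
    unfolding F_def by measurable
  have F_int: "integrable (lborel \<Otimes>\<^sub>M lborel) (\<lambda>(y, \<xi>). F y \<xi>)"
  proof (rule Bochner_Integration.integrable_bound)
    show "integrable (lborel \<Otimes>\<^sub>M lborel) (\<lambda>(y::real^'n, \<xi>). fund_sol \<theta> y s * e t \<xi>)"
      unfolding e_def by (intro integrable_lborel_pair_mult Gs integrable_exp_neg_norm_powr \<open>0 < t\<close> \<theta>)
    show "AE w in lborel \<Otimes>\<^sub>M lborel. norm (case w of (y, \<xi>) \<Rightarrow> F y \<xi>) \<le> norm (case w of (y, \<xi>) \<Rightarrow> fund_sol \<theta> y s * e t \<xi>)"
      by (rule AE_I2) (auto simp: F_def e_def abs_mult intro!: mult_left_mono)
  qed simp
  have eqF: "fund_sol \<theta> (x - y) t * fund_sol \<theta> y s = C * (\<integral>\<xi>. F y \<xi> \<partial>lborel)" for y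
    unfolding F_def e_def C_def by (simp add: fund_sol_lborel[of _ "x - y"])
  show "integrable lborel (\<lambda>y. fund_sol \<theta> (x - y) t * fund_sol \<theta> y s)"
    unfolding eqF using lborel_pair.integrable_fst'[OF F_int] by simp
  have inner: "(\<integral>y. F y \<xi> \<partial>lborel) = cos (x \<bullet> \<xi>) * e (t + s) \<xi>" for \<xi>
  proof -
    have bnd: "integrable lborel (\<lambda>y. f (\<xi> \<bullet> y) * fund_sol \<theta> y s)"
      if [measurable]: "f \<in> borel_measurable borel" and "\<And>r. \<bar>f r\<bar> \<le> 1" for f :: "real \<Rightarrow> real"
      by (rule Bochner_Integration.integrable_bound[OF Gs])
         (auto intro!: AE_I2 mult_left_le_one_le that simp: abs_mult)
    \<comment> \<open>The reflection of \<open>y\<close>: the kernel is even and the sine odd, so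
      the sine term of the addition formula drops out.\<close>
    have odd: "(\<integral>y. sin (\<xi> \<bullet> y) * fund_sol \<theta> y s \<partial>lborel) = 0"
      using lborel_integral_affine[of "\<lambda>y. sin (\<xi> \<bullet> y) * fund_sol \<theta> y s" "-1" 0]
      by (simp add: fund_sol_uminus)
    have "F y \<xi> = e t \<xi> * cos (x \<bullet> \<xi>) * (cos (\<xi> \<bullet> y) * fund_sol \<theta> y s) + e t \<xi> * sin (x \<bullet> \<xi>) * (sin (\<xi> \<bullet> y) * fund_sol \<theta> y s)" for y
      unfolding F_def by (simp add: inner_diff_left cos_diff inner_commute[of y] algebra_simps)
    then have "(\<integral>y. F y \<xi> \<partial>lborel) = e t \<xi> * cos (x \<bullet> \<xi>) * (\<integral>y. cos (\<xi> \<bullet> y) * fund_sol \<theta> y s \<partial>lborel)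
        + e t \<xi> * sin (x \<bullet> \<xi>) * (\<integral>y. sin (\<xi> \<bullet> y) * fund_sol \<theta> y s \<partial>lborel)"
      using bnd[of cos] bnd[of sin] by simp
    also have "\<dots> = cos (x \<bullet> \<xi>) * (e t \<xi> * e s \<xi>)"
      unfolding odd fund_sol_cos_integral[OF \<open>0 < s\<close> \<theta>] by (simp add: e_def)
    also have "e t \<xi> * e s \<xi> = e (t + s) \<xi>"
      by (simp add: e_def exp_add[symmetric] algebra_simps)
    finally show ?thesis .
  qed
  have "(\<integral>y. fund_sol \<theta> (x - y) t * fund_sol \<theta> y s \<partial>lborel) = C * (\<integral>y. (\<integral>\<xi>. F y \<xi> \<partial>lborel) \<partial>lborel)"
    unfolding eqF by simp
  also have "(\<integral>y. (\<integral>\<xi>. F y \<xi> \<partial>lborel) \<partial>lborel) = (\<integral>\<xi>. (\<integral>y. F y \<xi> \<partial>lborel) \<partial>lborel)"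
    using F_int by (rule lborel_pair.Fubini_integral[symmetric])
  finally show "(\<integral>y. fund_sol \<theta> (x - y) t * fund_sol \<theta> y s \<partial>lborel) = fund_sol \<theta> x (t + s)"
    unfolding inner by (simp only: C_def e_def fund_sol_lborel[of _ x "t + s"])
qed

section \<open>The linear evolution of the absolute value of the datum\<close>

text \<open>Here \<open>f\<close> plays the role of a Borel representative of \<open>\<phi>\<close>, and \<open>C0\<close> of its norm.\<close>

locale critical_data =
  fixes \<theta> \<kappa> \<alpha> C0 :: real and f :: "real^'n \<Rightarrow> real"
  assumes \<theta>: "0 < \<theta>" "\<theta> \<le> 2"
    and \<kappa>_eq: "\<kappa> = real CARD('n) / \<theta>"
    and \<alpha>: "\<kappa> < \<alpha>"
    and f_meas [measurable]: "f \<in> borel_measurable borel"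
    and C0: "0 \<le> C0"
    and f_bound: "\<And>E z s. E \<in> sets borel \<Longrightarrow> 0 < s \<Longrightarrow> emeasure lborel E = ennreal s \<Longrightarrow>
      (\<integral>\<^sup>+x\<in>E \<inter> ball z 1. ennreal \<bar>f x\<bar> \<partial>lborel) \<le> ennreal (C0 * ln (exp 1 + 1 / s) powr (- \<alpha>))"
begin

abbreviation "G \<equiv> fund_sol \<theta> :: real^'n \<Rightarrow> real \<Rightarrow> real"

text \<open>Values in \<open>ennreal\<close> let the averaging arguments and the semigroup identity
  run before finiteness is known; finiteness for small times is an outcome of
  \<open>W_sup\<close>.\<close>

definition W :: "real^'n \<Rightarrow> real \<Rightarrow> ennreal" where
  "W x t = (\<integral>\<^sup>+y. ennreal (G (x - y) t * \<bar>f y\<bar>) \<partial>lborel)"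

lemma \<kappa>_pos: "\<kappa> > 0"
  using \<theta> by (simp add: \<kappa>_eq)

lemma \<alpha>_pos: "\<alpha> > 0"
  using \<kappa>_pos \<alpha> by linarith

lemma G_nonneg: "0 < t \<Longrightarrow> 0 \<le> G x t"
  using \<theta> by (rule_tac fund_sol_nonneg)

lemma nn_integral_G: "0 < t \<Longrightarrow> (\<integral>\<^sup>+x. ennreal (G x t) \<partial>lborel) = 1"
  using \<theta> by (subst nn_integral_eq_integral) (auto simp: fund_sol_integrable fund_sol_integral G_nonneg)

lemma ln_ge_1: "s > 0 \<Longrightarrow> 1 \<le> ln (exp 1 + 1 / s)" for s :: real
  by (subst ln_ge_iff) (auto intro: add_pos_pos)

lemma ln_powr_le_1: "s > 0 \<Longrightarrow> ln (exp 1 + 1 / s) powr (- \<alpha>) \<le> 1"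
  using ln_ge_1[of s] \<alpha>_pos by (simp add: powr_minus inverse_le_1_iff ge_one_powr_ge_zero)

lemma f_ball_bound: "(\<integral>\<^sup>+x\<in>ball z 1. ennreal \<bar>f x\<bar> \<partial>lborel) \<le> ennreal C0"
proof -
  have "emeasure lborel (ball z 1) = ennreal (measure lborel (ball z 1))"
    by (intro emeasure_eq_ennreal_measure) (use emeasure_lborel_ball_finite[of z 1] in auto)
  moreover have "measure lborel (ball z 1) > 0"
    using content_ball_pos[of 1 z] by simp
  ultimately have "(\<integral>\<^sup>+x\<in>ball z 1 \<inter> ball z 1. ennreal \<bar>f x\<bar> \<partial>lborel)
     \<le> ennreal (C0 * ln (exp 1 + 1 / measure lborel (ball z 1)) powr (- \<alpha>))"
    by (intro f_bound) auto
  also have "\<dots> \<le> ennreal C0"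
    using \<open>measure lborel (ball z 1) > 0\<close> C0 by (intro ennreal_leI mult_left_le ln_powr_le_1)
  finally show ?thesis by simp
qed

lemma W_measurable [measurable (raw)]:
  assumes [measurable]: "g \<in> borel_measurable M" "h \<in> borel_measurable M"
  shows "(\<lambda>z. W (g z) (h z)) \<in> borel_measurable M"
  unfolding W_def by measurable

text \<open>\<open>W x t\<close> is an average of translates of the absolute value of
  \<open>f\<close>, with weights \<open>G y t\<close> of total mass 1. A bound for \<open>f\<close>
  tested against all translates of \<open>h\<close> therefore passes to \<open>W\<close> with the
  same constant, uniformly in \<open>t\<close>.\<close>

lemma W_test:
  assumes [measurable]: "h \<in> borel_measurable borel" and "0 < t"
    and B: "\<And>y. (\<integral>\<^sup>+u. h (y + u) * ennreal \<bar>f u\<bar> \<partial>lborel) \<le> B"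
  shows "(\<integral>\<^sup>+x. h x * W x t \<partial>lborel) \<le> B"
proof -
  have W_eq: "W x t = (\<integral>\<^sup>+y. ennreal (G y t) * ennreal \<bar>f (x - y)\<bar> \<partial>lborel)" for x
    unfolding W_def using \<open>0 < t\<close>
    by (subst nn_integral_lborel_affine[of _ "-1" x]) (auto simp: ennreal_mult' G_nonneg)
  have "(\<integral>\<^sup>+x. h x * W x t \<partial>lborel)
      = (\<integral>\<^sup>+x. (\<integral>\<^sup>+y. ennreal (G y t) * (h x * ennreal \<bar>f (x - y)\<bar>) \<partial>lborel) \<partial>lborel)"
    unfolding W_eq by (subst nn_integral_cmult[symmetric]) (auto intro!: nn_integral_cong simp: mult_ac)
  also have "\<dots> = (\<integral>\<^sup>+y. (\<integral>\<^sup>+x. ennreal (G y t) * (h x * ennreal \<bar>f (x - y)\<bar>) \<partial>lborel) \<partial>lborel)"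
    by (rule lborel_pair.Fubini') measurable
  also have "\<dots> = (\<integral>\<^sup>+y. ennreal (G y t) * (\<integral>\<^sup>+x. h x * ennreal \<bar>f (x - y)\<bar> \<partial>lborel) \<partial>lborel)"
    by (subst nn_integral_cmult) auto
  also have "\<dots> \<le> (\<integral>\<^sup>+y. ennreal (G y t) * B \<partial>lborel)"
  proof (intro nn_integral_mono mult_left_mono)
    fix y :: "real^'n"
    have "(\<integral>\<^sup>+x. h x * ennreal \<bar>f (x - y)\<bar> \<partial>lborel) = (\<integral>\<^sup>+u. h (y + u) * ennreal \<bar>f u\<bar> \<partial>lborel)"
      by (subst nn_integral_lborel_affine[of _ 1 y]) auto
    then show "(\<integral>\<^sup>+x. h x * ennreal \<bar>f (x - y)\<bar> \<partial>lborel) \<le> B"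
      using B by simp
  qed simp
  also have "\<dots> = B"
    using \<open>0 < t\<close> by (simp add: nn_integral_multc nn_integral_G)
  finally show ?thesis .
qed

text \<open>Translation moves \<open>E\<close> and the unit ball together: the set keeps its
  measure, only the centre changes, and the hypothesis on \<open>f\<close> is uniform in the centre.
  So the constant \<open>C0\<close> of the datum survives for all times.\<close>

lemma W_bound:
  assumes [measurable]: "E \<in> sets borel" and "0 < s" "emeasure lborel E = ennreal s" "0 < t"
  shows "(\<integral>\<^sup>+x\<in>E \<inter> ball z 1. W x t \<partial>lborel) \<le> ennreal (C0 * ln (exp 1 + 1 / s) powr (- \<alpha>))"
proof -
  have [measurable]: "ball z 1 \<in> sets borel" by simp
  have "(\<integral>\<^sup>+x. indicator (E \<inter> ball z 1) x * W x t \<partial>lborel) \<le> ennreal (C0 * ln (exp 1 + 1 / s) powr (- \<alpha>))"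
  proof (rule W_test)
    fix y :: "real^'n"
    define E' where "E' = (+) y -` E"
    have [measurable]: "E' \<in> sets borel"
      unfolding E'_def by (rule measurable_sets_borel[OF _ assms(1)]) simp
    have "emeasure lborel E' = emeasure (distr lborel borel ((+) y)) E"
      unfolding E'_def by (subst emeasure_distr) auto
    then have "emeasure lborel E' = ennreal s"
      by (simp add: lborel_distr_plus assms)
    then have "(\<integral>\<^sup>+x\<in>E' \<inter> ball (z - y) 1. ennreal \<bar>f x\<bar> \<partial>lborel) \<le> ennreal (C0 * ln (exp 1 + 1 / s) powr (- \<alpha>))"
      using \<open>0 < s\<close> by (intro f_bound) auto
    moreover have "indicator (E \<inter> ball z 1) (y + u) = (indicator (E' \<inter> ball (z - y) 1) u :: ennreal)" for u
      by (auto simp: indicator_def E'_def dist_norm algebra_simps)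
    ultimately show "(\<integral>\<^sup>+u. indicator (E \<inter> ball z 1) (y + u) * ennreal \<bar>f u\<bar> \<partial>lborel) \<le> ennreal (C0 * ln (exp 1 + 1 / s) powr (- \<alpha>))"
      by (simp add: mult.commute)
  qed (auto simp: assms)
  then show ?thesis by (simp add: mult.commute)
qed

text \<open>Tonelli reduces this to the semigroup property of the kernel; in \<open>ennreal\<close>
  it is an identity even where both sides are infinite.\<close>

lemma W_semigroup:
  assumes "0 < s" "s < t"
  shows "(\<integral>\<^sup>+y. ennreal (G (x - y) (t - s)) * W y s \<partial>lborel) = W x t"
proof -
  have "(\<integral>\<^sup>+y. ennreal (G (x - y) (t - s)) * W y s \<partial>lborel)
      = (\<integral>\<^sup>+y. (\<integral>\<^sup>+v. ennreal \<bar>f v\<bar> * (ennreal (G (x - y) (t - s)) * ennreal (G (y - v) s)) \<partial>lborel) \<partial>lborel)"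
    unfolding W_def using assms
    by (subst nn_integral_cmult[symmetric]) (auto intro!: nn_integral_cong simp: ennreal_mult' G_nonneg mult_ac)
  also have "\<dots> = (\<integral>\<^sup>+v. (\<integral>\<^sup>+y. ennreal \<bar>f v\<bar> * (ennreal (G (x - y) (t - s)) * ennreal (G (y - v) s)) \<partial>lborel) \<partial>lborel)"
    by (rule lborel_pair.Fubini') measurable
  also have "\<dots> = (\<integral>\<^sup>+v. ennreal \<bar>f v\<bar> * (\<integral>\<^sup>+y. ennreal (G (x - y) (t - s)) * ennreal (G (y - v) s) \<partial>lborel) \<partial>lborel)"
    by (subst nn_integral_cmult) auto
  also have "\<dots> = (\<integral>\<^sup>+v. ennreal \<bar>f v\<bar> * ennreal (G (x - v) t) \<partial>lborel)"
  proof (intro nn_integral_cong arg_cong2[where f="(*)"] refl)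
    fix v
    have "(\<integral>\<^sup>+y. ennreal (G (x - y) (t - s)) * ennreal (G (y - v) s) \<partial>lborel)
       = (\<integral>\<^sup>+y. ennreal (G ((x - v) - y) (t - s) * G y s) \<partial>lborel)"
      using assms by (subst nn_integral_lborel_affine[of _ 1 v]) (auto simp: ennreal_mult' G_nonneg diff_diff_eq)
    also have "\<dots> = ennreal (G (x - v) (t - s + s))"
      using assms \<theta> fund_sol_semigroup[of "t - s" s \<theta> "x - v"]
      by (subst nn_integral_eq_integral) (auto simp: G_nonneg)
    finally show "(\<integral>\<^sup>+y. ennreal (G (x - y) (t - s)) * ennreal (G (y - v) s) \<partial>lborel) = ennreal (G (x - v) t)"
      by simp
  qed
  also have "\<dots> = W x t"
    unfolding W_def using assms by (auto intro!: nn_integral_cong simp: ennreal_mult' G_nonneg mult_ac)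
  finally show ?thesis .
qed

text \<open>Averaging over balls of radius \<open>t powr (1 / \<theta>)\<close>: a radially decreasing kernel at scale \<open>t powr (1 / \<theta>)\<close>
  changes only by an integrable majorant when its argument moves by that radius.\<close>

lemma W_le:
  "\<exists>H\<ge>0. \<forall>x t. 0 < t \<and> t \<le> 1 \<longrightarrow>
     W x t \<le> ennreal (H * t powr (- \<kappa>) * ln (exp 1 + 1 / (measure lborel (ball (0::real^'n) 1) * t powr \<kappa>)) powr (- \<alpha>))"
proof -
  let ?n = "CARD('n)"
  define g where "g = (\<lambda>v. G v 1)"
  have [measurable]: "g \<in> borel_measurable borel" unfolding g_def by measurable
  have g_nn: "g v \<ge> 0" for v unfolding g_def by (rule G_nonneg) simp
  have g_mono: "g w \<le> g v" if "norm v \<le> norm w" for v w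
    unfolding g_def using \<theta> that by (intro fund_sol_antimono) auto
  define V where "V = measure lborel (ball (0::real^'n) 1)"
  have V: "V > 0" unfolding V_def by (rule content_ball_pos) simp
  \<comment> \<open>A majorant for the values of \<open>g\<close> at points within distance 1 of
    \<open>v\<close>: near the origin the maximum \<open>g 0\<close>, and for norm at least 2 the
    value at half of \<open>v\<close>, since then \<open>norm v - 1\<close> is at least half of
    \<open>norm v\<close>.\<close>
  define h where "h = (\<lambda>v::real^'n. ennreal (g 0) * indicator (ball 0 2) v + ennreal (g (0 + (1/2) *\<^sub>R v)))"
  have [measurable]: "ball z r \<in> sets borel" for z :: "real^'n" and r by simp
  have [measurable]: "h \<in> borel_measurable borel" unfolding h_def by measurable
  have ball_fin: "emeasure lborel (ball z r) < \<top>" for z :: "real^'n" and r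
    using emeasure_lborel_ball_finite[of z r] by (simp add: less_top)
  have "(\<integral>\<^sup>+v. h v \<partial>lborel) = ennreal (g 0) * emeasure lborel (ball (0::real^'n) 2) + (\<integral>\<^sup>+v. ennreal (g (0 + (1/2) *\<^sub>R v)) \<partial>lborel)"
    unfolding h_def by (subst nn_integral_add) (auto simp: nn_integral_cmult_indicator)
  moreover have "(\<integral>\<^sup>+v. ennreal (g (0 + (1/2) *\<^sub>R v)) \<partial>lborel) < \<top>"
    using nn_integral_lborel_affine[of "\<lambda>v. ennreal (g v)" "1/2" 0] nn_integral_G[of 1]
    by (auto simp: g_def ennreal_mult_eq_top_iff less_top[symmetric] ennreal_top_mult)
  ultimately have "(\<integral>\<^sup>+v. h v \<partial>lborel) < \<top>"
    using ball_fin[of 0 2] by (simp add: ennreal_mult_less_top)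
  then obtain H where H: "H \<ge> 0" "(\<integral>\<^sup>+v. h v \<partial>lborel) = ennreal H"
    by (cases "\<integral>\<^sup>+v. h v \<partial>lborel") auto
  have "W x t \<le> ennreal (H * C0 / V * t powr (- \<kappa>) * ln (exp 1 + 1 / (V * t powr \<kappa>)) powr (- \<alpha>))"
    if t: "0 < t" "t \<le> 1" for x t
  proof -
    define r where "r = t powr (1 / \<theta>)"
    have r: "0 < r" "r \<le> 1"
      using t \<theta> by (auto simp: r_def intro!: powr_le1)
    have rn: "r ^ ?n = t powr \<kappa>"
      using r t by (simp add: r_def \<kappa>_eq powr_powr flip: powr_realpow)
    have G_eq: "G v t = t powr (- \<kappa>) * g ((1 / r) *\<^sub>R v)" for v
      using fund_sol_scaling[OF t(1) \<theta>(1), of v] \<theta> t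
      by (simp add: g_def r_def \<kappa>_eq powr_minus field_simps powr_divide inverse_eq_divide)
    have ball_r: "emeasure lborel (ball z r) = ennreal (V * t powr \<kappa>)" for z :: "real^'n"
    proof -
      have "measure lborel (ball z r) = measure lborel (ball (0::real^'n) 1) * r ^ ?n" for z :: "real^'n"
        using r content_ball_conv_unit_ball[of r z] by (simp add: mult.commute)
      then show ?thesis
        using ball_fin[of z r] unfolding V_def rn[symmetric]
        by (subst emeasure_eq_ennreal_measure) auto
    qed
    define l where "l = ln (exp 1 + 1 / (V * t powr \<kappa>)) powr (- \<alpha>)"
    \<comment> \<open>Because \<open>r \<le> 1\<close>, which comes from \<open>t \<le> 1\<close>,
      the ball equals its intersection with the unit ball, and the hypothesis on \<open>f\<close>
      applies with this ball as \<open>E\<close>.\<close>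
    have f_ball: "(\<integral>\<^sup>+y\<in>ball z r. ennreal \<bar>f y\<bar> \<partial>lborel) \<le> ennreal (C0 * l)" for z
    proof -
      have "ball z r \<inter> ball z 1 = ball z r" using r by auto
      then show ?thesis
        using f_bound[of "ball z r" "V * t powr \<kappa>" z] ball_r V t by (simp add: l_def)
    qed
    have key: "ennreal (G (x - y) t * \<bar>f y\<bar>) * indicator (ball y r) z
       \<le> ennreal (t powr (- \<kappa>)) * (h ((1 / r) *\<^sub>R (x - z)) * (ennreal \<bar>f y\<bar> * indicator (ball z r) y))" for y z
    proof (cases "dist y z < r")
      case True
      define v where "v = (1 / r) *\<^sub>R (x - z)"
      define v' where "v' = (1 / r) *\<^sub>R (x - y)"
      have "norm (v' - v) = dist y z / r"
        using r by (simp add: v_def v'_def dist_norm norm_minus_commute flip: scaleR_diff_right)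
      also have "\<dots> < 1" using True r by simp
      finally have vv: "norm (v' - v) < 1" .
      have "ennreal (g v') \<le> h v"
      proof (cases "norm v < 2")
        case True
        have "ennreal (g v') \<le> ennreal (g 0)"
          by (intro ennreal_leI g_mono) simp
        also have "\<dots> \<le> h v" using True by (simp add: h_def)
        finally show ?thesis .
      next
        case False
        have "norm v \<le> norm v' + norm (v' - v)"
          using norm_triangle_ineq4[of v' "v' - v"] by simp
        then have "norm (0 + (1/2) *\<^sub>R v) \<le> norm v'"
          using False vv by simp
        then have "ennreal (g v') \<le> ennreal (g (0 + (1/2) *\<^sub>R v))"
          by (intro ennreal_leI g_mono)
        also have "\<dots> \<le> h v" by (simp add: h_def)
        finally show ?thesis .
      qed
      then have "ennreal (t powr (- \<kappa>)) * (ennreal (g v') * ennreal \<bar>f y\<bar>) \<le> ennreal (t powr (- \<kappa>)) * (h v * ennreal \<bar>f y\<bar>)"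
        by (intro mult_left_mono mult_right_mono) auto
      then show ?thesis
        using True g_nn[of v'] unfolding G_eq v_def v'_def
        by (simp add: ennreal_mult' mult.assoc dist_commute)
    qed (simp add: dist_commute)
    have ind: "indicator (ball z r) y = (if dist z y < r then 1 else 0 :: ennreal)" for y z :: "real^'n"
      by (simp add: indicator_def)
    \<comment> \<open>Multiplying by the volume of a ball of radius \<open>r\<close> inserts an
      integration over \<open>z\<close> in \<open>ball y r\<close>. The relation between
      \<open>y\<close> and \<open>z\<close> is symmetric, so exchanging the order leaves the mass of
      \<open>f\<close> in \<open>ball z r\<close>, which is under control.\<close>
    have "ennreal (V * t powr \<kappa>) * W x t
        = (\<integral>\<^sup>+y. (\<integral>\<^sup>+z. ennreal (G (x - y) t * \<bar>f y\<bar>) * indicator (ball y r) z \<partial>lborel) \<partial>lborel)"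
      unfolding W_def
      by (simp add: nn_integral_cmult_indicator ball_r nn_integral_multc) (simp add: mult.commute)
    also have "\<dots> \<le> (\<integral>\<^sup>+y. (\<integral>\<^sup>+z. ennreal (t powr (- \<kappa>)) * (h ((1 / r) *\<^sub>R (x - z)) * (ennreal \<bar>f y\<bar> * indicator (ball z r) y)) \<partial>lborel) \<partial>lborel)"
      by (intro nn_integral_mono key)
    also have "\<dots> = (\<integral>\<^sup>+z. (\<integral>\<^sup>+y. ennreal (t powr (- \<kappa>)) * (h ((1 / r) *\<^sub>R (x - z)) * (ennreal \<bar>f y\<bar> * indicator (ball z r) y)) \<partial>lborel) \<partial>lborel)"
      unfolding ind by (rule lborel_pair.Fubini') measurable
    also have "\<dots> = ennreal (t powr (- \<kappa>)) * (\<integral>\<^sup>+z. h ((1 / r) *\<^sub>R (x - z)) * (\<integral>\<^sup>+y\<in>ball z r. ennreal \<bar>f y\<bar> \<partial>lborel) \<partial>lborel)"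
    proof -
      have m: "(\<lambda>z. \<integral>\<^sup>+y\<in>ball z r. ennreal \<bar>f y\<bar> \<partial>lborel) \<in> borel_measurable borel"
        unfolding ind by measurable
      have "(\<integral>\<^sup>+y. ennreal (t powr (- \<kappa>)) * (h ((1 / r) *\<^sub>R (x - z)) * (ennreal \<bar>f y\<bar> * indicator (ball z r) y)) \<partial>lborel)
         = ennreal (t powr (- \<kappa>)) * (h ((1 / r) *\<^sub>R (x - z)) * (\<integral>\<^sup>+y\<in>ball z r. ennreal \<bar>f y\<bar> \<partial>lborel))" for z
        by (simp add: nn_integral_cmult)
      then show ?thesis
        using m by (simp add: nn_integral_cmult)
    qed
    also have "\<dots> \<le> ennreal (t powr (- \<kappa>)) * (\<integral>\<^sup>+z. h ((1 / r) *\<^sub>R (x - z)) * ennreal (C0 * l) \<partial>lborel)"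
      by (intro mult_left_mono nn_integral_mono f_ball) auto
    also have "(\<integral>\<^sup>+z. h ((1 / r) *\<^sub>R (x - z)) * ennreal (C0 * l) \<partial>lborel) = ennreal (t powr \<kappa> * H) * ennreal (C0 * l)"
    proof -
      have "(\<integral>\<^sup>+z. h ((1 / r) *\<^sub>R (x - z)) \<partial>lborel) = ennreal (\<bar>- r\<bar> ^ DIM(real^'n)) * (\<integral>\<^sup>+v. h ((1 / r) *\<^sub>R (x - (x + (- r) *\<^sub>R v))) \<partial>lborel)"
        using r by (intro nn_integral_lborel_affine) auto
      also have "\<dots> = ennreal (t powr \<kappa> * H)"
        using r H by (simp add: rn ennreal_mult')
      finally show ?thesis
        by (simp add: nn_integral_multc)
    qed
    finally have *: "ennreal (V * t powr \<kappa>) * W x t \<le> ennreal (t powr (- \<kappa>)) * (ennreal (t powr \<kappa> * H) * ennreal (C0 * l))" .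
    have "W x t = ennreal (1 / (V * t powr \<kappa>)) * (ennreal (V * t powr \<kappa>) * W x t)"
      using V t by (simp add: mult.assoc[symmetric] ennreal_mult[symmetric])
    also have "\<dots> \<le> ennreal (1 / (V * t powr \<kappa>)) * (ennreal (t powr (- \<kappa>)) * (ennreal (t powr \<kappa> * H) * ennreal (C0 * l)))"
      by (intro mult_left_mono *) simp
    also have "\<dots> = ennreal (1 / (V * t powr \<kappa>) * (t powr (- \<kappa>) * (t powr \<kappa> * H * (C0 * l))))"
    proof -
      have "0 \<le> 1 / (V * t powr \<kappa>)" "0 \<le> t powr \<kappa> * H" "0 \<le> C0 * l" "0 \<le> t powr (- \<kappa>)"
        using V H C0 by (auto simp: l_def)
      then show ?thesis
        by (simp only: ennreal_mult[symmetric] mult_nonneg_nonneg)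
    qed
    also have "1 / (V * t powr \<kappa>) * (t powr (- \<kappa>) * (t powr \<kappa> * H * (C0 * l))) = H * C0 / V * t powr (- \<kappa>) * l"
      using t V by (simp add: field_simps)
    finally show ?thesis unfolding l_def .
  qed
  then show ?thesis
    using H C0 V by (intro exI[of _ "H * C0 / V"]) (auto simp: V_def)
qed

text \<open>The volume inside the logarithm is a constant times a power of \<open>t\<close>, so the
  quotient of the two logarithms tends to \<kappa>. Half of this limit is a lower bound near 0 and
  costs the factor \<open>(k / 2) powr (- \<alpha>)\<close> in the constant.\<close>

lemma W_sup:
  obtains C T where "C \<ge> 0" "0 < T" "T < 1"
    "\<And>x t. 0 < t \<Longrightarrow> t \<le> T \<Longrightarrow> W x t \<le> ennreal (C * t powr (- \<kappa>) * ln (exp 1 + 1 / t) powr (- \<alpha>))"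
proof -
  define V where "V = measure lborel (ball (0::real^'n) 1)"
  have V: "V > 0" unfolding V_def by (rule content_ball_pos) simp
  define k where "k = \<kappa>"
  have k: "k > 0" unfolding k_def by (rule \<kappa>_pos)
  have "((\<lambda>t. ln (exp 1 + 1 / (V * t powr k)) / ln (exp 1 + 1 / t)) \<longlongrightarrow> k) (at_right 0)"
    using V k by real_asymp
  then have "\<forall>\<^sub>F t in at_right 0. k / 2 < ln (exp 1 + 1 / (V * t powr k)) / ln (exp 1 + 1 / t)"
    using k by (intro order_tendstoD) auto
  then obtain b where b: "b > 0" "\<And>t. 0 < t \<Longrightarrow> t < b \<Longrightarrow> k / 2 < ln (exp 1 + 1 / (V * t powr k)) / ln (exp 1 + 1 / t)"
    by (auto simp: eventually_at_right_field)
  \<comment> \<open>\<open>b / 2\<close> puts the closed range \<open>t \<le> T\<close> inside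
    \<open>t < b\<close>; \<open>1 / 2\<close> keeps \<open>T\<close> below 1, where
    \<open>- ln t\<close> is positive.\<close>
  define T where "T = min (b / 2) (1 / 2)"
  obtain H where H: "H \<ge> 0" "\<And>x t. 0 < t \<Longrightarrow> t \<le> 1 \<Longrightarrow>
     W x t \<le> ennreal (H * t powr (- \<kappa>) * ln (exp 1 + 1 / (V * t powr k)) powr (- \<alpha>))"
    using W_le unfolding V_def k_def by blast
  show ?thesis
  proof (rule that)
    show "H * (k / 2) powr (- \<alpha>) \<ge> 0" "0 < T" "T < 1"
      using H b by (auto simp: T_def)
    fix x :: "real^'n" and t :: real assume t: "0 < t" "t \<le> T"
    have ln_pos: "ln (exp 1 + 1 / t) > 0"
      using ln_ge_1[OF t(1)] by linarith
    have "k / 2 * ln (exp 1 + 1 / t) \<le> ln (exp 1 + 1 / (V * t powr k))"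
      using b(2)[of t] t b(1) ln_pos by (auto simp: T_def field_simps)
    then have "ln (exp 1 + 1 / (V * t powr k)) powr (- \<alpha>) \<le> (k / 2 * ln (exp 1 + 1 / t)) powr (- \<alpha>)"
      using k ln_pos \<alpha>_pos by (intro powr_mono2') auto
    also have "\<dots> = (k / 2) powr (- \<alpha>) * ln (exp 1 + 1 / t) powr (- \<alpha>)"
      using k ln_pos by (intro powr_mult)
    finally have "H * t powr (- \<kappa>) * ln (exp 1 + 1 / (V * t powr k)) powr (- \<alpha>)
       \<le> H * t powr (- \<kappa>) * ((k / 2) powr (- \<alpha>) * ln (exp 1 + 1 / t) powr (- \<alpha>))"
      using H by (intro mult_left_mono) auto
    then show "W x t \<le> ennreal (H * (k / 2) powr (- \<alpha>) * t powr (- \<kappa>) * ln (exp 1 + 1 / t) powr (- \<alpha>))"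
      using t by (intro order_trans[OF H(2)] ennreal_leI) (auto simp: T_def mult_ac)
  qed
qed

end

section \<open>Contraction for the Duhamel map\<close>

text \<open>Replacing \<open>ln (exp 1 + 1 / s)\<close> by the smaller \<open>- ln s\<close>
  enlarges the integrand and provides the primitive \<open>F\<close>, which vanishes at 0 because
  \<open>1 < m\<close>. The condition \<open>t < 1\<close> keeps \<open>- ln s\<close>
  positive.\<close>

lemma nn_integral_inverse_log_powr_le:
  fixes m t :: real
  assumes m: "1 < m" and t: "0 < t" "t < 1"
  shows "(\<integral>\<^sup>+s\<in>{0<..<t}. ennreal (1 / s * ln (exp 1 + 1 / s) powr (- m)) \<partial>lborel)
    \<le> ennreal ((- ln t) powr (1 - m) / (m - 1))"
proof -
  define F where "F = (\<lambda>s::real. (- ln s) powr (1 - m) / (m - 1))"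
  define g where "g = (\<lambda>s::real. 1 / s * (- ln s) powr (- m))"
  have deriv: "DERIV F s :> g s" if "0 < s" "s < 1" for s
  proof -
    have "DERIV F s :> (1 - m) * (- ln s) powr (1 - m - 1) * (- (1 / s)) / (m - 1)"
      unfolding F_def using that m by (auto intro!: derivative_eq_intros)
    moreover have "(1 - m) * (- ln s) powr (1 - m - 1) * (- (1 / s)) / (m - 1) = g s"
      using m that by (simp add: g_def field_simps)
    ultimately show ?thesis by simp
  qed
  have cont: "isCont g s" if "0 < s" "s < 1" for s
    unfolding g_def using that by (intro continuous_intros) auto
  have lim0: "(F \<longlongrightarrow> 0) (at_right 0)"
    unfolding F_def using m by real_asymp
  have limt: "(F \<longlongrightarrow> F t) (at_left t)"
    using DERIV_isCont[OF deriv[OF t]] by (simp add: isCont_def filterlim_at_split)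
  have FTC: "set_integrable lborel (einterval (ereal 0) (ereal t)) g"
    "(LBINT s=ereal 0..ereal t. g s) = F t - 0"
    using t lim0 limt deriv cont
    by (intro interval_integral_FTC_nonneg[where F = F]; force simp: ereal_tendsto_simps g_def)+
  have ein: "einterval (ereal 0) (ereal t) = {0<..<t}"
    by (auto simp: einterval_def)
  have int: "set_integrable lborel {0<..<t} g" and eq: "(LINT s:{0<..<t}|lborel. g s) = F t"
    using FTC t unfolding ein interval_lebesgue_integral_def by auto
  have "(\<integral>\<^sup>+s\<in>{0<..<t}. ennreal (1 / s * ln (exp 1 + 1 / s) powr (- m)) \<partial>lborel)
    \<le> (\<integral>\<^sup>+s. ennreal (indicator {0<..<t} s * g s) \<partial>lborel)"
  proof (intro nn_integral_mono)
    fix s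
    show "ennreal (1 / s * ln (exp 1 + 1 / s) powr (- m)) * indicator {0<..<t} s \<le> ennreal (indicator {0<..<t} s * g s)"
    proof (cases "s \<in> {0<..<t}")
      case True
      then have s: "0 < s" "s < 1" using t by auto
      have "- ln s = ln (1 / s)" using s by (simp add: ln_div)
      also have "\<dots> \<le> ln (exp 1 + 1 / s)"
        using s by (intro ln_mono) (auto intro: add_pos_pos)
      finally have "ln (exp 1 + 1 / s) powr (- m) \<le> (- ln s) powr (- m)"
        using s m by (intro powr_mono2') auto
      then show ?thesis
        using True s by (auto simp: g_def intro!: ennreal_leI divide_right_mono)
    qed simp
  qed
  also have "\<dots> = ennreal (LINT s:{0<..<t}|lborel. g s)"
    using int unfolding set_integrable_def set_lebesgue_integral_def
    by (subst nn_integral_eq_integral) (auto simp: g_def indicator_def)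
  finally show ?thesis unfolding eq F_def .
qed

section \<open>Lipschitz bound for the power nonlinearity\<close>

lemma powr_diff_le:
  fixes a b p :: real
  assumes p: "1 \<le> p" and "0 \<le> b" "b \<le> a"
  shows "a powr p - b powr p \<le> p * a powr (p - 1) * (a - b)"
proof (cases "a = b")
  case False
  then have ab: "b < a" using assms by simp
  have diff: "(\<lambda>x. x powr p) differentiable (at x)" if "b < x" for x
    using that assms has_real_derivative_powr[of x p] by (auto simp: real_differentiable_def)
  have "\<exists>l z. b < z \<and> z < a \<and> DERIV (\<lambda>x. x powr p) z :> l \<and> a powr p - b powr p = (a - b) * l"
    using ab assms
    by (intro MVT) (auto intro!: continuous_intros continuous_on_powr' diff)
  then obtain l z where z: "b < z" "z < a" "DERIV (\<lambda>x. x powr p) z :> l" "a powr p - b powr p = (a - b) * l"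
    by blast
  have "DERIV (\<lambda>x. x powr p) z :> p * z powr (p - 1)"
    using z assms by (intro has_real_derivative_powr) auto
  then have "l = p * z powr (p - 1)"
    using z(3) DERIV_unique by blast
  also have "\<dots> \<le> p * a powr (p - 1)"
    using z assms by (intro mult_left_mono powr_mono2) auto
  finally show ?thesis
    using z(4) ab mult_left_mono[of l "p * a powr (p - 1)" "a - b"] by (simp add: mult.commute)
qed simp

text \<open>By oddness, equal signs reduce to nonnegative arguments, where the mean value theorem
  applies. For opposite signs both values are compared with 0, and since then |a| + |b| = |a - b|
  the constant stays the same.\<close>

lemma Fp_lipschitz:
  assumes p: "1 < p" and a: "\<bar>a\<bar> \<le> M" and b: "\<bar>b\<bar> \<le> M"
  shows "\<bar>Fp p a - Fp p b\<bar> \<le> p * M powr (p - 1) * \<bar>a - b\<bar>"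
proof -
  have Fp_pos: "Fp p x = x powr p" if "x \<ge> 0" for x
    using that by (cases "x = 0") (auto simp: Fp_def powr_mult_base mult.commute[of _ x])
  have Fp_neg: "Fp p (- x) = - Fp p x" for x
    by (simp add: Fp_def)
  have same: "\<bar>Fp p x - Fp p y\<bar> \<le> p * M powr (p - 1) * \<bar>x - y\<bar>" if "0 \<le> y" "y \<le> x" "x \<le> M" for x y
  proof -
    have "y powr p \<le> x powr p" using that p by (intro powr_mono2) auto
    moreover have "x powr p - y powr p \<le> p * x powr (p - 1) * (x - y)"
      using that p by (intro powr_diff_le) auto
    moreover have "p * x powr (p - 1) * (x - y) \<le> p * M powr (p - 1) * (x - y)"
      using that p by (intro mult_right_mono mult_left_mono powr_mono2) auto
    ultimately show ?thesis using that by (simp add: Fp_pos)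
  qed
  have zero: "\<bar>Fp p x\<bar> \<le> p * M powr (p - 1) * \<bar>x\<bar>" if "\<bar>x\<bar> \<le> M" for x
  proof -
    have "\<bar>Fp p x\<bar> = \<bar>Fp p \<bar>x\<bar>\<bar>"
      using Fp_neg[of x] by (simp add: abs_if)
    then show ?thesis
      using same[of 0 "\<bar>x\<bar>"] that by (simp add: Fp_pos)
  qed
  consider "0 \<le> a \<and> 0 \<le> b" | "a \<le> 0 \<and> b \<le> 0" | "a \<le> 0 \<and> 0 \<le> b" | "0 \<le> a \<and> b \<le> 0"
    by linarith
  then show ?thesis
  proof cases
    case 1
    then show ?thesis
      using same[of a b] same[of b a] a b by (cases "a \<le> b") (auto simp: abs_minus_commute)
  next
    case 2
    then show ?thesis
      using same[of "- a" "- b"] same[of "- b" "- a"] a b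
      by (cases "a \<le> b") (auto simp: abs_minus_commute Fp_neg)
  next
    case 3
    have "\<bar>Fp p a - Fp p b\<bar> \<le> \<bar>Fp p a\<bar> + \<bar>Fp p b\<bar>" by (rule abs_triangle_ineq4)
    also have "\<dots> \<le> p * M powr (p - 1) * (\<bar>a\<bar> + \<bar>b\<bar>)"
      using zero[OF a] zero[OF b] by (simp add: distrib_left)
    also have "\<bar>a\<bar> + \<bar>b\<bar> = \<bar>a - b\<bar>" using 3 by simp
    finally show ?thesis .
  next
    case 4
    have "\<bar>Fp p a - Fp p b\<bar> \<le> \<bar>Fp p a\<bar> + \<bar>Fp p b\<bar>" by (rule abs_triangle_ineq4)
    also have "\<dots> \<le> p * M powr (p - 1) * (\<bar>a\<bar> + \<bar>b\<bar>)"
      using zero[OF a] zero[OF b] by (simp add: distrib_left)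
    also have "\<bar>a\<bar> + \<bar>b\<bar> = \<bar>a - b\<bar>" using 4 by simp
    finally show ?thesis .
  qed
qed

text \<open>Banach iteration from 0 in the sup norm weighted by \<open>w\<close>, carried out
  pointwise so that zeros of \<open>w\<close> cause no trouble and the limit stays measurable. A
  first step of size \<open>w\<close> and the factor 1/2 keep all iterates within
  \<open>2 * w\<close>, the radius in which the contraction is assumed.\<close>

lemma weighted_fixed_point:
  fixes w :: "'z \<Rightarrow> real" and \<Phi> :: "('z \<Rightarrow> real) \<Rightarrow> 'z \<Rightarrow> real"
  assumes meas: "\<And>u. u \<in> borel_measurable M \<Longrightarrow> \<Phi> u \<in> borel_measurable M"
    and start: "\<And>z. \<bar>\<Phi> (\<lambda>_. 0) z\<bar> \<le> w z"
    and contr: "\<And>u v c z. u \<in> borel_measurable M \<Longrightarrow> v \<in> borel_measurable M \<Longrightarrow>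
      (\<And>z. \<bar>u z\<bar> \<le> 2 * w z) \<Longrightarrow> (\<And>z. \<bar>v z\<bar> \<le> 2 * w z) \<Longrightarrow> 0 \<le> c \<Longrightarrow>
      (\<And>z. \<bar>u z - v z\<bar> \<le> c * w z) \<Longrightarrow> \<bar>\<Phi> u z - \<Phi> v z\<bar> \<le> c / 2 * w z"
  obtains u where "u \<in> borel_measurable M" "\<And>z. \<bar>u z\<bar> \<le> 2 * w z" "\<Phi> u = u"
proof -
  have w: "0 \<le> w z" for z
    using order_trans[OF abs_ge_zero start] .
  define U where "U = (\<lambda>k. (\<Phi> ^^ k) (\<lambda>_. 0))"
  have U0: "U 0 = (\<lambda>_. 0)" and US: "U (Suc k) = \<Phi> (U k)" for k
    by (auto simp: U_def)
  have U_meas: "U k \<in> borel_measurable M" for k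
    by (induction k) (auto simp: U0 US intro: meas)
  \<comment> \<open>The bound is a partial geometric sum: the first \<open>k\<close> increments are
    at most 1, 1/2, 1/4, ... times \<open>w\<close> and add up to
    \<open>2 - 2 * (1/2)^k\<close>.\<close>
  have step: "(\<forall>z. \<bar>U k z\<bar> \<le> (2 - 2 * (1/2)^k) * w z) \<and> (\<forall>z. \<bar>U (Suc k) z - U k z\<bar> \<le> (1/2)^k * w z)" for k
  proof (induction k)
    case 0
    then show ?case using start by (simp add: U0 US)
  next
    case (Suc k)
    have le: "\<bar>U (Suc k) z\<bar> \<le> (2 - 2 * (1/2)^Suc k) * w z" for z
    proof -
      have "\<bar>U (Suc k) z\<bar> \<le> \<bar>U k z\<bar> + \<bar>U (Suc k) z - U k z\<bar>" by linarith
      also have "\<dots> \<le> (2 - 2 * (1/2)^k) * w z + (1/2)^k * w z"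
        using Suc by (intro add_mono) auto
      finally show ?thesis by (simp add: algebra_simps)
    qed
    have le2: "\<bar>U k z\<bar> \<le> 2 * w z" "\<bar>U (Suc k) z\<bar> \<le> 2 * w z" for z
      using Suc le[of z] w[of z] by (auto intro: order_trans simp: mult_right_mono)
    have "\<bar>\<Phi> (U (Suc k)) z - \<Phi> (U k) z\<bar> \<le> (1/2)^k / 2 * w z" for z
      using le2 Suc by (intro contr U_meas) auto
    then show ?case using le by (simp add: US)
  qed
  have U_le: "\<bar>U k z\<bar> \<le> 2 * w z" for k z
  proof -
    have "(2 - 2 * (1/2)^k) * w z \<le> 2 * w z"
      using w[of z] by (intro mult_right_mono) auto
    then show ?thesis using step[of k] order_trans by blast
  qed
  \<comment> \<open>The negative term is kept so that the induction on \<open>d\<close> closes; it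
    is dropped in \<open>tail'\<close>.\<close>
  have tail: "\<bar>U (k + d) z - U k z\<bar> \<le> (2 * (1/2)^k - 2 * (1/2)^(k + d)) * w z" for k d z
  proof (induction d)
    case (Suc d)
    have "\<bar>U (k + Suc d) z - U k z\<bar> \<le> \<bar>U (Suc (k + d)) z - U (k + d) z\<bar> + \<bar>U (k + d) z - U k z\<bar>"
      by simp
    also have "\<dots> \<le> (1/2)^(k + d) * w z + (2 * (1/2)^k - 2 * (1/2)^(k + d)) * w z"
      using step[of "k + d"] Suc by (intro add_mono) auto
    finally show ?case by (simp add: algebra_simps)
  qed simp
  have tail': "\<bar>U m z - U k z\<bar> \<le> 2 * (1/2)^k * w z" if "k \<le> m" for k m z
  proof -
    have "(2 * (1/2)^k - 2 * (1/2)^m) * w z \<le> 2 * (1/2)^k * w z"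
      using w[of z] by (intro mult_right_mono) auto
    then show ?thesis using tail[where k=k and d="m - k" and z=z] that by simp
  qed
  have small: "(\<lambda>k. c * (1/2)^k * w z) \<longlonglongrightarrow> 0" for c :: real and z
    by (intro tendsto_mult_left_zero tendsto_mult_right_zero LIMSEQ_realpow_zero) auto
  have "Cauchy (\<lambda>k. U k z)" for z
    unfolding Cauchy_altdef2
  proof (intro allI impI)
    fix e :: real assume "e > 0"
    then have "\<forall>\<^sub>F k in sequentially. 2 * (1/2)^k * w z < e"
      using small[of 2 z] by (intro order_tendstoD)
    then obtain N where "2 * (1/2)^N * w z < e"
      by (auto simp: eventually_sequentially)
    then show "\<exists>N. \<forall>n\<ge>N. dist (U n z) (U N z) < e"
      using tail'[of N _ z] by (auto simp: dist_real_def intro!: exI[of _ N] intro: le_less_trans)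
  qed
  then have lim: "(\<lambda>k. U k z) \<longlonglongrightarrow> lim (\<lambda>k. U k z)" for z
    by (simp add: Cauchy_convergent_iff convergent_LIMSEQ_iff)
  define u where "u = (\<lambda>z. lim (\<lambda>k. U k z))"
  have u_lim: "(\<lambda>k. U k z) \<longlonglongrightarrow> u z" for z
    using lim by (simp add: u_def)
  have u_meas: "u \<in> borel_measurable M"
    using u_lim by (rule_tac borel_measurable_LIMSEQ_real[OF _ U_meas])
  have u_le: "\<bar>u z\<bar> \<le> 2 * w z" for z
    by (rule LIMSEQ_le_const2[OF tendsto_rabs[OF u_lim]]) (use U_le in auto)
  have u_diff: "\<bar>u z - U k z\<bar> \<le> 2 * (1/2)^k * w z" for z k
    by (rule LIMSEQ_le_const2[OF tendsto_rabs[OF tendsto_diff[OF u_lim tendsto_const]]])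
       (use tail' in blast)
  have "\<Phi> u z = u z" for z
  proof -
    have "\<bar>\<Phi> u z - u z\<bar> \<le> 2 * (1/2)^k * w z" for k
    proof -
      have "\<bar>\<Phi> u z - \<Phi> (U k) z\<bar> \<le> (2 * (1/2)^k) / 2 * w z"
        by (intro contr u_meas U_meas u_le U_le u_diff) simp
      moreover have "\<bar>u z - U (Suc k) z\<bar> \<le> 2 * (1/2)^Suc k * w z"
        by (rule u_diff)
      ultimately show ?thesis by (simp add: US)
    qed
    then have "\<bar>\<Phi> u z - u z\<bar> \<le> 0"
      by (intro LIMSEQ_le_const[OF small[of 2 z]]) auto
    then show ?thesis by simp
  qed
  then show ?thesis
    using that[OF u_meas u_le] by auto
qed

lemma measurable_fst_borel [measurable]: "fst \<in> borel_measurable (borel :: ('a::euclidean_space \<times> 'b::euclidean_space) measure)"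
  by (intro borel_measurable_continuous_onI continuous_intros)

lemma measurable_snd_borel [measurable]: "snd \<in> borel_measurable (borel :: ('a::euclidean_space \<times> 'b::euclidean_space) measure)"
  by (intro borel_measurable_continuous_onI continuous_intros)

lemma Fp_measurable [measurable (raw)]:
  "u \<in> borel_measurable M \<Longrightarrow> (\<lambda>z. Fp p (u z)) \<in> borel_measurable M"
  unfolding Fp_def by measurable

section \<open>The Duhamel integral measured by the weight\<close>

context critical_data
begin

definition S :: "real^'n \<Rightarrow> real \<Rightarrow> real" where
  "S x t = (\<integral>y. G (x - y) t * f y \<partial>lborel)"

text \<open>Extension by zero outside \<open>0 < s < t\<close> turns the strip integral of Duhamel's
  formula into one integral over space-time with a jointly Borel measurable kernel, and
  \<open>G\<close> is evaluated at positive times only, where it is nonnegative.\<close>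

definition K :: "(real^'n) \<times> real \<Rightarrow> (real^'n) \<times> real \<Rightarrow> real" where
  "K z w = (if 0 < snd w \<and> snd w < snd z then G (fst z - fst w) (snd z - snd w) else 0)"

lemma S_measurable [measurable (raw)]:
  assumes [measurable]: "g \<in> borel_measurable M" "h \<in> borel_measurable M"
  shows "(\<lambda>z. S (g z) (h z)) \<in> borel_measurable M"
  unfolding S_def by measurable

lemma K_measurable [measurable (raw)]:
  assumes [measurable]: "g \<in> borel_measurable M" "h \<in> borel_measurable M"
  shows "(\<lambda>z. K (g z) (h z)) \<in> borel_measurable M"
  unfolding K_def by measurable

lemma S_integrable_bound:
  assumes "0 < t" "W x t < \<top>"
  shows "integrable lborel (\<lambda>y. G (x - y) t * f y)" "\<bar>S x t\<bar> \<le> enn2real (W x t)"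
proof -
  have eq: "(\<integral>\<^sup>+y. ennreal (norm (G (x - y) t * f y)) \<partial>lborel) = W x t"
    unfolding W_def using assms by (simp add: abs_mult G_nonneg)
  show int: "integrable lborel (\<lambda>y. G (x - y) t * f y)"
    using assms eq by (intro integrableI_bounded) auto
  have "ennreal \<bar>S x t\<bar> \<le> W x t"
    using integral_norm_bound_ennreal[OF int] unfolding eq S_def by simp
  then show "\<bar>S x t\<bar> \<le> enn2real (W x t)"
    using assms enn2real_mono by fastforce
qed

text \<open>Integrating in space first, the semigroup identity replaces the integral of
  \<open>G (x - y) (t - s) * W y s\<close> by \<open>W x t\<close>, which does not depend on
  \<open>s\<close>. What is left is the scalar integral of \<open>r\<close>, so the Duhamel term is
  a small multiple of the weight as soon as \<open>R\<close> is small.\<close>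

lemma duhamel_bound:
  fixes g :: "(real^'n) \<times> real \<Rightarrow> real" and r :: "real \<Rightarrow> real"
  assumes [measurable]: "g \<in> borel_measurable borel" "r \<in> borel_measurable borel"
    and g: "\<And>y s. 0 < s \<Longrightarrow> s < t \<Longrightarrow> ennreal \<bar>g (y, s)\<bar> \<le> ennreal (r s) * W y s"
    and R: "(\<integral>\<^sup>+s\<in>{0<..<t}. ennreal (r s) \<partial>lborel) \<le> ennreal R" and "0 \<le> R"
    and W: "W x t < \<top>"
  shows "integrable lborel (\<lambda>w. K (x, t) w * g w)"
    and "\<bar>\<integral>w. K (x, t) w * g w \<partial>lborel\<bar> \<le> R * enn2real (W x t)"
proof -
  have "(\<integral>\<^sup>+w. ennreal (norm (K (x, t) w * g w)) \<partial>lborel)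
      = (\<integral>\<^sup>+s. (\<integral>\<^sup>+y. ennreal (norm (K (x, t) (y, s) * g (y, s))) \<partial>lborel) \<partial>lborel)"
    by (subst lborel_prod[symmetric], subst lborel_pair.nn_integral_snd[symmetric]) (simp_all add: lborel_prod)
  also have "\<dots> \<le> (\<integral>\<^sup>+s. ennreal (r s) * indicator {0<..<t} s * W x t \<partial>lborel)"
  proof (intro nn_integral_mono)
    fix s
    show "(\<integral>\<^sup>+y. ennreal (norm (K (x, t) (y, s) * g (y, s))) \<partial>lborel) \<le> ennreal (r s) * indicator {0<..<t} s * W x t"
    proof (cases "0 < s \<and> s < t")
      case True
      have "(\<integral>\<^sup>+y. ennreal (norm (K (x, t) (y, s) * g (y, s))) \<partial>lborel)
         \<le> (\<integral>\<^sup>+y. ennreal (r s) * (ennreal (G (x - y) (t - s)) * W y s) \<partial>lborel)"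
      proof (intro nn_integral_mono)
        fix y
        have "ennreal (norm (K (x, t) (y, s) * g (y, s))) = ennreal (G (x - y) (t - s)) * ennreal \<bar>g (y, s)\<bar>"
          using True by (simp add: K_def abs_mult G_nonneg ennreal_mult')
        also have "\<dots> \<le> ennreal (G (x - y) (t - s)) * (ennreal (r s) * W y s)"
          using True by (intro mult_left_mono g) auto
        finally show "ennreal (norm (K (x, t) (y, s) * g (y, s))) \<le> ennreal (r s) * (ennreal (G (x - y) (t - s)) * W y s)"
          by (simp add: mult_ac)
      qed
      also have "\<dots> = ennreal (r s) * W x t"
        using True by (simp add: nn_integral_cmult W_semigroup)
      finally show ?thesis using True by simp
    next
      case False
      then show ?thesis by (auto simp: K_def)
    qed
  qed
  also have "\<dots> = (\<integral>\<^sup>+s\<in>{0<..<t}. ennreal (r s) \<partial>lborel) * W x t"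
    by (simp add: nn_integral_multc)
  also have "\<dots> \<le> ennreal R * W x t"
    by (intro mult_right_mono R) simp
  finally have le: "(\<integral>\<^sup>+w. ennreal (norm (K (x, t) w * g w)) \<partial>lborel) \<le> ennreal R * W x t" .
  have fin: "ennreal R * W x t < \<top>"
    using W by (simp add: ennreal_mult_less_top)
  show int: "integrable lborel (\<lambda>w. K (x, t) w * g w)"
    using le fin by (intro integrableI_bounded) auto
  have "ennreal \<bar>\<integral>w. K (x, t) w * g w \<partial>lborel\<bar> \<le> ennreal R * W x t"
    using integral_norm_bound_ennreal[OF int] le by (simp add: order_trans)
  then have "\<bar>\<integral>w. K (x, t) w * g w \<partial>lborel\<bar> \<le> enn2real (ennreal R * W x t)"
    using fin enn2real_mono by fastforce
  then show "\<bar>\<integral>w. K (x, t) w * g w \<partial>lborel\<bar> \<le> R * enn2real (W x t)"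
    using \<open>0 \<le> R\<close> by (simp add: enn2real_mult)
qed

text \<open>The rate \<open>\<eta>\<close> and the bound on \<open>W\<close> are returned together
  with \<open>u\<close>: size and initial behaviour of the solution are read off from them without
  going back to the equation.\<close>

lemma mild_solution_exists:
  assumes p: "p = 1 + 1 / \<kappa>"
  obtains T C u \<eta> where "0 < T" "T < 1" "0 \<le> C" "u \<in> borel_measurable borel"
    "(\<eta> \<longlongrightarrow> 0) (at_right 0)" "\<And>t. 0 < t \<Longrightarrow> t < T \<Longrightarrow> 0 \<le> \<eta> t"
    "\<And>x t. 0 < t \<Longrightarrow> t < T \<Longrightarrow> W x t \<le> ennreal (C * t powr (- \<kappa>) * ln (exp 1 + 1 / t) powr (- \<alpha>))"
    "\<And>x t. 0 < t \<Longrightarrow> t < T \<Longrightarrow> integrable lborel (\<lambda>w. K (x, t) w * Fp p (u w))"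
    "\<And>x t. 0 < t \<Longrightarrow> t < T \<Longrightarrow> u (x, t) = S x t + (\<integral>w. K (x, t) w * Fp p (u w) \<partial>lborel)"
    "\<And>x t. 0 < t \<Longrightarrow> t < T \<Longrightarrow> \<bar>u (x, t)\<bar> \<le> 2 * enn2real (W x t)"
    "\<And>x t. 0 < t \<Longrightarrow> t < T \<Longrightarrow> \<bar>u (x, t) - S x t\<bar> \<le> \<eta> t * enn2real (W x t)"
proof -
  obtain C T1 where C: "C \<ge> 0" and T1: "0 < T1" "T1 < 1" and
    W_le': "\<And>x t. 0 < t \<Longrightarrow> t \<le> T1 \<Longrightarrow> W x t \<le> ennreal (C * t powr (- \<kappa>) * ln (exp 1 + 1 / t) powr (- \<alpha>))"
    by (rule W_sup) blast
  have p1: "1 < p" "p - 1 = 1 / \<kappa>" using \<kappa>_pos p by auto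
  \<comment> \<open>Raising the bound on \<open>W\<close> to the power
    \<open>p - 1 = 1 / \<kappa>\<close> turns \<open>t powr (- \<kappa>)\<close> into
    \<open>1 / t\<close> and the logarithmic exponent \<alpha> into \<open>m\<close>; thus
    \<open>1 < m\<close> expresses \<open>\<kappa> < \<alpha>\<close>.\<close>
  define m where "m = \<alpha> / \<kappa>"
  have m: "1 < m" using \<alpha> \<kappa>_pos by (simp add: m_def)
  \<comment> \<open>\<open>p\<close> is the constant of \<open>Fp_lipschitz\<close>;
    \<open>2 * C\<close> bounds the functions in the iteration, which stay within twice the
    weight.\<close>
  define A where "A = p * (2 * C) powr (1 / \<kappa>)"
  have A: "A \<ge> 0" using p1 by (simp add: A_def)
  define \<rho> where "\<rho> = (\<lambda>s::real. A * (1 / s * ln (exp 1 + 1 / s) powr (- m)))"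
  define \<eta> where "\<eta> = (\<lambda>t::real. A * ((- ln t) powr (1 - m) / (m - 1)))"
  have [measurable]: "\<rho> \<in> borel_measurable borel" unfolding \<rho>_def by measurable
  have \<rho>_nn: "\<rho> s \<ge> 0" if "s > 0" for s
    using that A by (auto simp: \<rho>_def)
  have \<eta>_nn: "\<eta> t \<ge> 0" for t
    using A m by (auto simp: \<eta>_def)
  have \<eta>_lim: "(\<eta> \<longlongrightarrow> 0) (at_right 0)"
  proof -
    have "((\<lambda>t::real. (- ln t) powr (1 - m) / (m - 1)) \<longlongrightarrow> 0) (at_right 0)"
      using m by real_asymp
    then have "(\<eta> \<longlongrightarrow> A * 0) (at_right 0)"
      unfolding \<eta>_def by (intro tendsto_mult tendsto_const)
    then show ?thesis by simp
  qed
  then have "\<forall>\<^sub>F t in at_right 0. \<eta> t < 1 / 2"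
    by (intro order_tendstoD) auto
  then obtain b where b: "b > 0" "\<And>t. 0 < t \<Longrightarrow> t < b \<Longrightarrow> \<eta> t < 1 / 2"
    by (auto simp: eventually_at_right_field)
  define T where "T = min b T1"
  have T: "0 < T" "T < 1" "T \<le> T1" using b T1 by (auto simp: T_def)
  \<comment> \<open>1/2 is the contraction factor expected by \<open>weighted_fixed_point\<close>;
    together with the range of the bound on \<open>W\<close> it determines \<open>T\<close>.\<close>
  have \<eta>_half: "\<eta> t \<le> 1 / 2" if "0 < t" "t < T" for t
    using b(2)[of t] that by (simp add: T_def)
  have \<eta>_int: "(\<integral>\<^sup>+s\<in>{0<..<t}. ennreal (c * \<rho> s) \<partial>lborel) \<le> ennreal (c * \<eta> t)" if "0 < t" "t < T" "0 \<le> c" for c t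
  proof -
    have "(\<integral>\<^sup>+s\<in>{0<..<t}. ennreal (c * \<rho> s) \<partial>lborel)
       = (\<integral>\<^sup>+s. ennreal (c * A) * (ennreal (1 / s * ln (exp 1 + 1 / s) powr (- m)) * indicator {0<..<t} s) \<partial>lborel)"
      using A that by (intro nn_integral_cong)
        (auto simp: \<rho>_def indicator_def mult.assoc ennreal_mult'[symmetric] simp del: times_divide_eq_left times_divide_eq_right)
    also have "\<dots> = ennreal (c * A) * (\<integral>\<^sup>+s\<in>{0<..<t}. ennreal (1 / s * ln (exp 1 + 1 / s) powr (- m)) \<partial>lborel)"
      by (rule nn_integral_cmult) measurable
    also have "\<dots> \<le> ennreal (c * A) * ennreal ((- ln t) powr (1 - m) / (m - 1))"
      using that T by (intro mult_left_mono nn_integral_inverse_log_powr_le m) auto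
    also have "\<dots> = ennreal (c * \<eta> t)"
      using A that by (simp add: \<eta>_def ennreal_mult'[symmetric] mult.assoc)
    finally show ?thesis .
  qed
  \<comment> \<open>The weight, like \<open>\<Phi>\<close> below, is set to 0 outside the time
    strip, so that the fixed point argument can deal with functions on all of space-time.\<close>
  define w where "w = (\<lambda>z. if 0 < snd z \<and> snd z < T then enn2real (W (fst z) (snd z)) else 0)"
  have w_nn: "w z \<ge> 0" for z by (simp add: w_def)
  have W_fin: "W x t < \<top>" if "0 < t" "t < T" for x t
    using W_le'[of t x] that T by (auto intro: le_less_trans)
  have W_eq: "W x t = ennreal (w (x, t))" if "0 < t" "t < T" for x t
    using W_fin[OF that, of x] that by (simp add: w_def)
  have lip: "\<bar>Fp p a - Fp p b\<bar> \<le> \<rho> s * \<bar>a - b\<bar>"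
    if "0 < s" "s < T" "\<bar>a\<bar> \<le> 2 * w (y, s)" "\<bar>b\<bar> \<le> 2 * w (y, s)" for a b s y
  proof -
    define l where "l = ln (exp 1 + 1 / s)"
    have l: "l > 0" using ln_ge_1[OF that(1)] by (simp add: l_def)
    have "ennreal (w (y, s)) \<le> ennreal (C * s powr (- \<kappa>) * l powr (- \<alpha>))"
      using W_le'[of s y] that T by (simp add: W_eq[symmetric] l_def)
    then have "w (y, s) \<le> C * s powr (- \<kappa>) * l powr (- \<alpha>)"
      using C by (subst (asm) ennreal_le_iff) auto
    then have w2: "2 * w (y, s) \<le> 2 * C * s powr (- \<kappa>) * l powr (- \<alpha>)"
      by simp
    have "\<bar>Fp p a - Fp p b\<bar> \<le> p * (2 * C * s powr (- \<kappa>) * l powr (- \<alpha>)) powr (p - 1) * \<bar>a - b\<bar>"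
      using that w2 by (intro Fp_lipschitz p1) auto
    also have "(2 * C * s powr (- \<kappa>) * l powr (- \<alpha>)) powr (p - 1)
        = (2 * C) powr (1 / \<kappa>) * (s powr (- \<kappa>)) powr (1 / \<kappa>) * (l powr (- \<alpha>)) powr (1 / \<kappa>)"
      unfolding p1(2) using C by (simp add: powr_mult)
    also have "(s powr (- \<kappa>)) powr (1 / \<kappa>) = 1 / s"
      unfolding powr_powr using \<kappa>_pos that by (simp add: powr_minus divide_inverse)
    also have "(l powr (- \<alpha>)) powr (1 / \<kappa>) = l powr (- m)"
      unfolding powr_powr m_def by simp
    finally show ?thesis
      by (simp add: \<rho>_def A_def l_def mult_ac)
  qed
  define \<Phi> where "\<Phi> = (\<lambda>u z. if 0 < snd z \<and> snd z < T then S (fst z) (snd z) + (\<integral>w. K z w * Fp p (u w) \<partial>lborel) else 0)"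
  have diff_bound: "integrable lborel (\<lambda>q. K (x, t) q * (Fp p (u q) - Fp p (v q)))
     \<and> \<bar>\<integral>q. K (x, t) q * (Fp p (u q) - Fp p (v q)) \<partial>lborel\<bar> \<le> c * \<eta> t * w (x, t)"
    if [measurable]: "u \<in> borel_measurable borel" "v \<in> borel_measurable borel"
      and uv: "\<And>z. \<bar>u z\<bar> \<le> 2 * w z" "\<And>z. \<bar>v z\<bar> \<le> 2 * w z" "0 \<le> c" "\<And>z. \<bar>u z - v z\<bar> \<le> c * w z"
      and t: "0 < t" "t < T" for u v c x t
  proof -
    have *: "ennreal \<bar>Fp p (u (y, s)) - Fp p (v (y, s))\<bar> \<le> ennreal (c * \<rho> s) * W y s" if s: "0 < s" "s < t" for y s
    proof -
      have "\<bar>Fp p (u (y, s)) - Fp p (v (y, s))\<bar> \<le> \<rho> s * \<bar>u (y, s) - v (y, s)\<bar>"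
        using s t by (intro lip[where y=y] uv) auto
      also have "\<dots> \<le> \<rho> s * (c * w (y, s))"
        using s by (intro mult_left_mono uv \<rho>_nn)
      finally have "ennreal \<bar>Fp p (u (y, s)) - Fp p (v (y, s))\<bar> \<le> ennreal ((c * \<rho> s) * w (y, s))"
        by (intro ennreal_leI) (simp add: mult_ac)
      then show ?thesis
        using s t \<rho>_nn[of s] uv by (simp add: W_eq ennreal_mult' w_nn mult_ac ennreal_mult)
    qed
    have "(\<lambda>q. Fp p (u q) - Fp p (v q)) \<in> borel_measurable borel" "(\<lambda>s. c * \<rho> s) \<in> borel_measurable borel"
      by measurable
    note duhamel = duhamel_bound[OF this *  \<eta>_int[OF t uv(3)] mult_nonneg_nonneg[OF uv(3) \<eta>_nn] W_fin[OF t]]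
    show ?thesis
      using duhamel[of x] t by (simp add: w_def)
  qed
  have Fp0: "Fp p 0 = 0" by (simp add: Fp_def)
  \<comment> \<open>The comparison function is 0, for which the bound \<open>2 * w\<close> on
    \<open>u\<close> makes the difference constant equal to 2; hence the rate finally returned is
    \<open>2 * \<eta> t\<close>.\<close>
  have zero_bound: "integrable lborel (\<lambda>q. K (x, t) q * Fp p (u q))
     \<and> \<bar>\<integral>q. K (x, t) q * Fp p (u q) \<partial>lborel\<bar> \<le> 2 * \<eta> t * w (x, t)"
    if "u \<in> borel_measurable borel" "\<And>z. \<bar>u z\<bar> \<le> 2 * w z" "0 < t" "t < T" for u x t
    using diff_bound[of u "\<lambda>_. 0" 2 t x] that w_nn by (simp add: Fp0)
  obtain u where u: "u \<in> borel_measurable borel" "\<And>z. \<bar>u z\<bar> \<le> 2 * w z" "\<Phi> u = u"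
  proof (rule weighted_fixed_point[of borel \<Phi> w])
    show "\<Phi> u \<in> borel_measurable borel" if [measurable]: "u \<in> borel_measurable borel" for u
      unfolding \<Phi>_def by measurable
    show "\<bar>\<Phi> (\<lambda>_. 0) z\<bar> \<le> w z" for z
      using S_integrable_bound(2)[of "snd z" "fst z"] W_fin[of "snd z" "fst z"]
      by (auto simp: \<Phi>_def w_def Fp0)
    fix u v :: "(real^'n) \<times> real \<Rightarrow> real" and c z
    assume uv: "u \<in> borel_measurable borel" "v \<in> borel_measurable borel"
      "\<And>z. \<bar>u z\<bar> \<le> 2 * w z" "\<And>z. \<bar>v z\<bar> \<le> 2 * w z" "0 \<le> c" "\<And>z. \<bar>u z - v z\<bar> \<le> c * w z"
    show "\<bar>\<Phi> u z - \<Phi> v z\<bar> \<le> c / 2 * w z"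
    proof (cases "0 < snd z \<and> snd z < T")
      case True
      obtain x t where z: "z = (x, t)" by (cases z)
      have t: "0 < t" "t < T" using True z by auto
      have "\<Phi> u z - \<Phi> v z = (\<integral>q. K (x, t) q * Fp p (u q) \<partial>lborel) - (\<integral>q. K (x, t) q * Fp p (v q) \<partial>lborel)"
        using t by (simp add: \<Phi>_def z)
      also have "\<dots> = (\<integral>q. K (x, t) q * (Fp p (u q) - Fp p (v q)) \<partial>lborel)"
        using zero_bound[OF uv(1,3) t] zero_bound[OF uv(2,4) t]
        by (simp add: right_diff_distrib)
      also have "\<bar>\<dots>\<bar> \<le> c * \<eta> t * w (x, t)"
        using diff_bound[OF uv t] by blast
      also have "\<dots> \<le> c * (1 / 2) * w (x, t)"
        using uv(5) w_nn \<eta>_half[OF t] by (intro mult_right_mono mult_left_mono) auto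
      finally show ?thesis by (simp add: z)
    next
      case False
      then show ?thesis using uv(5) w_nn[of z] by (auto simp: \<Phi>_def)
    qed
  qed blast
  have u_eq: "u (x, t) = S x t + (\<integral>w. K (x, t) w * Fp p (u w) \<partial>lborel)" if "0 < t" "t < T" for x t
    using fun_cong[OF u(3), of "(x, t)"] that by (simp add: \<Phi>_def)
  show ?thesis
  proof (rule that[OF T(1,2) C u(1), of "\<lambda>t. 2 * \<eta> t"])
    show "((\<lambda>t. 2 * \<eta> t) \<longlongrightarrow> 0) (at_right 0)"
      using tendsto_mult_right_zero[OF \<eta>_lim, of 2] .
  next
    fix x :: "real^'n" and t :: real assume t: "0 < t" "t < T"
    show "0 \<le> 2 * \<eta> t" using \<eta>_nn by simp
    show "W x t \<le> ennreal (C * t powr (- \<kappa>) * ln (exp 1 + 1 / t) powr (- \<alpha>))"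
      using W_le' t T by simp
    show "integrable lborel (\<lambda>w. K (x, t) w * Fp p (u w))"
      using zero_bound[OF u(1,2) t] by blast
    show "u (x, t) = S x t + (\<integral>w. K (x, t) w * Fp p (u w) \<partial>lborel)"
      using u_eq[OF t] .
    show "\<bar>u (x, t)\<bar> \<le> 2 * enn2real (W x t)"
      using u(2)[of "(x, t)"] t by (simp add: w_def)
    have "\<bar>u (x, t) - S x t\<bar> = \<bar>\<integral>w. K (x, t) w * Fp p (u w) \<partial>lborel\<bar>"
      using u_eq[OF t, of x] by simp
    also have "\<dots> \<le> 2 * \<eta> t * w (x, t)"
      using zero_bound[OF u(1,2) t] by blast
    also have "w (x, t) = enn2real (W x t)"
      using t by (simp add: w_def)
    finally show "\<bar>u (x, t) - S x t\<bar> \<le> 2 * \<eta> t * enn2real (W x t)" .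
  qed
qed

end

section \<open>Convergence to the initial datum in the sense of distributions\<close>

context critical_data
begin

text \<open>A finite cover of \<open>Q\<close> by unit balls, shifted, covers every translate of
  \<open>Q\<close>, so the number of balls times \<open>C0\<close> serves for all \<open>y\<close>
  at once. This uniformity is what \<open>W_test\<close> asks for.\<close>

lemma compact_bound:
  assumes "compact Q"
  obtains N where "0 \<le> N" "\<And>y. (\<integral>\<^sup>+u. indicator Q (y + u) * ennreal \<bar>f u\<bar> \<partial>lborel) \<le> ennreal N"
proof -
  have cover: "Q \<subseteq> (\<Union>z\<in>UNIV. ball z 1)"
    using UN_I[of _ UNIV _ "\<lambda>z. ball z 1", OF UNIV_I centre_in_ball[THEN iffD2]] by auto
  obtain Z where Z: "finite Z" "Q \<subseteq> (\<Union>z\<in>Z. ball z 1)"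
    by (rule compactE_image[OF assms _ cover]) auto
  have [measurable]: "ball z 1 \<in> sets borel" for z :: "real^'n" by simp
  have "(\<integral>\<^sup>+u. indicator Q (y + u) * ennreal \<bar>f u\<bar> \<partial>lborel) \<le> ennreal (real (card Z) * C0)" for y
  proof -
    have "(\<integral>\<^sup>+u. indicator Q (y + u) * ennreal \<bar>f u\<bar> \<partial>lborel)
       \<le> (\<integral>\<^sup>+u. (\<Sum>z\<in>Z. ennreal \<bar>f u\<bar> * indicator (ball (z - y) 1) u) \<partial>lborel)"
    proof (intro nn_integral_mono)
      fix u
      show "indicator Q (y + u) * ennreal \<bar>f u\<bar> \<le> (\<Sum>z\<in>Z. ennreal \<bar>f u\<bar> * indicator (ball (z - y) 1) u)"
      proof (cases "y + u \<in> Q")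
        case True
        then obtain z where z: "z \<in> Z" "y + u \<in> ball z 1" using Z by auto
        then have "u \<in> ball (z - y) 1" by (simp add: dist_norm algebra_simps)
        then have "ennreal \<bar>f u\<bar> = ennreal \<bar>f u\<bar> * indicator (ball (z - y) 1) u" by simp
        also have "\<dots> \<le> (\<Sum>z\<in>Z. ennreal \<bar>f u\<bar> * indicator (ball (z - y) 1) u)"
          using z Z by (intro member_le_sum) auto
        finally show ?thesis using True by simp
      qed simp
    qed
    also have "\<dots> = (\<Sum>z\<in>Z. \<integral>\<^sup>+u\<in>ball (z - y) 1. ennreal \<bar>f u\<bar> \<partial>lborel)"
      by (rule nn_integral_sum) measurable
    also have "\<dots> \<le> (\<Sum>z\<in>Z. ennreal C0)"
      by (intro sum_mono f_ball_bound)
    also have "\<dots> = ennreal (real (card Z) * C0)"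
      by (simp add: ennreal_mult' ennreal_of_nat_eq_real_of_nat)
    finally show ?thesis .
  qed
  then show ?thesis
    using C0 by (intro that[of "real (card Z) * C0"]) auto
qed

lemma compact_sets_borel [measurable]: "compact Q \<Longrightarrow> Q \<in> sets (borel :: (real^'n) measure)"
  by (intro borel_closed compact_imp_closed)

lemma f_integrable_compact:
  assumes Q: "compact Q"
  shows "integrable lborel (\<lambda>y. indicator Q y * \<bar>f y\<bar>)"
proof -
  obtain N where N: "\<And>y. (\<integral>\<^sup>+u. indicator Q (y + u) * ennreal \<bar>f u\<bar> \<partial>lborel) \<le> ennreal N"
    using compact_bound[OF Q] by blast
  note compact_sets_borel[OF Q, measurable]
  have "(\<integral>\<^sup>+y. ennreal (norm (indicator Q y * \<bar>f y\<bar>)) \<partial>lborel) = (\<integral>\<^sup>+u. indicator Q (0 + u) * ennreal \<bar>f u\<bar> \<partial>lborel)"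
    by (intro nn_integral_cong) (auto simp: indicator_def)
  also have "\<dots> \<le> ennreal N" by (rule N)
  finally show ?thesis
    by (intro integrableI_bounded) (auto simp: less_top[symmetric] top_unique)
qed

text \<open>The kernel is moved from the rough datum onto the test function: with \<open>P\<close>
  the correlation of \<open>f\<close> and \<psi>, the pairing is the average of
  \<open>P (t powr (1 / \<theta>) *\<^sub>R v)\<close> with weights \<open>G v 1\<close>. As
  \<open>P\<close> is bounded and continuous at 0, dominated convergence gives
  \<open>P 0\<close>.\<close>

lemma S_tendsto_distribution:
  assumes \<psi>: "continuous_on UNIV \<psi>" and Q: "compact Q" and supp: "\<And>x. x \<notin> Q \<Longrightarrow> \<psi> x = 0"
  shows "((\<lambda>t. \<integral>x. S x t * \<psi> x \<partial>lborel) \<longlongrightarrow> (\<integral>x. f x * \<psi> x \<partial>lborel)) (at_right 0)"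
proof -
  note compact_sets_borel[OF Q, measurable]
  have [measurable]: "\<psi> \<in> borel_measurable borel"
    using \<psi> by (rule borel_measurable_continuous_onI)
  have "bounded (\<psi> ` Q)"
    by (intro compact_imp_bounded compact_continuous_image Q continuous_on_subset[OF \<psi>]) auto
  then obtain M where M: "\<And>x. x \<in> Q \<Longrightarrow> \<bar>\<psi> x\<bar> \<le> M"
    unfolding bounded_iff by (metis imageI real_norm_def)
  have \<psi>_le: "\<bar>\<psi> x\<bar> \<le> \<bar>M\<bar> * indicator Q x" for x
    using M[of x] supp[of x] by (cases "x \<in> Q") auto
  obtain N where N: "0 \<le> N" "\<And>y. (\<integral>\<^sup>+u. indicator Q (y + u) * ennreal \<bar>f u\<bar> \<partial>lborel) \<le> ennreal N"
    using compact_bound[OF Q] by blast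
  define B where "B = \<bar>M\<bar> * N"
  have f\<psi>_le: "(\<integral>\<^sup>+u. ennreal \<bar>f u * \<psi> (y + u)\<bar> \<partial>lborel) \<le> ennreal B" for y
  proof -
    have "(\<integral>\<^sup>+u. ennreal \<bar>f u * \<psi> (y + u)\<bar> \<partial>lborel) \<le> (\<integral>\<^sup>+u. ennreal \<bar>M\<bar> * (indicator Q (y + u) * ennreal \<bar>f u\<bar>) \<partial>lborel)"
    proof (intro nn_integral_mono)
      fix u
      have "ennreal \<bar>f u * \<psi> (y + u)\<bar> \<le> ennreal (\<bar>f u\<bar> * (\<bar>M\<bar> * indicator Q (y + u)))"
        unfolding abs_mult by (intro ennreal_leI mult_left_mono \<psi>_le) simp
      also have "\<dots> = ennreal \<bar>M\<bar> * (indicator Q (y + u) * ennreal \<bar>f u\<bar>)"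
        by (auto simp: indicator_def ennreal_mult' mult.commute)
      finally show "ennreal \<bar>f u * \<psi> (y + u)\<bar> \<le> ennreal \<bar>M\<bar> * (indicator Q (y + u) * ennreal \<bar>f u\<bar>)" .
    qed
    also have "\<dots> = ennreal \<bar>M\<bar> * (\<integral>\<^sup>+u. indicator Q (y + u) * ennreal \<bar>f u\<bar> \<partial>lborel)"
      by (rule nn_integral_cmult) measurable
    also have "\<dots> \<le> ennreal \<bar>M\<bar> * ennreal N"
      by (intro mult_left_mono N) simp
    also have "\<dots> = ennreal B" by (simp add: B_def ennreal_mult')
    finally show ?thesis .
  qed
  have f\<psi>_int: "integrable lborel (\<lambda>u. f u * \<psi> (y + u))" for y
    using f\<psi>_le[of y] by (intro integrableI_bounded) (auto simp: less_top[symmetric] top_unique)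
  define P where "P = (\<lambda>z. \<integral>u. f u * \<psi> (z + u) \<partial>lborel)"
  have [measurable]: "P \<in> borel_measurable borel" unfolding P_def by measurable
  have P_le: "\<bar>P z\<bar> \<le> B" for z
  proof -
    have "ennreal \<bar>P z\<bar> \<le> ennreal B"
      unfolding P_def
      using integral_norm_bound_ennreal[OF f\<psi>_int[of z], unfolded real_norm_def] f\<psi>_le[of z] by (rule order_trans)
    then show ?thesis using N(1) by (subst (asm) ennreal_le_iff) (auto simp: B_def)
  qed
  have P_lim: "(\<lambda>k. P (X k)) \<longlonglongrightarrow> P 0" if X: "X \<longlonglongrightarrow> 0" for X :: "nat \<Rightarrow> real^'n"
  proof -
    have "bounded (range X)" using X by (intro convergent_imp_bounded convergentI)
    then obtain R where R: "\<And>k. norm (X k) \<le> R"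
      unfolding bounded_iff by blast
    \<comment> \<open>The shifts \<open>X k\<close> stay in a ball of radius \<open>R\<close>, so
      all shifted supports lie in the compact set \<open>Q1\<close>, on which \<open>f\<close> is
      integrable; this provides the common majorant.\<close>
    define Q1 where "Q1 = {a - b | a b. a \<in> Q \<and> b \<in> cball 0 R}"
    have Q1: "compact Q1" unfolding Q1_def by (intro compact_differences Q compact_cball)
    show ?thesis
      unfolding P_def
    proof (rule integral_dominated_convergence)
      show "integrable lborel (\<lambda>u. \<bar>M\<bar> * (indicator Q1 u * \<bar>f u\<bar>))"
        by (intro integrable_mult_right f_integrable_compact Q1)
      show "AE u in lborel. norm (f u * \<psi> (X k + u)) \<le> \<bar>M\<bar> * (indicator Q1 u * \<bar>f u\<bar>)" for k
      proof (rule AE_I2)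
        fix u
        have "indicator Q (X k + u) \<le> (indicator Q1 u :: real)"
        proof (cases "X k + u \<in> Q")
          case True
          have "u = (X k + u) - X k" by simp
          then have "u \<in> Q1"
            unfolding Q1_def using True R[of k] by (intro CollectI exI[of _ "X k + u"] exI[of _ "X k"]) auto
          then show ?thesis by simp
        qed simp
        then have "\<bar>\<psi> (X k + u)\<bar> \<le> \<bar>M\<bar> * indicator Q1 u"
          by (intro order_trans[OF \<psi>_le] mult_left_mono) auto
        then have "\<bar>f u\<bar> * \<bar>\<psi> (X k + u)\<bar> \<le> \<bar>f u\<bar> * (\<bar>M\<bar> * indicator Q1 u)"
          by (intro mult_left_mono) auto
        then show "norm (f u * \<psi> (X k + u)) \<le> \<bar>M\<bar> * (indicator Q1 u * \<bar>f u\<bar>)"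
          by (simp add: abs_mult mult_ac)
      qed
      show "AE u in lborel. (\<lambda>k. f u * \<psi> (X k + u)) \<longlonglongrightarrow> f u * \<psi> (0 + u)"
      proof (rule AE_I2)
        fix u
        have "isCont \<psi> (0 + u)" using \<psi> by (simp add: continuous_on_eq_continuous_at)
        then have "(\<lambda>k. \<psi> (X k + u)) \<longlonglongrightarrow> \<psi> (0 + u)"
          by (rule isCont_tendsto_compose) (intro tendsto_intros X)
        then show "(\<lambda>k. f u * \<psi> (X k + u)) \<longlonglongrightarrow> f u * \<psi> (0 + u)"
          by (intro tendsto_mult tendsto_const)
      qed
    qed simp_all
  qed
  \<comment> \<open>In convolution form the shift sits in \<open>f (x - z)\<close>. Fubini is
    allowed because the inner bound \<open>B\<close> does not depend on \<open>z\<close> and the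
    kernel has mass 1; scaling then fixes the kernel at time 1.\<close>
  have S_eq: "(\<integral>x. S x t * \<psi> x \<partial>lborel) = (\<integral>v. G v 1 * P (t powr (1 / \<theta>) *\<^sub>R v) \<partial>lborel)" if t: "0 < t" for t
  proof -
    define F where "F = (\<lambda>x z. G z t * (f (x - z) * \<psi> x))"
    have [measurable]: "(\<lambda>(x, z). F x z) \<in> borel_measurable (lborel \<Otimes>\<^sub>M lborel)"
      unfolding F_def by measurable
    have inner_nn: "(\<integral>\<^sup>+x. ennreal \<bar>f (x - z) * \<psi> x\<bar> \<partial>lborel) \<le> ennreal B" for z
      using f\<psi>_le[of z] by (subst nn_integral_lborel_affine[of _ 1 z]) auto
    have "integrable (lborel \<Otimes>\<^sub>M lborel) (\<lambda>(x, z). F x z)"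
    proof (rule integrableI_bounded)
      have "(\<integral>\<^sup>+w. ennreal (norm (case w of (x, z) \<Rightarrow> F x z)) \<partial>(lborel \<Otimes>\<^sub>M lborel))
        = (\<integral>\<^sup>+z. (\<integral>\<^sup>+x. ennreal (norm (F x z)) \<partial>lborel) \<partial>lborel)"
        by (subst lborel_pair.nn_integral_snd[symmetric]) auto
      also have "\<dots> = (\<integral>\<^sup>+z. ennreal (G z t) * (\<integral>\<^sup>+x. ennreal \<bar>f (x - z) * \<psi> x\<bar> \<partial>lborel) \<partial>lborel)"
        using t by (subst nn_integral_cmult[symmetric])
          (auto intro!: nn_integral_cong simp: F_def abs_mult G_nonneg ennreal_mult')
      also have "\<dots> \<le> (\<integral>\<^sup>+z. ennreal (G z t) * ennreal B \<partial>lborel)"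
        by (intro nn_integral_mono mult_left_mono inner_nn) simp
      also have "\<dots> = ennreal B"
        using t by (simp add: nn_integral_multc nn_integral_G)
      finally show "(\<integral>\<^sup>+w. ennreal (norm (case w of (x, z) \<Rightarrow> F x z)) \<partial>(lborel \<Otimes>\<^sub>M lborel)) < \<infinity>"
        by (auto simp: less_top[symmetric] top_unique)
    qed measurable
    then have Fub: "(\<integral>z. (\<integral>x. F x z \<partial>lborel) \<partial>lborel) = (\<integral>x. (\<integral>z. F x z \<partial>lborel) \<partial>lborel)"
      by (rule lborel_pair.Fubini_integral)
    have "S x t = (\<integral>z. G z t * f (x - z) \<partial>lborel)" for x
      unfolding S_def by (subst lborel_integral_affine[of _ "-1" x]) auto
    then have "S x t * \<psi> x = (\<integral>z. F x z \<partial>lborel)" for x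
      unfolding F_def by (simp flip: mult.assoc)
    then have "(\<integral>x. S x t * \<psi> x \<partial>lborel) = (\<integral>z. (\<integral>x. F x z \<partial>lborel) \<partial>lborel)"
      using Fub by simp
    also have "(\<integral>x. F x z \<partial>lborel) = G z t * P z" for z
      unfolding F_def P_def using lborel_integral_affine[of "\<lambda>x. f (x - z) * \<psi> x" 1 z] by simp
    then have "(\<integral>z. (\<integral>x. F x z \<partial>lborel) \<partial>lborel) = (\<integral>z. G z t * P z \<partial>lborel)"
      by simp
    also have "\<dots> = (\<integral>v. G v 1 * P (t powr (1 / \<theta>) *\<^sub>R v) \<partial>lborel)"
    proof -
      define r where "r = t powr (1 / \<theta>)"
      have r: "r > 0" "r ^ CARD('n) = t powr \<kappa>"
        using t by (auto simp: r_def \<kappa>_eq powr_powr simp flip: powr_realpow)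
      have "G (r *\<^sub>R v) t = t powr (- \<kappa>) * G v 1" for v
        using fund_sol_scaling[OF t \<theta>(1), of "r *\<^sub>R v"] t
        by (simp add: r_def \<kappa>_eq flip: powr_add)
      then have "(\<integral>z. G z t * P z \<partial>lborel) = t powr \<kappa> * (\<integral>v. t powr (- \<kappa>) * (G v 1 * P (r *\<^sub>R v)) \<partial>lborel)"
        using r lborel_integral_affine[of "\<lambda>z. G z t * P z" r 0] by (simp add: mult.assoc)
      then show ?thesis
        using t by (simp add: r_def powr_minus)
    qed
    finally show ?thesis .
  qed
  have "((\<lambda>t. \<integral>v. G v 1 * P (t powr (1 / \<theta>) *\<^sub>R v) \<partial>lborel) \<longlongrightarrow> P 0) (at_right 0)"
    unfolding tendsto_at_iff_sequentially o_def
  proof (intro allI impI)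
    fix X :: "nat \<Rightarrow> real" assume X: "\<forall>i. X i \<in> {0<..} - {0}" "X \<longlonglongrightarrow> 0"
    have "(\<lambda>k. \<integral>v. G v 1 * P (X k powr (1 / \<theta>) *\<^sub>R v) \<partial>lborel) \<longlonglongrightarrow> (\<integral>v. G v 1 * P 0 \<partial>lborel)"
    proof (rule integral_dominated_convergence)
      show "integrable lborel (\<lambda>v. G v 1 * B)"
        using \<theta> by (intro integrable_mult_left fund_sol_integrable) auto
      show "AE v in lborel. norm (G v 1 * P (X k powr (1 / \<theta>) *\<^sub>R v)) \<le> G v 1 * B" for k
        using G_nonneg[of 1] P_le by (intro AE_I2) (simp add: abs_mult mult_left_mono)
      have "(\<lambda>k. X k powr (1 / \<theta>)) \<longlonglongrightarrow> 0 powr (1 / \<theta>)"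
        using X \<theta> by (intro tendsto_powr2) (auto simp: less_imp_le)
      then have "(\<lambda>k. X k powr (1 / \<theta>) *\<^sub>R v) \<longlonglongrightarrow> 0" for v :: "real^'n"
        using tendsto_scaleR[OF _ tendsto_const, of "\<lambda>k. X k powr (1 / \<theta>)" 0 sequentially v] by simp
      then show "AE v in lborel. (\<lambda>k. G v 1 * P (X k powr (1 / \<theta>) *\<^sub>R v)) \<longlonglongrightarrow> G v 1 * P 0"
        by (intro AE_I2 tendsto_mult tendsto_const P_lim)
    qed simp_all
    then show "(\<lambda>k. \<integral>v. G v 1 * P (X k powr (1 / \<theta>) *\<^sub>R v) \<partial>lborel) \<longlonglongrightarrow> P 0"
      using \<theta> by (simp add: fund_sol_integral)
  qed
  moreover have "\<forall>\<^sub>F t in at_right 0. (\<integral>v. G v 1 * P (t powr (1 / \<theta>) *\<^sub>R v) \<partial>lborel) = (\<integral>x. S x t * \<psi> x \<partial>lborel)"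
    unfolding eventually_at_right_field using S_eq by (intro exI[of _ 1]) auto
  ultimately have "((\<lambda>t. \<integral>x. S x t * \<psi> x \<partial>lborel) \<longlongrightarrow> P 0) (at_right 0)"
    by (rule Lim_transform_eventually)
  then show ?thesis by (simp add: P_def)
qed

text \<open>The difference to the linear evolution is at most \<open>\<eta> t\<close> times the
  weight, whose integral over \<open>Q\<close> is bounded by \<open>N\<close> at all times through
  \<open>W_test\<close>; so the perturbation contributes at most a fixed multiple of
  \<open>\<eta> t\<close>.\<close>

lemma perturbation_tendsto_distribution:
  assumes \<psi>: "continuous_on UNIV \<psi>" and Q: "compact Q" and supp: "\<And>x. x \<notin> Q \<Longrightarrow> \<psi> x = 0"
    and [measurable]: "u \<in> borel_measurable borel"
    and \<eta>: "(\<eta> \<longlongrightarrow> 0) (at_right 0)" and T: "0 < T"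
    and W_fin: "\<And>x t. 0 < t \<Longrightarrow> t < T \<Longrightarrow> W x t < \<top>"
    and u: "\<And>x t. 0 < t \<Longrightarrow> t < T \<Longrightarrow> \<bar>u (x, t) - S x t\<bar> \<le> \<eta> t * enn2real (W x t)"
    and \<eta>_nn: "\<And>t. 0 < t \<Longrightarrow> t < T \<Longrightarrow> 0 \<le> \<eta> t"
  shows "((\<lambda>t. \<integral>x. u (x, t) * \<psi> x \<partial>lborel) \<longlongrightarrow> (\<integral>x. f x * \<psi> x \<partial>lborel)) (at_right 0)"
proof -
  note compact_sets_borel[OF Q, measurable]
  have [measurable]: "\<psi> \<in> borel_measurable borel"
    using \<psi> by (rule borel_measurable_continuous_onI)
  have "bounded (\<psi> ` Q)"
    by (intro compact_imp_bounded compact_continuous_image Q continuous_on_subset[OF \<psi>]) auto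
  then obtain M where M: "\<And>x. x \<in> Q \<Longrightarrow> \<bar>\<psi> x\<bar> \<le> M"
    unfolding bounded_iff by (metis imageI real_norm_def)
  have \<psi>_le: "\<bar>\<psi> x\<bar> \<le> \<bar>M\<bar> * indicator Q x" for x
    using M[of x] supp[of x] by (cases "x \<in> Q") auto
  obtain N where N: "0 \<le> N" "\<And>y. (\<integral>\<^sup>+u. indicator Q (y + u) * ennreal \<bar>f u\<bar> \<partial>lborel) \<le> ennreal N"
    using compact_bound[OF Q] by blast
  have bound: "(\<integral>\<^sup>+x. ennreal \<bar>g x * \<psi> x\<bar> \<partial>lborel) \<le> ennreal (c * (\<bar>M\<bar> * N))"
    if t: "0 < t" "t < T" and "0 \<le> c" and g: "\<And>x. \<bar>g x\<bar> \<le> c * enn2real (W x t)" for g c t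
  proof -
    have "(\<integral>\<^sup>+x. ennreal \<bar>g x * \<psi> x\<bar> \<partial>lborel) \<le> (\<integral>\<^sup>+x. ennreal (c * \<bar>M\<bar>) * (indicator Q x * W x t) \<partial>lborel)"
    proof (intro nn_integral_mono)
      fix x
      have "\<bar>g x * \<psi> x\<bar> \<le> (c * enn2real (W x t)) * (\<bar>M\<bar> * indicator Q x)"
        unfolding abs_mult using \<open>0 \<le> c\<close> by (intro mult_mono g \<psi>_le) auto
      then have "ennreal \<bar>g x * \<psi> x\<bar> \<le> ennreal ((c * \<bar>M\<bar>) * (indicator Q x * enn2real (W x t)))"
        by (intro ennreal_leI) (simp add: mult_ac)
      also have "\<dots> = ennreal (c * \<bar>M\<bar>) * (indicator Q x * W x t)"
        using \<open>0 \<le> c\<close> W_fin[OF t, of x] by (simp add: ennreal_mult ennreal_indicator)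
      finally show "ennreal \<bar>g x * \<psi> x\<bar> \<le> ennreal (c * \<bar>M\<bar>) * (indicator Q x * W x t)" .
    qed
    also have "\<dots> = ennreal (c * \<bar>M\<bar>) * (\<integral>\<^sup>+x. indicator Q x * W x t \<partial>lborel)"
      by (rule nn_integral_cmult) measurable
    also have "\<dots> \<le> ennreal (c * \<bar>M\<bar>) * ennreal N"
      using t N by (intro mult_left_mono W_test) auto
    also have "\<dots> = ennreal (c * (\<bar>M\<bar> * N))"
      using \<open>0 \<le> c\<close> N by (simp add: ennreal_mult[symmetric] mult.assoc)
    finally show ?thesis .
  qed
  have int: "integrable lborel (\<lambda>x. g x * \<psi> x)" and int_le: "\<bar>\<integral>x. g x * \<psi> x \<partial>lborel\<bar> \<le> c * (\<bar>M\<bar> * N)"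
    if [measurable]: "g \<in> borel_measurable borel" and "0 < t" "t < T" "0 \<le> c" "\<And>x. \<bar>g x\<bar> \<le> c * enn2real (W x t)" for g c t
  proof -
    show i: "integrable lborel (\<lambda>x. g x * \<psi> x)"
      using bound[OF that(2-5)] by (intro integrableI_bounded) (auto simp: less_top[symmetric] top_unique)
    have "ennreal \<bar>\<integral>x. g x * \<psi> x \<partial>lborel\<bar> \<le> ennreal (c * (\<bar>M\<bar> * N))"
      using integral_norm_bound_ennreal[OF i, unfolded real_norm_def] bound[OF that(2-5)] by (rule order_trans)
    then show "\<bar>\<integral>x. g x * \<psi> x \<partial>lborel\<bar> \<le> c * (\<bar>M\<bar> * N)"
      using that N by (subst (asm) ennreal_le_iff) auto
  qed
  have ev: "\<forall>\<^sub>F t in at_right 0. 0 < t \<and> t < T"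
    using T by (auto simp: eventually_at_right_field)
  have "((\<lambda>t. \<integral>x. (u (x, t) - S x t) * \<psi> x \<partial>lborel) \<longlongrightarrow> 0) (at_right 0)"
  proof (rule Lim_null_comparison)
    show "\<forall>\<^sub>F t in at_right 0. norm (\<integral>x. (u (x, t) - S x t) * \<psi> x \<partial>lborel) \<le> \<eta> t * (\<bar>M\<bar> * N)"
      using ev
    proof eventually_elim
      case (elim t)
      then show ?case
        using int_le[of "\<lambda>x. u (x, t) - S x t" t "\<eta> t"] u \<eta>_nn by simp
    qed
    show "((\<lambda>t. \<eta> t * (\<bar>M\<bar> * N)) \<longlongrightarrow> 0) (at_right 0)"
      using \<eta> by (rule tendsto_mult_left_zero)
  qed
  from tendsto_add[OF this S_tendsto_distribution[OF \<psi> Q supp]]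
  have "((\<lambda>t. (\<integral>x. (u (x, t) - S x t) * \<psi> x \<partial>lborel) + (\<integral>x. S x t * \<psi> x \<partial>lborel)) \<longlongrightarrow> (\<integral>x. f x * \<psi> x \<partial>lborel)) (at_right 0)"
    by simp
  moreover have "\<forall>\<^sub>F t in at_right 0. (\<integral>x. (u (x, t) - S x t) * \<psi> x \<partial>lborel) + (\<integral>x. S x t * \<psi> x \<partial>lborel) = (\<integral>x. u (x, t) * \<psi> x \<partial>lborel)"
    using ev
  proof eventually_elim
    case (elim t)
    have "integrable lborel (\<lambda>x. (u (x, t) - S x t) * \<psi> x)"
      using elim u \<eta>_nn by (intro int[where c = "\<eta> t" and t = t]) auto
    moreover have "integrable lborel (\<lambda>x. S x t * \<psi> x)"
      using elim S_integrable_bound(2)[of t] W_fin by (intro int[where c = 1 and t = t]) auto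
    ultimately show ?case
      by (subst Bochner_Integration.integral_add[symmetric]) (auto simp: algebra_simps)
  qed
  ultimately show ?thesis
    by (rule Lim_transform_eventually)
qed

end

section \<open>Uniformly local norms and conclusion\<close>

lemma enn_root_1: "enn_root 1 X = X"
  by (cases X) (auto simp: enn_root_def)

text \<open>For \<open>q = 1\<close> the root disappears and the logarithmic factor can be pulled
  into the inner supremum, so that norm bounds become bounds for one centre, one size and one set.
  The integrals are moved to \<open>lborel\<close> although \<open>E\<close> ranges over Lebesgue
  sets.\<close>

lemma ul_norm_1:
  fixes g :: "'a::euclidean_space \<Rightarrow> real"
  shows "ul_norm 1 \<beta> \<rho> g = (SUP z. SUP s\<in>{0<..}. SUP E\<in>{E \<in> sets lebesgue. emeasure lebesgue E = ennreal s}.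
     ennreal (ln (exp 1 + 1 / s) powr \<beta>) * (\<integral>\<^sup>+x\<in>E. ennreal \<bar>g x * indicator (ball z \<rho>) x\<bar> \<partial>lborel))"
  unfolding ul_norm_def logweak_norm_def enn_root_1 SUP_mult_left_ennreal nn_integral_completion
  by (simp only: powr_one abs_ge_zero)

lemma ul_norm_1_bound:
  fixes g :: "'a::euclidean_space \<Rightarrow> real"
  assumes "E \<in> sets lebesgue" "emeasure lebesgue E = ennreal s" "0 < s"
  shows "ennreal (ln (exp 1 + 1 / s) powr \<beta>) * (\<integral>\<^sup>+x\<in>E. ennreal \<bar>g x * indicator (ball z \<rho>) x\<bar> \<partial>lborel) \<le> ul_norm 1 \<beta> \<rho> g"
  unfolding ul_norm_1 using assms
  by (intro SUP_upper2[where i = z] SUP_upper2[where i = s] SUP_upper2[where i = E]) auto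

text \<open>The norm ranges over Lebesgue sets, the bounds on \<open>W\<close> over Borel sets. The
  main part of \<open>E\<close> is Borel and differs from \<open>E\<close> by a subset of a null
  set, so neither the measure nor the integrals notice the change.\<close>

lemma nn_integral_lebesgue_set:
  fixes E :: "'a::euclidean_space set"
  assumes "E \<in> sets lebesgue"
  obtains E' where "E' \<in> sets borel" "emeasure lborel E' = emeasure lebesgue E"
    "\<And>h. (\<integral>\<^sup>+x\<in>E. h x \<partial>lborel) = (\<integral>\<^sup>+x\<in>E'. h x \<partial>lborel)"
proof -
  obtain N where N: "N \<in> null_sets lborel" "null_part lborel E \<subseteq> N"
    using null_part[OF assms] by blast
  have E: "x \<in> E \<longleftrightarrow> x \<in> main_part lborel E \<or> x \<in> null_part lborel E" for x
    using main_part_null_part_Un[OF assms] by blast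
  have "AE x in lborel. x \<notin> N"
    using N(1) by (rule AE_not_in)
  then have ae: "AE x in lborel. h x * indicator E x = h x * indicator (main_part lborel E) x" for h :: "'a \<Rightarrow> ennreal"
    by eventually_elim (use N(2) in \<open>auto simp: indicator_def E\<close>)
  show ?thesis
  proof (rule that[of "main_part lborel E"])
    show "main_part lborel E \<in> sets borel"
      using main_part_sets[OF assms] by simp
    show "emeasure lborel (main_part lborel E) = emeasure lebesgue E"
      using assms by simp
    show "(\<integral>\<^sup>+x\<in>E. h x \<partial>lborel) = (\<integral>\<^sup>+x\<in>main_part lborel E. h x \<partial>lborel)" for h
      by (intro nn_integral_cong_AE ae)
  qed
qed

text \<open>Turns pointwise domination by the weight into a norm bound. As \<open>l\<close> is at
  least 1, the logarithms contribute \<open>l powr (\<beta> - \<alpha>) \<le> 1\<close>, and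
  \<open>\<rho> \<le> 1\<close> places the small ball inside the unit ball. A fixed \<open>c\<close>
  gives boundedness, a vanishing one convergence.\<close>

lemma (in critical_data) ul_norm_le_of_W:
  assumes t: "0 < t" and W: "\<And>x. W x t < \<top>" and c: "0 \<le> c"
    and g: "\<And>x. \<bar>g x\<bar> \<le> c * enn2real (W x t)" and "\<beta> \<le> \<alpha>" "\<rho> \<le> 1"
  shows "ul_norm 1 \<beta> \<rho> g \<le> ennreal (c * C0)"
  unfolding ul_norm_1
proof (intro SUP_least)
  fix z :: "real^'n" and s :: real and E :: "(real^'n) set"
  assume "s \<in> {0<..}" and E: "E \<in> {E \<in> sets lebesgue. emeasure lebesgue E = ennreal s}"
  then have s: "0 < s" by simp
  obtain E' where E': "E' \<in> sets borel" "emeasure lborel E' = emeasure lebesgue E"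
    "\<And>h. (\<integral>\<^sup>+x\<in>E. h x \<partial>lborel) = (\<integral>\<^sup>+x\<in>E'. h x \<partial>lborel)"
    using nn_integral_lebesgue_set[of E] E by blast
  note E'(1)[measurable]
  have [measurable]: "ball z 1 \<in> sets borel" by simp
  define l where "l = ln (exp 1 + 1 / s)"
  have l: "1 \<le> l" unfolding l_def using s by (rule ln_ge_1)
  have "(\<integral>\<^sup>+x\<in>E'. ennreal \<bar>g x * indicator (ball z \<rho>) x\<bar> \<partial>lborel)
    \<le> (\<integral>\<^sup>+x. ennreal c * (W x t * indicator (E' \<inter> ball z 1) x) \<partial>lborel)"
  proof (intro nn_integral_mono)
    fix x
    have "ennreal \<bar>g x\<bar> \<le> ennreal (c * enn2real (W x t))"
      by (intro ennreal_leI g)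
    also have "\<dots> = ennreal c * W x t"
      using c W[of x] by (simp add: ennreal_mult)
    finally show "ennreal \<bar>g x * indicator (ball z \<rho>) x\<bar> * indicator E' x \<le> ennreal c * (W x t * indicator (E' \<inter> ball z 1) x)"
      using \<open>\<rho> \<le> 1\<close> by (auto simp: indicator_def)
  qed
  also have "\<dots> = ennreal c * (\<integral>\<^sup>+x\<in>E' \<inter> ball z 1. W x t \<partial>lborel)"
    by (rule nn_integral_cmult) measurable
  also have "\<dots> \<le> ennreal c * ennreal (C0 * l powr (- \<alpha>))"
    unfolding l_def using E' E s t by (intro mult_left_mono W_bound) auto
  finally have "ennreal (l powr \<beta>) * (\<integral>\<^sup>+x\<in>E. ennreal \<bar>g x * indicator (ball z \<rho>) x\<bar> \<partial>lborel)
     \<le> ennreal (l powr \<beta>) * (ennreal c * ennreal (C0 * l powr (- \<alpha>)))"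
    unfolding E'(3) by (intro mult_left_mono) auto
  also have "\<dots> = ennreal (l powr \<beta> * (c * (C0 * l powr (- \<alpha>))))"
    using c C0 by (simp add: ennreal_mult)
  also have "l powr \<beta> * (c * (C0 * l powr (- \<alpha>))) = c * C0 * l powr (\<beta> - \<alpha>)"
    by (simp add: powr_diff powr_minus divide_inverse)
  also have "ennreal (c * C0 * l powr (\<beta> - \<alpha>)) \<le> ennreal (c * C0)"
  proof (intro ennreal_leI mult_left_le)
    have "l powr (\<beta> - \<alpha>) \<le> l powr 0"
      using l \<open>\<beta> \<le> \<alpha>\<close> by (intro powr_mono) auto
    then show "l powr (\<beta> - \<alpha>) \<le> 1" using l by simp
  qed (use c C0 in simp)
  finally show "ennreal (ln (exp 1 + 1 / s) powr \<beta>) * (\<integral>\<^sup>+x\<in>E. ennreal \<bar>g x * indicator (ball z \<rho>) x\<bar> \<partial>lborel) \<le> ennreal (c * C0)"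
    unfolding l_def .
qed

section \<open>Return from Borel representatives to Lebesgue measurable functions\<close>

lemma smooth_fun_continuous:
  assumes "\<psi> \<in> smooth_fun"
  shows "continuous_on UNIV \<psi>"
  using assms
proof cases
  case 1
  show ?thesis
    using 1(1) by (intro differentiable_imp_continuous_on) (simp add: differentiable_on_def)
qed

lemma borel_integral_lebesgue:
  fixes h :: "'a::euclidean_space \<Rightarrow> real"
  assumes "h \<in> borel_measurable borel"
  shows "integrable lebesgue h \<longleftrightarrow> integrable lborel h" "integral\<^sup>L lebesgue h = integral\<^sup>L lborel h"
  by (rule integrable_completion integral_completion, simp add: assms)+

lemma borel_measurable_lebesgue:
  "h \<in> borel_measurable borel \<Longrightarrow> h \<in> borel_measurable (lebesgue :: 'a::euclidean_space measure)"
  by (rule measurable_completion) simp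

theorem theorem1p2:
  fixes \<theta> p \<alpha> :: real and \<phi> :: "real^'n \<Rightarrow> real"
  assumes "0 < \<theta>" "\<theta> \<le> 2"
    and "p = 1 + \<theta> / real CARD('n)"
    and "\<alpha> > real CARD('n) / \<theta>"
    and "\<phi> \<in> ul_space 1 \<alpha>"
  shows "\<exists>T>0. \<exists>u. is_solution \<theta> p \<phi> T u \<and>
    (SUP t \<in> {0<..<T}. ul_norm 1 (real CARD('n) / \<theta>) (T powr (1 / \<theta>)) (\<lambda>x. u x t))
    + (SUP t \<in> {0<..<T}. ennreal (t powr (real CARD('n) / \<theta>)
                                  * ln (exp 1 + 1 / t) powr (real CARD('n) / \<theta>))
                        * esssup lebesgue (\<lambda>x. ennreal \<bar>u x t\<bar>)) < \<top> \<and>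
    (\<forall>\<gamma>. 0 \<le> \<gamma> \<and> \<gamma> < real CARD('n) / \<theta> \<longrightarrow>
       ((\<lambda>t. ul_norm 1 \<gamma> 1 (\<lambda>x. u x t - semigroup \<theta> t \<phi> x)) \<longlongrightarrow> 0) (at_right 0)) \<and>
    (\<forall>\<psi>. test_fun \<psi> \<longrightarrow>
       ((\<lambda>t. \<integral>x. u x t * \<psi> x \<partial>lebesgue) \<longlongrightarrow> (\<integral>x. \<phi> x * \<psi> x \<partial>lebesgue)) (at_right 0))"
proof -
  define k where "k = real CARD('n) / \<theta>"
  have k: "k > 0" "k < \<alpha>" using assms by (auto simp: k_def)
  have \<phi>_meas: "\<phi> \<in> borel_measurable lebesgue" and \<phi>_norm: "ul_norm 1 \<alpha> 1 \<phi> < \<top>"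
    using assms(5) by (auto simp: ul_space_def locally_integrable_def)
  obtain f where f [measurable]: "f \<in> borel_measurable borel" and ae: "AE x in lborel. \<phi> x = f x"
    using completion_ex_borel_measurable_real[OF \<phi>_meas] by auto
  define C0 where "C0 = enn2real (ul_norm 1 \<alpha> 1 \<phi>)"
  \<comment> \<open>The norm controls \<open>l powr \<alpha>\<close> times the mass on
    \<open>E\<close>; multiplying by the inverse weight gives the hypothesis on \<open>f\<close>,
    with the finite norm of the datum as \<open>C0\<close>.\<close>
  interpret critical_data \<theta> k \<alpha> C0 f
  proof
    fix E :: "(real^'n) set" and z s
    assume E: "E \<in> sets borel" "0 < s" "emeasure lborel E = ennreal s"
    define l where "l = ln (exp 1 + 1 / s)"
    have "exp 1 + 1 / s > 1"
      using E(2) by (intro less_trans[OF _ less_add_same_cancel1[THEN iffD2]]) auto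
    then have l: "l > 0"
      unfolding l_def by simp
    have "(\<integral>\<^sup>+x\<in>E \<inter> ball z 1. ennreal \<bar>f x\<bar> \<partial>lborel) = (\<integral>\<^sup>+x\<in>E. ennreal \<bar>\<phi> x * indicator (ball z 1) x\<bar> \<partial>lborel)"
    proof (rule nn_integral_cong_AE)
      show "AE x in lborel. ennreal \<bar>f x\<bar> * indicator (E \<inter> ball z 1) x
          = ennreal \<bar>\<phi> x * indicator (ball z 1) x\<bar> * indicator E x"
        using ae by eventually_elim (simp add: indicator_def)
    qed
    also have "\<dots> = ennreal (l powr (- \<alpha>)) * (ennreal (l powr \<alpha>) * (\<integral>\<^sup>+x\<in>E. ennreal \<bar>\<phi> x * indicator (ball z 1) x\<bar> \<partial>lborel))"
      using l by (simp add: mult.assoc[symmetric] ennreal_mult[symmetric] powr_minus)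
    also have "\<dots> \<le> ennreal (l powr (- \<alpha>)) * ul_norm 1 \<alpha> 1 \<phi>"
      unfolding l_def using E by (intro mult_left_mono ul_norm_1_bound) auto
    also have "\<dots> = ennreal (C0 * l powr (- \<alpha>))"
      using \<phi>_norm by (simp add: C0_def ennreal_mult mult.commute)
    finally show "(\<integral>\<^sup>+x\<in>E \<inter> ball z 1. ennreal \<bar>f x\<bar> \<partial>lborel) \<le> ennreal (C0 * ln (exp 1 + 1 / s) powr (- \<alpha>))"
      unfolding l_def .
  qed (use assms k f in \<open>auto simp: k_def C0_def\<close>)
  have "p = 1 + 1 / k"
    using assms by (simp add: k_def)
  then obtain T C u \<eta> where T: "0 < T" "T < 1" and C: "0 \<le> C" and u [measurable]: "u \<in> borel_measurable borel"
    and \<eta>: "(\<eta> \<longlongrightarrow> 0) (at_right 0)" and \<eta>_nn: "\<And>t. 0 < t \<Longrightarrow> t < T \<Longrightarrow> 0 \<le> \<eta> t"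
    and W_le: "\<And>x t. 0 < t \<Longrightarrow> t < T \<Longrightarrow> W x t \<le> ennreal (C * t powr (- k) * ln (exp 1 + 1 / t) powr (- \<alpha>))"
    and u_int: "\<And>x t. 0 < t \<Longrightarrow> t < T \<Longrightarrow> integrable lborel (\<lambda>w. K (x, t) w * Fp p (u w))"
    and u_eq: "\<And>x t. 0 < t \<Longrightarrow> t < T \<Longrightarrow> u (x, t) = S x t + (\<integral>w. K (x, t) w * Fp p (u w) \<partial>lborel)"
    and u_le: "\<And>x t. 0 < t \<Longrightarrow> t < T \<Longrightarrow> \<bar>u (x, t)\<bar> \<le> 2 * enn2real (W x t)"
    and u_S: "\<And>x t. 0 < t \<Longrightarrow> t < T \<Longrightarrow> \<bar>u (x, t) - S x t\<bar> \<le> \<eta> t * enn2real (W x t)"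
    by (rule mild_solution_exists) blast
  have W_fin: "W x t < \<top>" if "0 < t" "t < T" for x t
    using W_le[OF that, of x] by (auto intro: le_less_trans)
  have ae': "AE y in lebesgue. G (x - y) t * \<phi> y = G (x - y) t * f y" for x t
    using AE_completion[OF ae] by eventually_elim simp
  have G_leb: "(\<lambda>y. G (x - y) t) \<in> borel_measurable lebesgue" for x t
    by (rule borel_measurable_lebesgue) measurable
  have f_leb: "f \<in> borel_measurable lebesgue"
    using f by (rule borel_measurable_lebesgue)
  have Gf: "(\<lambda>y. G (x - y) t * f y) \<in> borel_measurable borel" for x t
    by measurable
  \<comment> \<open>Changing the datum on a null set alters no value of the integral, so the
    identity holds at every point and not just almost everywhere.\<close>
  have semigroup_eq: "semigroup \<theta> t \<phi> x = S x t" for x t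
    unfolding semigroup_def S_def borel_integral_lebesgue(2)[OF Gf, symmetric]
    by (intro integral_cong_AE borel_measurable_times G_leb \<phi>_meas f_leb ae')
  have semigroup_int: "integrable lebesgue (\<lambda>y. G (x - y) t * \<phi> y)" if "0 < t" "t < T" for x t
  proof -
    have "integrable lebesgue (\<lambda>y. G (x - y) t * f y)"
      using S_integrable_bound(1)[of t x] that W_fin by (simp add: borel_integral_lebesgue)
    then show ?thesis
      by (subst integrable_cong_AE[OF _ _ ae'])
         (intro borel_measurable_times G_leb \<phi>_meas f_leb)+
  qed
  define v where "v = (\<lambda>x t. u (x, t))"
  \<comment> \<open>The mild equation holds at every point of the strip; it remains to recognise the
    strip integrand as the one with \<open>K\<close> and to pass from \<open>lborel\<close> to its
    completion.\<close>
  have sol: "is_solution \<theta> p \<phi> T v"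
    unfolding is_solution_def
  proof (intro conjI AE_I2 impI)
    show "(\<lambda>z. v (fst z) (snd z)) \<in> borel_measurable lebesgue"
      unfolding v_def using borel_measurable_lebesgue[OF u] by simp
    fix z :: "(real^'n) \<times> real" assume "snd z \<in> {0<..<T}"
    then obtain x t where z: "z = (x, t)" and t: "0 < t" "t < T" by (cases z) auto
    have eq: "indicator (UNIV \<times> {0<..<t}) w *\<^sub>R (G (x - fst w) (t - snd w) * Fp p (v (fst w) (snd w))) = K (x, t) w * Fp p (u w)" for w
      by (cases w) (auto simp: K_def v_def indicator_def)
    have m: "(\<lambda>w. K (x, t) w * Fp p (u w)) \<in> borel_measurable borel"
      by measurable
    show "let x = fst z; t = snd z in
           integrable lebesgue (\<lambda>y. fund_sol \<theta> (x - y) t * \<phi> y) \<and>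
           set_integrable lebesgue (UNIV \<times> {0<..<t})
              (\<lambda>w. fund_sol \<theta> (x - fst w) (t - snd w) * Fp p (v (fst w) (snd w))) \<and>
           v x t = semigroup \<theta> t \<phi> x +
              (LINT w : UNIV \<times> {0<..<t} | lebesgue.
                 fund_sol \<theta> (x - fst w) (t - snd w) * Fp p (v (fst w) (snd w)))"
      unfolding z Let_def fst_conv snd_conv set_integrable_def set_lebesgue_integral_def eq
        borel_integral_lebesgue[OF m] semigroup_eq
      using semigroup_int[OF t] u_int[OF t] u_eq[OF t] by (simp add: v_def)
  qed
  \<comment> \<open>The radius \<open>T powr (1 / \<theta>)\<close> is at most 1 because
    \<open>T < 1\<close>, and 2 is the factor in \<open>u_le\<close>.\<close>
  have "(SUP t \<in> {0<..<T}. ul_norm 1 k (T powr (1 / \<theta>)) (\<lambda>x. v x t)) \<le> ennreal (2 * C0)"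
  proof (intro SUP_least)
    fix t assume "t \<in> {0<..<T}"
    then show "ul_norm 1 k (T powr (1 / \<theta>)) (\<lambda>x. v x t) \<le> ennreal (2 * C0)"
      unfolding v_def using W_fin u_le k T assms(1)
      by (intro ul_norm_le_of_W[where t = t]) (auto intro!: powr_le1)
  qed
  moreover have "(SUP t \<in> {0<..<T}. ennreal (t powr k * ln (exp 1 + 1 / t) powr k)
                        * esssup lebesgue (\<lambda>x. ennreal \<bar>v x t\<bar>)) \<le> ennreal (2 * C)"
  proof (intro SUP_least)
    fix t assume "t \<in> {0<..<T}"
    then have t: "0 < t" "t < T" by auto
    define l where "l = ln (exp 1 + 1 / t)"
    have l: "1 \<le> l" unfolding l_def using t by (intro ln_ge_1)
    have bd: "ennreal \<bar>v x t\<bar> \<le> ennreal (2 * (C * t powr (- k) * l powr (- \<alpha>)))" for x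
    proof -
      have "enn2real (W x t) \<le> enn2real (ennreal (C * t powr (- k) * l powr (- \<alpha>)))"
        using W_le[OF t, of x] unfolding l_def by (intro enn2real_mono) auto
      also have "\<dots> = C * t powr (- k) * l powr (- \<alpha>)"
        using C by simp
      finally show ?thesis
        using u_le[OF t, of x] by (intro ennreal_leI) (simp add: v_def)
    qed
    have "(\<lambda>x. ennreal \<bar>v x t\<bar>) \<in> borel_measurable lebesgue"
      unfolding v_def by (rule borel_measurable_lebesgue) measurable
    then have "esssup lebesgue (\<lambda>x. ennreal \<bar>v x t\<bar>) \<le> ennreal (2 * (C * t powr (- k) * l powr (- \<alpha>)))"
      using bd by (intro esssup_I AE_I2)
    then have "ennreal (t powr k * l powr k) * esssup lebesgue (\<lambda>x. ennreal \<bar>v x t\<bar>)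
       \<le> ennreal (t powr k * l powr k) * ennreal (2 * (C * t powr (- k) * l powr (- \<alpha>)))"
      by (intro mult_left_mono) auto
    also have "\<dots> = ennreal (t powr k * l powr k * (2 * (C * t powr (- k) * l powr (- \<alpha>))))"
      by (rule ennreal_mult'[symmetric]) simp
    \<comment> \<open>The powers of \<open>t\<close> cancel exactly, while the logarithm keeps the
      negative exponent \<open>k - \<alpha>\<close>; since \<open>l\<close> is at least 1, that
      factor is at most 1.\<close>
    also have "t powr k * l powr k * (2 * (C * t powr (- k) * l powr (- \<alpha>))) = 2 * C * l powr (k - \<alpha>)"
      using t by (simp add: powr_diff powr_minus divide_inverse)
    also have "ennreal (2 * C * l powr (k - \<alpha>)) \<le> ennreal (2 * C)"
    proof (intro ennreal_leI mult_left_le)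
      have "l powr (k - \<alpha>) \<le> l powr 0"
        using l k by (intro powr_mono) auto
      then show "l powr (k - \<alpha>) \<le> 1" using l by simp
    qed (use C in simp)
    finally show "ennreal (t powr k * ln (exp 1 + 1 / t) powr k) * esssup lebesgue (\<lambda>x. ennreal \<bar>v x t\<bar>) \<le> ennreal (2 * C)"
      unfolding l_def .
  qed
  ultimately have sup: "(SUP t \<in> {0<..<T}. ul_norm 1 k (T powr (1 / \<theta>)) (\<lambda>x. v x t))
    + (SUP t \<in> {0<..<T}. ennreal (t powr k * ln (exp 1 + 1 / t) powr k)
                        * esssup lebesgue (\<lambda>x. ennreal \<bar>v x t\<bar>)) < \<top>"
    by (auto intro!: ennreal_add_less_top intro: le_less_trans)
  \<comment> \<open>Here the domination constant is the vanishing rate, so the norm of the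
    difference is at most \<open>\<eta> t * C0\<close>.\<close>
  have conv: "((\<lambda>t. ul_norm 1 \<gamma> 1 (\<lambda>x. v x t - semigroup \<theta> t \<phi> x)) \<longlongrightarrow> 0) (at_right 0)" if "\<gamma> < k" for \<gamma>
  proof (rule tendsto_sandwich[OF _ _ tendsto_const])
    show "((\<lambda>t. ennreal (\<eta> t * C0)) \<longlongrightarrow> 0) (at_right 0)"
      using tendsto_ennrealI[OF tendsto_mult_left_zero[OF \<eta>, of C0]] by simp
    have "\<forall>\<^sub>F t in at_right 0. 0 < t \<and> t < T"
      using T by (auto simp: eventually_at_right_field)
    then show "\<forall>\<^sub>F t in at_right 0. ul_norm 1 \<gamma> 1 (\<lambda>x. v x t - semigroup \<theta> t \<phi> x) \<le> ennreal (\<eta> t * C0)"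
    proof eventually_elim
      case (elim t)
      then show ?case
        unfolding semigroup_eq v_def using that k W_fin u_S \<eta>_nn
        by (intro ul_norm_le_of_W[where t = t]) auto
    qed
  qed simp
  have dist: "((\<lambda>t. \<integral>x. v x t * \<psi> x \<partial>lebesgue) \<longlongrightarrow> (\<integral>x. \<phi> x * \<psi> x \<partial>lebesgue)) (at_right 0)" if \<psi>: "test_fun \<psi>" for \<psi>
  proof -
    have cont: "continuous_on UNIV \<psi>"
      using \<psi> by (auto simp: test_fun_def intro: smooth_fun_continuous)
    then have [measurable]: "\<psi> \<in> borel_measurable borel"
      by (rule borel_measurable_continuous_onI)
    define Q where "Q = closure {x. \<psi> x \<noteq> 0}"
    have Q: "compact Q" "\<And>x. x \<notin> Q \<Longrightarrow> \<psi> x = 0"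
      using \<psi> closure_subset[of "{x. \<psi> x \<noteq> 0}"] by (auto simp: test_fun_def Q_def)
    have "(\<integral>x. \<phi> x * \<psi> x \<partial>lebesgue) = (\<integral>x. f x * \<psi> x \<partial>lebesgue)"
    proof (rule integral_cong_AE)
      show "AE x in lebesgue. \<phi> x * \<psi> x = f x * \<psi> x"
        using AE_completion[OF ae] by eventually_elim simp
    qed (intro borel_measurable_times \<phi>_meas f_leb borel_measurable_lebesgue; measurable)+
    also have "\<dots> = (\<integral>x. f x * \<psi> x \<partial>lborel)"
      by (rule borel_integral_lebesgue) measurable
    finally have lim: "(\<integral>x. \<phi> x * \<psi> x \<partial>lebesgue) = (\<integral>x. f x * \<psi> x \<partial>lborel)" .
    have "(\<integral>x. v x t * \<psi> x \<partial>lebesgue) = (\<integral>x. u (x, t) * \<psi> x \<partial>lborel)" for t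
      unfolding v_def by (rule borel_integral_lebesgue) measurable
    then show ?thesis
      unfolding lim using perturbation_tendsto_distribution[OF cont Q u \<eta> T(1) W_fin u_S \<eta>_nn] by simp
  qed
  show ?thesis
    unfolding k_def[symmetric]
    by (intro exI[of _ T] exI[of _ v] conjI allI impI T(1) sol sup dist)
       (rule conv, simp)
qed

end
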